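(* Let $1\le m\le q/p^b$ and let $\mathbf{P}_{m+1}=(P_\infty,P_1,\ldots,P_m)$ on the curve $\mathcal{X}_{a,b,n,s}$. For $(i,j)\in\mathcal{I}$ and $k_2,\ldots,k_{m+1}\in\mathbb{Z}$ let $$\gamma^{i,j,m}_{k_2,\ldots,k_{m+1}}:=\Big(\tfrac{1}{p^b}\big[\big(q^2-mp^b-p^b\textstyle\sum_{\ell=2}^{m+1}k_\ell\big)(q+1)M-iqM-jq^3\big],\ k_2(q+1)M+iM+j,\ \ldots,\ k_{m+1}(q+1)M+iM+j\Big)\in\mathbb{Z}^{m+1}.$$ Then $\Gamma(\mathbf{P}_{m+1})$ is the set of all $\gamma^{i,j,m}_{k_2,\ldots,k_{m+1}}$ (with $(i,j)\in\mathcal{I}$ and $k_2,\ldots,k_{m+1}\in\mathbb{Z}$) that lie in $\mathbb{N}_0^{m+1}$.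
   Context: Let $p$ be a prime, $a\ge 1$, $q=p^a$, and let $n,b,s\ge 1$ be integers with $n$ odd, $b\mid a$, and $s\mid\frac{q^n+1}{q+1}$. Put $M=\frac{q^n+1}{s(q+1)}$ and fix $c\in\mathbb{F}_{q^2}$ with $c^{q-1}=-1$. $\mathcal{X}_{a,b,n,s}$ is the nonsingular projective geometrically irreducible curve over $\mathbb{F}_{q^{2n}}$ given by the affine equations $c\,y^{q+1}=t(x):=\sum_{i=0}^{a/b-1}x^{p^{ib}}$ and $y^{q^2}-y=z^M$. $P_\infty$ is the unique common pole of $x,y,z$; $\alpha_1,\ldots,\alpha_{q/p^b}$ are the distinct roots of $t$, and $P_i$ is the rational point $(x,y,z)=(\alpha_i,0,0)$, $1\le i\le q/p^b$. $\mathcal{I}:=\{(i,j)\in\mathbb{Z}^2: 0\le i\le q,\ 1\le j\le M\}\setminus\{(q,M)\}$; $\mathbb{N}_0$ is the set of nonnegative integers. Generalized Weierstrass semigroup: for an $r$-tuple $\mathbf{Q}=(Q_1,\ldots,Q_r)$ of distinct rational points on a curve, $\widehat{H}(\mathbf{Q})=\{(-v_{Q_1}(h),\ldots,-v_{Q_r}(h)) : h\ne 0 \text{ a rational function regular outside } \{Q_1,\ldots,Q_r\}\}\subseteq\mathbb{Z}^r$, where $v_Q$ is the discrete valuation at $Q$. For $\alpha\in\mathbb{Z}^r$ and nonempty $J\subsetneq\{1,\ldots,r\}$, $\nabla_J(\alpha):=\{\beta\in\widehat{H}(\mathbf{Q}):\beta_j=\alpha_j\ (j\in J),\ \beta_i<\alpha_i\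 (i\notin J)\}$. An element $\alpha\in\widehat{H}(\mathbf{Q})$ is called absolute maximal if $\nabla_J(\alpha)=\emptyset$ for every $J\subsetneq\{1,\ldots,r\}$ with $\#J\ge 2$. $\widehat{\Gamma}(\mathbf{Q})$ is the set of absolute maximal elements of $\widehat{H}(\mathbf{Q})$, and $\Gamma(\mathbf{Q})=\widehat{\Gamma}(\mathbf{Q})\cap\mathbb{N}_0^r$ is the minimal generating set of the Weierstrass semigroup $H(\mathbf{Q})$, the set of $(a_1,\ldots,a_r)\in\mathbb{N}_0^r$ for which some nonzero rational function has pole divisor $\sum_i a_iQ_i$.
   Formalization: The zero tuple, which always lies in Γ but is never one of the γ's, is added to the set; and absolute maximality requires ∇_J(α)=∅ for every nonempty proper J, including singletons, which changes the meaning only for m=1. *)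

theory Defs
  imports Complex_Main "HOL-Computational_Algebra.Polynomial"
begin

text \<open>
  A nonsingular projective geometrically irreducible curve over a finite field \<open>K\<close> is represented
  by its function field: a type \<open>'f\<close> of class field in which \<open>K\<close> is a subfield.  Closed points of
  the curve are the places of \<open>'f\<close> over \<open>K\<close>, given by their normalized discrete valuations, and
  the rational functions on the curve are the elements of \<open>'f\<close>.
\<close>

definition is_subfield :: "'f::field set \<Rightarrow> bool" where
  "is_subfield K \<longleftrightarrow> 0 \<in> K \<and> 1 \<in> K \<and>
     (\<forall>u\<in>K. \<forall>w\<in>K. u - w \<in> K \<and> u * w \<in> K) \<and> (\<forall>u\<in>K. inverse u \<in> K)"

definition field_adjoin :: "'f::field set \<Rightarrow> 'f set \<Rightarrow> 'f set" where
  "field_adjoin K S = \<Inter>{L. is_subfield L \<and> K \<union> S \<subseteq> L}"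

definition algebraic_over :: "'f::field set \<Rightarrow> 'f \<Rightarrow> bool" where
  "algebraic_over K u \<longleftrightarrow> (\<exists>f. f \<noteq> 0 \<and> (\<forall>i. coeff f i \<in> K) \<and> poly f u = 0)"

definition additive_t :: "nat \<Rightarrow> nat \<Rightarrow> nat \<Rightarrow> 'f::field \<Rightarrow> 'f" where
  "additive_t p a b u = (\<Sum>i<a div b. u ^ (p ^ (i * b)))"

text \<open>
  The function field of the curve with affine equations \<open>c y\<^sup>q\<^sup>+\<^sup>1 = t(x)\<close> and
  \<open>y\<^bsup>q\<^sup>2\<^esup> - y = z\<^sup>M\<close>, where \<open>q = p\<^sup>a\<close>.  Over the algebraic closure of \<open>K\<close> the second
  and the first equation define totally ramified extensions of degrees \<open>M\<close> and \<open>q + 1\<close>, so the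
  affine curve is irreducible and these conditions determine \<open>K(x, y, z)\<close> up to isomorphism.
  That \<open>K\<close> is algebraically closed in the function field expresses, as \<open>K\<close> is perfect, that the
  curve is geometrically irreducible.
\<close>

definition curve_function_field ::
  "nat \<Rightarrow> nat \<Rightarrow> nat \<Rightarrow> nat \<Rightarrow> 'f::field set \<Rightarrow> 'f \<Rightarrow> 'f \<Rightarrow> 'f \<Rightarrow> 'f \<Rightarrow> bool" where
  "curve_function_field p a b M K c x y z \<longleftrightarrow>
     is_subfield K \<and> field_adjoin K {x, y, z} = UNIV \<and>
     \<not> algebraic_over K x \<and> (\<forall>u. algebraic_over K u \<longrightarrow> u \<in> K) \<and>
     c * y ^ (p ^ a + 1) = additive_t p a b x \<and>
     y ^ ((p ^ a)\<^sup>2) - y = z ^ M"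

text \<open>
  The value at \<open>0\<close> (which would be infinite) is fixed to \<open>0\<close>, so that two places are equal as
  functions iff they agree on nonzero elements.
\<close>

definition is_place :: "'f::field set \<Rightarrow> ('f \<Rightarrow> int) \<Rightarrow> bool" where
  "is_place K v \<longleftrightarrow> v 0 = 0 \<and>
     (\<forall>u w. u \<noteq> 0 \<longrightarrow> w \<noteq> 0 \<longrightarrow> v (u * w) = v u + v w) \<and>
     (\<forall>u w. u \<noteq> 0 \<longrightarrow> w \<noteq> 0 \<longrightarrow> u + w \<noteq> 0 \<longrightarrow> min (v u) (v w) \<le> v (u + w)) \<and>
     (\<forall>u\<in>K - {0}. v u = 0) \<and>
     v ` (- {0}) = UNIV"

definition vanishes_at :: "('f::field \<Rightarrow> int) \<Rightarrow> 'f \<Rightarrow> bool" where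
  "vanishes_at v h \<longleftrightarrow> h = 0 \<or> v h > 0"

definition is_pole_at :: "('f::field \<Rightarrow> int) \<Rightarrow> 'f \<Rightarrow> bool" where
  "is_pole_at v h \<longleftrightarrow> h \<noteq> 0 \<and> v h < 0"

definition regular_at :: "('f::field \<Rightarrow> int) \<Rightarrow> 'f \<Rightarrow> bool" where
  "regular_at v h \<longleftrightarrow> h = 0 \<or> v h \<ge> 0"

text \<open>
  Tuples of places and tuples of integers are lists; their entries are indexed from \<open>0\<close>.
\<close>

definition generalized_semigroup :: "'f::field set \<Rightarrow> ('f \<Rightarrow> int) list \<Rightarrow> int list set" where
  "generalized_semigroup K Q =
     {map (\<lambda>v. - v h) Q | h. h \<noteq> 0 \<and> (\<forall>v. is_place K v \<and> v \<notin> set Q \<longrightarrow> regular_at v h)}"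

definition nabla ::
  "'f::field set \<Rightarrow> ('f \<Rightarrow> int) list \<Rightarrow> nat set \<Rightarrow> int list \<Rightarrow> int list set" where
  "nabla K Q J \<alpha> = {\<beta> \<in> generalized_semigroup K Q.
     (\<forall>j\<in>J. \<beta> ! j = \<alpha> ! j) \<and> (\<forall>i\<in>{..<length Q} - J. \<beta> ! i < \<alpha> ! i)}"

text \<open>
  An absolute maximal element is maximal (the condition for singletons \<open>J\<close>) and satisfies the
  same condition for all proper \<open>J\<close> with at least two elements.  For tuples of at least three
  rational places the singleton case follows from the others; for pairs there is no proper \<open>J\<close>
  with two elements, and maximality is the whole condition.
\<close>

definition absolute_maximal :: "'f::field set \<Rightarrow> ('f \<Rightarrow> int) list \<Rightarrow> int list \<Rightarrow> bool" where
  "absolute_maximal K Q \<alpha> \<longleftrightarrow> \<alpha> \<in> generalized_semigroup K Q \<and>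
     (\<forall>J. J \<noteq> {} \<and> J \<subset> {..<length Q} \<longrightarrow> nabla K Q J \<alpha> = {})"

definition Gamma_hat :: "'f::field set \<Rightarrow> ('f \<Rightarrow> int) list \<Rightarrow> int list set" where
  "Gamma_hat K Q = {\<alpha>. absolute_maximal K Q \<alpha>}"

text \<open>
  The zero tuple is not excluded: it comes from the constant functions and is absolute maximal,
  because a function without poles is constant.
\<close>

definition Gamma_set :: "'f::field set \<Rightarrow> ('f \<Rightarrow> int) list \<Rightarrow> int list set" where
  "Gamma_set K Q = Gamma_hat K Q \<inter> {\<alpha>. \<forall>e\<in>set \<alpha>. 0 \<le> e}"

definition index_set :: "nat \<Rightarrow> nat \<Rightarrow> (int \<times> int) set" where
  "index_set q M = {(i, j). 0 \<le> i \<and> i \<le> int q \<and> 1 \<le> j \<and> j \<le> int M} - {(int q, int M)}"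

text \<open>
  The entries \<open>k\<^sub>2, \<dots>, k\<^bsub>m+1\<^esub>\<close> are the values of \<open>k\<close> on \<open>{2..m+1}\<close>.  The division is exact,
  as \<open>p\<^sup>b\<close> divides \<open>q = p\<^sup>a\<close>.
\<close>

definition gamma_tuple ::
  "nat \<Rightarrow> nat \<Rightarrow> nat \<Rightarrow> nat \<Rightarrow> nat \<Rightarrow> int \<Rightarrow> int \<Rightarrow> (nat \<Rightarrow> int) \<Rightarrow> int list" where
  "gamma_tuple p b q M m i j k =
     (((int q)\<^sup>2 - int m * int p ^ b - int p ^ b * (\<Sum>l=2..m+1. k l)) * (int q + 1) * int M
        - i * int q * int M - j * int q ^ 3) div (int p ^ b)
     # map (\<lambda>l. k l * (int q + 1) * int M + i * int M + j) [2..<m+2]"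

end

theory Submission
  imports "HOL-Algebra.Algebraic_Closure_Type" Defs
begin

text \<open>
  Put \<open>n = (q + 1) M\<close>.  Eliminating \<open>y\<close> from the two equations gives \<open>z\<^sup>n = G(x)\<close>, with
  \<open>G = w (w\<^bsup>q-1\<^esup> - 1)\<^bsup>q+1\<^esup>\<close> and \<open>w = t / c\<close>, so the function field is a radical extension of degree \<open>n\<close>
  of \<open>K(x)\<close>.  The elements \<open>e\<^sub>s = y\<^sup>i z\<^sup>j\<close> with \<open>s = i M + j\<close>, \<open>0 \<le> i \<le> q\<close>, \<open>0 \<le> j < M\<close>
  form a basis.  The points \<open>P\<^sub>\<infinity>\<close> and \<open>P\<^sub>l\<close> are totally ramified over \<open>K(x)\<close>, and the order of
  \<open>f e\<^sub>s\<close> with \<open>f\<close> in \<open>K(x)\<close> at each of them determines \<open>s\<close> modulo \<open>n\<close>.  Hence at each of these points the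
  order of \<open>h = \<Sum> f\<^sub>s e\<^sub>s\<close> is the smallest order of a component \<open>f\<^sub>s e\<^sub>s\<close>, and it is attained by one
  component only.  By the same argument a pole of \<open>x\<close> or a zero of \<open>x - \<alpha>\<^sub>l\<close> is a single place
  (\<open>place_at_pole_unique\<close>, \<open>place_at_root_unique\<close>).

  The geometric input is \<open>regular_form\<close>: if \<open>h\<close> is regular outside the given points, then so is each
  component, and it has the form \<open>C(x) \<Prod>(x - \<alpha>\<^sub>l)\<^bsup>k\<^sub>l\<^esup> e\<^sub>s\<close> with a polynomial \<open>C\<close> that does not
  vanish at the \<open>\<alpha>\<^sub>l\<close>.  Here one needs enough places: for every \<open>\<beta>\<close> algebraic over \<open>K\<close>, a place
  above \<open>x = \<beta>\<close>, and the conjugates of that place under \<open>z \<mapsto> \<eta> z\<close>, \<open>y \<mapsto> \<eta>\<^sup>M y\<close> with \<open>\<eta>\<^sup>n = 1\<close>.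
  They are obtained from embeddings of the function field into Laurent series in the local parameter
  \<open>z - z\<^sub>0\<close> (\<open>curve_point_series\<close>, \<open>hom_exists\<close>).  Averaging over the conjugates
  (\<open>fourier_components\<close>) separates the components of \<open>h\<close>, and \<open>fibre_orders\<close> says that \<open>e\<^sub>s\<close> never
  vanishes to the order needed to cancel a pole of a coefficient from \<open>K(x)\<close>.

  It remains to compare monomials \<open>\<Prod>(x - \<alpha>\<^sub>l)\<^bsup>k\<^sub>l\<^esup> e\<^sub>s\<close>.  The divisor of \<open>x - \<alpha>\<^sub>l\<close> is
  \<open>n (P\<^sub>l - P\<^sub>\<infinity>)\<close>, so the sum of the orders of a monomial over all given points depends on \<open>s\<close> only.
  A function in \<open>\<nabla>\<^sub>J\<close> of a monomial would have a component with the same \<open>s\<close> and a larger sum of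
  orders, whereas a factor \<open>C(x)\<close> only makes the sum smaller; so monomials are absolute maximal.
  Conversely an absolute maximal element must come from a single component, with \<open>C\<close> constant
  (\<open>Gamma_hat_eq\<close>).  For \<open>s \<noteq> 0\<close> the pole orders of a monomial are the tuple
  \<open>\<gamma>\<close> with \<open>i M + j = n - s\<close>; for \<open>s = 0\<close> they add up to zero, which leaves only the zero tuple
  among the nonnegative ones.
\<close>

section \<open>Polynomials over a subring\<close>

definition is_subring :: "'a::comm_ring_1 set \<Rightarrow> bool" where
  "is_subring D \<longleftrightarrow> 0 \<in> D \<and> 1 \<in> D \<and> (\<forall>u\<in>D. \<forall>w\<in>D. u - w \<in> D \<and> u * w \<in> D)"

lemma is_subring_closed:
  assumes "is_subring D"
  shows "0 \<in> D" "1 \<in> D"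
    "u \<in> D \<Longrightarrow> w \<in> D \<Longrightarrow> u - w \<in> D"
    "u \<in> D \<Longrightarrow> w \<in> D \<Longrightarrow> u * w \<in> D"
    "u \<in> D \<Longrightarrow> - u \<in> D"
    "u \<in> D \<Longrightarrow> w \<in> D \<Longrightarrow> u + w \<in> D"
    "u \<in> D \<Longrightarrow> u ^ k \<in> D"
proof -
  show 1: "0 \<in> D" and 2: "1 \<in> D" and 3: "u \<in> D \<Longrightarrow> w \<in> D \<Longrightarrow> u - w \<in> D"
    and 4: "u \<in> D \<Longrightarrow> w \<in> D \<Longrightarrow> u * w \<in> D" for u w
    using assms by (auto simp: is_subring_def)
  show 5: "u \<in> D \<Longrightarrow> - u \<in> D" for u using 3[OF 1, of u] by simp
  show "u \<in> D \<Longrightarrow> w \<in> D \<Longrightarrow> u + w \<in> D" for u w using 3[OF _ 5, of u w] by simp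
  show "u \<in> D \<Longrightarrow> u ^ k \<in> D" for u by (induction k) (auto intro: 2 4)
qed

lemma is_subring_sum:
  assumes "is_subring D" "\<And>i. i \<in> I \<Longrightarrow> f i \<in> D"
  shows "sum f I \<in> D"
  using assms(2) by (induction I rule: infinite_finite_induct)
    (auto intro: is_subring_closed[OF assms(1)])

lemma is_subring_subfield: "is_subfield K \<Longrightarrow> is_subring K"
  by (auto simp: is_subfield_def is_subring_def)

definition poly_over :: "'a::comm_ring_1 set \<Rightarrow> 'a poly set" where
  "poly_over D = {A. \<forall>i. coeff A i \<in> D}"

lemma poly_over_coeff: "A \<in> poly_over D \<Longrightarrow> coeff A i \<in> D"
  by (simp add: poly_over_def)

lemma is_subring_poly_over:
  assumes "is_subring D"
  shows "is_subring (poly_over D)"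
  unfolding is_subring_def poly_over_def
  by (auto simp: coeff_mult coeff_1 intro!: is_subring_sum[OF assms] is_subring_closed[OF assms])

lemma monom_poly_over:
  assumes "is_subring D" "u \<in> D"
  shows "monom u k \<in> poly_over D"
  using assms by (auto simp: poly_over_def intro: is_subring_closed)

lemma pCons_poly_over:
  assumes "u \<in> D" "A \<in> poly_over D"
  shows "pCons u A \<in> poly_over D"
  using assms by (auto simp: poly_over_def coeff_pCons split: nat.split)

lemma const_poly_over:
  assumes "is_subring D" "u \<in> D"
  shows "[:u:] \<in> poly_over D"
  using assms by (auto intro!: pCons_poly_over intro: is_subring_closed simp: is_subring_poly_over)

lemma linear_poly_over:
  assumes "is_subring D" "u \<in> D"
  shows "[:-u, 1:] \<in> poly_over D"
  using assms by (auto intro!: pCons_poly_over const_poly_over intro: is_subring_closed simp: is_subring_poly_over)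

lemma poly_in_subring:
  assumes "is_subring D" "A \<in> poly_over D" "u \<in> D"
  shows "poly A u \<in> D"
  using assms unfolding poly_altdef
  by (auto intro!: is_subring_sum is_subring_closed poly_over_coeff)

text \<open>
  Long division needs no inverses other than that of the leading coefficient, so quotient and
  remainder have coefficients in the subring generated by the given ones.
\<close>

lemma division_poly_over:
  assumes D: "is_subring D" and P: "P \<in> poly_over D" and B: "B \<in> poly_over D"
    and u: "u \<in> D" "u * lead_coeff B = 1"
  shows "\<exists>Q\<in>poly_over D. \<exists>R\<in>poly_over D. P = Q * B + R \<and> (\<forall>i\<ge>degree B. coeff R i = 0)"
proof -
  note DP = is_subring_poly_over[OF D]
  have "\<exists>Q\<in>poly_over D. \<exists>R\<in>poly_over D. P = Q * B + R \<and> (\<forall>i\<ge>degree B. coeff R i = 0)"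
    if "\<forall>i\<ge>k. coeff P i = 0" "P \<in> poly_over D" for k P
    using that
  proof (induction k arbitrary: P)
    case 0
    then have "P = 0" by (simp add: poly_eq_iff)
    then show ?case
      by (intro bexI[of _ 0]) (auto intro: is_subring_closed[OF DP])
  next
    case (Suc k)
    show ?case
    proof (cases "Suc k \<le> degree B")
      case True
      then show ?thesis using Suc.prems
        by (intro bexI[of _ 0] bexI[of _ P]) (auto intro: is_subring_closed[OF DP])
    next
      case False
      define S where "S = monom (coeff P k * u) (k - degree B)"
      have S: "S \<in> poly_over D"
        unfolding S_def using Suc.prems u
        by (intro monom_poly_over is_subring_closed[OF D] poly_over_coeff D) auto
      have "coeff (P - S * B) i = 0" if "i \<ge> k" for i
      proof (cases "i = k")
        case True
        have "coeff (S * B) k = coeff P k * u * coeff B (k - (k - degree B))"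
          using False by (simp add: S_def coeff_monom_mult)
        also have "k - (k - degree B) = degree B" using False by simp
        also have "coeff P k * u * coeff B (degree B) = coeff P k" using u by (simp add: mult.assoc)
        finally show ?thesis using True by simp
      next
        case False
        then have "coeff P i = 0" using that Suc.prems by auto
        moreover have "coeff B (i - (k - degree B)) = 0"
          using False that \<open>\<not> Suc k \<le> degree B\<close> by (intro coeff_eq_0) auto
        ultimately show ?thesis by (simp add: S_def coeff_monom_mult)
      qed
      moreover have "P - S * B \<in> poly_over D"
        using S B Suc.prems by (intro is_subring_closed[OF DP]) auto
      ultimately obtain Q R where QR: "Q \<in> poly_over D" "R \<in> poly_over D" "P - S * B = Q * B + R"
        "\<forall>i\<ge>degree B. coeff R i = 0"
        using Suc.IH[of "P - S * B"] by blast
      have "P = (Q + S) * B + R" using QR(3) by (simp add: algebra_simps)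
      then show ?thesis using QR S is_subring_closed(6)[OF DP] by blast
    qed
  qed
  from this[of "Suc (degree P)" P] P show ?thesis by (simp add: coeff_eq_0)
qed

lemma linear_factor_poly_over:
  assumes D: "is_subring D" and A: "A \<in> poly_over D" and r: "r \<in> D" "poly A r = 0"
  shows "\<exists>B\<in>poly_over D. A = [:-r, 1:] * B"
proof -
  obtain Q R where QR: "Q \<in> poly_over D" "A = Q * [:-r, 1:] + R" "\<forall>i\<ge>1. coeff R i = 0"
    using division_poly_over[OF D A linear_poly_over[OF D r(1)], of 1] is_subring_closed(2)[OF D] by auto
  have "degree R = 0" using QR(3) by (metis One_nat_def degree_le le_0_eq Suc_leI)
  then obtain d where "R = [:d:]" by (auto elim: degree_eq_zeroE)
  then show ?thesis using QR r(2) by (intro bexI[of _ Q]) (auto simp: mult.commute)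
qed

lemma split_roots_poly_over:
  fixes D :: "'a::idom set"
  assumes D: "is_subring D" and S: "finite S" "S \<subseteq> D" and A: "A \<in> poly_over D" "A \<noteq> 0"
  shows "\<exists>f B. B \<in> poly_over D \<and> (\<forall>r\<in>S. poly B r \<noteq> 0) \<and> A = (\<Prod>r\<in>S. [:-r, 1:] ^ f r) * B"
  using A
proof (induction "degree A" arbitrary: A rule: less_induct)
  case less
  show ?case
  proof (cases "\<exists>r\<in>S. poly A r = 0")
    case False
    then show ?thesis using less.prems by (intro exI[of _ "\<lambda>_. 0"] exI[of _ A]) auto
  next
    case True
    then obtain r where r: "r \<in> S" "poly A r = 0" by blast
    then obtain A' where A': "A' \<in> poly_over D" "A = [:-r, 1:] * A'"
      using linear_factor_poly_over[OF D less.prems(1)] S by blast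
    have "A' \<noteq> 0" using A' less.prems by auto
    moreover then have "degree A = Suc (degree A')" using A' by (simp add: degree_mult_eq del: mult_pCons_left)
    ultimately obtain f B where fB: "B \<in> poly_over D" "\<forall>r\<in>S. poly B r \<noteq> 0"
      "A' = (\<Prod>r\<in>S. [:-r, 1:] ^ f r) * B"
      using less.hyps[of A'] A' by auto
    have "(\<Prod>t\<in>S. [:-t, 1:] ^ (f(r := Suc (f r))) t) = [:-r, 1:] * (\<Prod>t\<in>S. [:-t, 1:] ^ f t)"
      using r(1) S(1) by (simp add: prod.remove[of S r] mult.assoc del: mult_pCons_left)
    then have "A = (\<Prod>t\<in>S. [:-t, 1:] ^ (f(r := Suc (f r))) t) * B"
      using A'(2) fB(3) by (simp only: mult.assoc)
    then show ?thesis using fB by blast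
  qed
qed

text \<open>
  Gaussian elimination by cross-multiplication instead of division keeps all coefficients in the
  subring.
\<close>

lemma linear_dependence:
  fixes D :: "'a::idom set" and coord :: "'i \<Rightarrow> 'j \<Rightarrow> 'a"
  assumes D: "is_subring D" and "finite J" "finite I" "card J < card I"
    and "\<And>i j. i \<in> I \<Longrightarrow> j \<in> J \<Longrightarrow> coord i j \<in> D"
  shows "\<exists>d. (\<forall>i\<in>I. d i \<in> D) \<and> (\<exists>i\<in>I. d i \<noteq> 0) \<and> (\<forall>j\<in>J. (\<Sum>i\<in>I. d i * coord i j) = 0)"
  using assms(2-)
proof (induction J arbitrary: I coord rule: finite_induct)
  case empty
  then obtain i where "i \<in> I" by fastforce
  then show ?case by (intro exI[of _ "\<lambda>_. 1"]) (auto intro: is_subring_closed[OF D])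
next
  case (insert j J)
  show ?case
  proof (cases "\<forall>i\<in>I. coord i j = 0")
    case True
    have "\<exists>d. (\<forall>i\<in>I. d i \<in> D) \<and> (\<exists>i\<in>I. d i \<noteq> 0) \<and> (\<forall>j\<in>J. (\<Sum>i\<in>I. d i * coord i j) = 0)"
      using insert.prems insert.hyps by (intro insert.IH) auto
    then show ?thesis using True by auto
  next
    case False
    then obtain i0 where i0: "i0 \<in> I" "coord i0 j \<noteq> 0" by blast
    define I' where "I' = I - {i0}"
    define coord' where "coord' i j' = coord i0 j * coord i j' - coord i j * coord i0 j'" for i j'
    have fin: "finite I'" and I: "I = insert i0 I'" and ni: "i0 \<notin> I'"
      using i0 insert.prems by (auto simp: I'_def)
    have "\<exists>d. (\<forall>i\<in>I'. d i \<in> D) \<and> (\<exists>i\<in>I'. d i \<noteq> 0) \<and> (\<forall>j\<in>J. (\<Sum>i\<in>I'. d i * coord' i j) = 0)"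
    proof (rule insert.IH)
      show "card J < card I'" using insert.prems insert.hyps fin ni unfolding I by simp
      show "coord' i j' \<in> D" if "i \<in> I'" "j' \<in> J" for i j'
        unfolding coord'_def using that insert.prems(3) i0 
        by (intro is_subring_closed[OF D]) (auto simp: I'_def)
    qed (use fin in auto)
    then obtain d where d: "\<forall>i\<in>I'. d i \<in> D" "\<exists>i\<in>I'. d i \<noteq> 0" "\<forall>j\<in>J. (\<Sum>i\<in>I'. d i * coord' i j) = 0"
      by blast
    define e where "e i = (if i = i0 then - (\<Sum>i\<in>I'. d i * coord i j) else d i * coord i0 j)" for i
    have e: "(\<Sum>i\<in>I. e i * coord i j') = (\<Sum>i\<in>I'. d i * coord' i j')" for j'
    proof -
      have "(\<Sum>i\<in>I. e i * coord i j') = e i0 * coord i0 j' + (\<Sum>i\<in>I'. e i * coord i j')"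
        using fin ni by (simp add: I)
      also have "(\<Sum>i\<in>I'. e i * coord i j') = (\<Sum>i\<in>I'. d i * coord i0 j * coord i j')"
        using ni by (intro sum.cong) (auto simp: e_def)
      finally show ?thesis
        by (simp add: e_def coord'_def sum_distrib_right sum_subtractf right_diff_distrib mult.assoc)
    qed
    show ?thesis
    proof (intro exI[of _ e] conjI ballI)
      show "e i \<in> D" if "i \<in> I" for i
        using that d insert.prems(3) i0 unfolding e_def
        by (auto intro!: is_subring_closed[OF D] is_subring_sum[OF D] simp: I)
      show "\<exists>i\<in>I. e i \<noteq> 0"
        using d(2) i0(2) ni by (auto simp: e_def I)
      show "(\<Sum>i\<in>I. e i * coord i j') = 0" if "j' \<in> insert j J" for j'
        unfolding e using that d(3) by (auto simp: coord'_def mult.commute)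
    qed
  qed
qed

section \<open>Homomorphisms out of a simple radical extension of a rational function field\<close>

definition is_hom :: "('a::comm_ring_1 \<Rightarrow> 'b::comm_ring_1) \<Rightarrow> bool" where
  "is_hom f \<longleftrightarrow> f 0 = 0 \<and> f 1 = 1 \<and> (\<forall>u w. f (u + w) = f u + f w) \<and> (\<forall>u w. f (u * w) = f u * f w)"

lemma is_hom_simps:
  assumes "is_hom f"
  shows "f 0 = 0" "f 1 = 1" "f (u + w) = f u + f w" "f (u * w) = f u * f w"
    "f (- u) = - f u" "f (u - w) = f u - f w" "f (u ^ k) = f u ^ k" "f (sum g I) = (\<Sum>i\<in>I. f (g i))"
proof -
  show 0: "f 0 = 0" and 1: "f 1 = 1" and a: "f (u + w) = f u + f w" and m: "f (u * w) = f u * f w" for u w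
    using assms by (auto simp: is_hom_def)
  show n: "f (- u) = - f u" for u
    using a[of u "- u"] 0 by (simp add: eq_neg_iff_add_eq_0 add.commute)
  show "f (u - w) = f u - f w" using a[of u "- w"] n[of w] by simp
  show "f (u ^ k) = f u ^ k" by (induction k) (auto simp: 1 m)
  show "f (sum g I) = (\<Sum>i\<in>I. f (g i))" by (induction I rule: infinite_finite_induct) (auto simp: 0 a)
qed

lemma is_hom_field:
  fixes f :: "'a::field \<Rightarrow> 'b::field"
  assumes "is_hom f"
  shows "f u = 0 \<longleftrightarrow> u = 0" "f (inverse u) = inverse (f u)" "f (u / w) = f u / f w"
proof -
  note h = is_hom_simps[OF assms]
  have i: "f u * f (inverse u) = 1" if "u \<noteq> 0" for u using h(4)[of u "inverse u"] h(2) that by simp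
  show "f u = 0 \<longleftrightarrow> u = 0" for u using i[of u] h(1) by force
  show inv: "f (inverse u) = inverse (f u)" for u
    using i[of u] h(1) by (cases "u = 0") (auto simp: inverse_unique)
  show "f (u / w) = f u / f w" by (simp add: divide_inverse h inv)
qed

lemma is_hom_comp: "is_hom f \<Longrightarrow> is_hom g \<Longrightarrow> is_hom (\<lambda>u. g (f u))"
  by (simp add: is_hom_def)

lemma map_poly_pCons_hom:
  assumes "is_hom f"
  shows "map_poly f (pCons u A) = pCons (f u) (map_poly f A)"
  by (simp add: poly_eq_iff coeff_map_poly coeff_pCons is_hom_simps[OF assms] split: nat.split)

lemma is_hom_map_poly:
  assumes "is_hom f"
  shows "is_hom (map_poly f)"
  unfolding is_hom_def
  by (auto simp: poly_eq_iff coeff_map_poly coeff_mult coeff_1 is_hom_simps[OF assms])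

lemma is_hom_poly: "is_hom (\<lambda>A. poly A u)"
  by (simp add: is_hom_def)

lemma poly_map_poly_hom:
  assumes "is_hom f"
  shows "poly (map_poly f A) (f u) = f (poly A u)"
  by (induction A) (simp_all add: map_poly_pCons_hom[OF assms] is_hom_simps[OF assms])

text \<open>
  A polynomial with polynomial coefficients stands for a polynomial in two variables; \<open>u\<close> is the
  value of the inner variable and \<open>w\<close> that of the outer one.
\<close>

definition eval2 :: "'a::comm_ring_1 poly poly \<Rightarrow> 'a \<Rightarrow> 'a \<Rightarrow> 'a" where
  "eval2 P u w = poly (poly P [:w:]) u"

lemma eval2_simps [simp]:
  "eval2 (P + Q) u w = eval2 P u w + eval2 Q u w"
  "eval2 (P * Q) u w = eval2 P u w * eval2 Q u w"
  "eval2 (P ^ k) u w = eval2 P u w ^ k"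
  "eval2 0 u w = 0" "eval2 1 u w = 1"
  "eval2 [:A:] u w = poly A u" "eval2 (smult A P) u w = poly A u * eval2 P u w"
  by (auto simp: eval2_def)

lemma eval2_diff [simp]:
  "eval2 (P - Q) u w = eval2 P u w - eval2 Q u w" "eval2 (- P) u w = - eval2 P u w"
  by (auto simp: eval2_def)

lemma eval2_sum: "eval2 (sum f I) u w = (\<Sum>i\<in>I. eval2 (f i) u w)"
  by (auto simp: eval2_def poly_sum)

lemma eval2_monom [simp]: "eval2 (monom A k) u w = poly A u * w ^ k"
  by (simp add: eval2_def poly_monom)

lemma eval2_altdef:
  assumes "\<forall>i\<ge>k. coeff P i = 0"
  shows "eval2 P u w = (\<Sum>i<k. poly (coeff P i) u * w ^ i)"
proof -
  have "P = (\<Sum>i<k. monom (coeff P i) i)"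
    using assms by (auto simp: poly_eq_iff coeff_sum)
  then have "eval2 P u w = eval2 (\<Sum>i<k. monom (coeff P i) i) u w" by simp
  then show ?thesis by (simp add: eval2_sum)
qed

text \<open>
  The last assumption says that \<open>z\<close> has degree \<open>n\<close> over \<open>K(x)\<close>; denominators are cleared, so that
  only polynomials in \<open>x\<close> occur.
\<close>

locale radical_extension =
  fixes K :: "'f::field set" and x z :: 'f and n :: nat and G :: "'f poly"
  assumes subfield: "is_subfield K"
    and generated: "field_adjoin K {x, z} = UNIV"
    and transcendental: "\<And>A. A \<in> poly_over K \<Longrightarrow> A \<noteq> 0 \<Longrightarrow> poly A x \<noteq> 0"
    and G: "G \<in> poly_over K"
    and n_pos: "n > 0"
    and z_power: "z ^ n = poly G x"
    and independent: "\<And>A. (\<And>s. s < n \<Longrightarrow> A s \<in> poly_over K) \<Longrightarrow> (\<Sum>s<n. poly (A s) x * z ^ s) = 0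
      \<Longrightarrow> \<forall>s<n. A s = 0"
begin

lemma K_subring: "is_subring K"
  using subfield by (rule is_subring_subfield)

lemmas K_closed = is_subring_closed[OF K_subring]
lemmas KX_subring = is_subring_poly_over[OF K_subring]
lemmas KX_closed = is_subring_closed[OF KX_subring]
lemmas KXZ_subring = is_subring_poly_over[OF KX_subring]
lemmas KXZ_closed = is_subring_closed[OF KXZ_subring]

lemma reduce:
  assumes "P \<in> poly_over (poly_over K)"
  shows "\<exists>Q\<in>poly_over (poly_over K). \<exists>R\<in>poly_over (poly_over K).
    P = Q * (monom 1 n - [:G:]) + R \<and> (\<forall>i\<ge>n. coeff R i = 0)"
proof -
  have B: "monom 1 n - [:G:] \<in> poly_over (poly_over K)"
    using G by (intro KXZ_closed monom_poly_over KX_subring const_poly_over KX_closed)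
  have d: "degree (monom 1 n - [:G:]) = n"
    using n_pos by (subst diff_conv_add_uminus, subst degree_add_eq_left) (auto simp: degree_monom_eq)
  then have l: "1 * lead_coeff (monom 1 n - [:G:]) = 1"
    using n_pos by (simp add: coeff_pCons split: nat.split)
  from division_poly_over[OF KX_subring assms B _ l] KX_closed(2) show ?thesis unfolding d by blast
qed

lemma reduce_eval:
  assumes "P \<in> poly_over (poly_over K)"
  shows "\<exists>R\<in>poly_over (poly_over K). eval2 R x z = eval2 P x z \<and> (\<forall>i\<ge>n. coeff R i = 0)"
proof -
  obtain Q R where "R \<in> poly_over (poly_over K)" "P = Q * (monom 1 n - [:G:]) + R" "\<forall>i\<ge>n. coeff R i = 0"
    using reduce[OF assms] by blast
  then show ?thesis by (intro bexI[of _ R]) (auto simp: z_power)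
qed

text \<open>
  The powers \<open>1, u, \<dots>, u\<^sup>n\<close> of an element \<open>u\<close> of \<open>K[x, z]\<close> are linearly dependent over \<open>K[x]\<close>;
  the lowest nonzero coefficient of a relation between them is a multiple of \<open>u\<close>.
\<close>

lemma nonzero_multiple_in_base:
  assumes P: "P \<in> poly_over (poly_over K)" and nz: "eval2 P x z \<noteq> 0"
  shows "\<exists>P'\<in>poly_over (poly_over K). \<exists>A\<in>poly_over K. A \<noteq> 0 \<and> eval2 P x z * eval2 P' x z = poly A x"
proof -
  let ?u = "eval2 P x z"
  have "\<forall>k. \<exists>R\<in>poly_over (poly_over K). eval2 R x z = ?u ^ k \<and> (\<forall>i\<ge>n. coeff R i = 0)"
  proof
    fix k
    have "P ^ k \<in> poly_over (poly_over K)" using P by (rule KXZ_closed)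
    from reduce_eval[OF this] show "\<exists>R\<in>poly_over (poly_over K). eval2 R x z = ?u ^ k \<and> (\<forall>i\<ge>n. coeff R i = 0)"
      by simp
  qed
  then obtain R where R: "\<And>k. R k \<in> poly_over (poly_over K)" "\<And>k. eval2 (R k) x z = ?u ^ k"
    "\<And>k. \<forall>i\<ge>n. coeff (R k) i = 0" by metis
  obtain d where d: "\<forall>k\<in>{..n}. d k \<in> poly_over K" "\<exists>k\<in>{..n}. d k \<noteq> 0"
    "\<forall>s\<in>{..<n}. (\<Sum>k\<in>{..n}. d k * coeff (R k) s) = 0"
    using linear_dependence[OF KX_subring finite_lessThan[of n] finite_atMost[of n], of "\<lambda>k s. coeff (R k) s"]
      poly_over_coeff[OF R(1)] by (simp add: Bex_def Ball_def) blast
  have "(\<Sum>k\<le>n. poly (d k) x * ?u ^ k) = (\<Sum>k\<le>n. \<Sum>s<n. poly (d k) x * (poly (coeff (R k) s) x * z ^ s))"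
    by (subst R(2)[symmetric], subst eval2_altdef[OF R(3)]) (simp add: sum_distrib_left)
  also have "\<dots> = (\<Sum>s<n. poly (\<Sum>k\<le>n. d k * coeff (R k) s) x * z ^ s)"
    by (subst sum.swap) (simp add: poly_sum sum_distrib_right mult.assoc)
  also have "\<dots> = 0" using d(3) by simp
  finally have rel: "(\<Sum>k\<le>n. poly (d k) x * ?u ^ k) = 0" .
  define r where "r = (LEAST k. d k \<noteq> 0)"
  obtain k0 where k0: "k0 \<le> n" "d k0 \<noteq> 0" using d(2) by auto
  have r: "d r \<noteq> 0" "\<And>k. k < r \<Longrightarrow> d k = 0" "r \<le> n"
    unfolding r_def using LeastI[of "\<lambda>k. d k \<noteq> 0", OF k0(2)] Least_le[of "\<lambda>k. d k \<noteq> 0", OF k0(2)] k0(1)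
    by (auto dest: not_less_Least)
  define P' where "P' = (\<Sum>k\<in>{r<..n}. - ([:d k:] * P ^ (k - r - 1)))"
  have P': "P' \<in> poly_over (poly_over K)"
    unfolding P'_def using d P
    by (intro is_subring_sum KXZ_subring KXZ_closed const_poly_over KX_subring) auto
  have "{..n} = {..<r} \<union> ({r} \<union> {r<..n})" using r(3) by auto
  then have "0 = (\<Sum>k\<in>{..<r} \<union> ({r} \<union> {r<..n}). poly (d k) x * ?u ^ k)" using rel by simp
  also have "\<dots> = poly (d r) x * ?u ^ r + (\<Sum>k\<in>{r<..n}. poly (d k) x * ?u ^ k)"
  proof -
    have "(\<Sum>k\<in>{..<r} \<union> ({r} \<union> {r<..n}). poly (d k) x * ?u ^ k)
        = (\<Sum>k\<in>{..<r}. poly (d k) x * ?u ^ k) + (\<Sum>k\<in>{r} \<union> {r<..n}. poly (d k) x * ?u ^ k)"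
      by (rule sum.union_disjoint) auto
    also have "(\<Sum>k\<in>{..<r}. poly (d k) x * ?u ^ k) = 0" using r(2) by simp
    finally show ?thesis by simp
  qed
  also have "(\<Sum>k\<in>{r<..n}. poly (d k) x * ?u ^ k) = - (?u ^ r * (?u * eval2 P' x z))"
    unfolding P'_def eval2_sum sum_distrib_left sum_negf[symmetric]
  proof (intro sum.cong refl)
    fix k assume "k \<in> {r<..n}"
    then have "?u ^ k = ?u ^ r * (?u * ?u ^ (k - r - 1))"
      by (simp flip: power_add power_Suc)
    then show "poly (d k) x * ?u ^ k = - (?u ^ r * (?u * eval2 (- ([:d k:] * P ^ (k - r - 1))) x z))"
      by (simp add: algebra_simps)
  qed
  finally have "?u ^ r * (?u * eval2 P' x z) = ?u ^ r * poly (d r) x"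
    by (metis add_uminus_conv_diff mult.commute right_minus_eq)
  then have "?u * eval2 P' x z = poly (d r) x" using nz by (metis mult_cancel_left power_not_zero)
  then show ?thesis using P' d(1) r by auto
qed

lemma fraction_form:
  obtains P A where "P \<in> poly_over (poly_over K)" "A \<in> poly_over K" "A \<noteq> 0" "u = eval2 P x z / poly A x"
proof -
  define L where "L = {eval2 P x z / poly A x | P A. P \<in> poly_over (poly_over K) \<and> A \<in> poly_over K \<and> A \<noteq> 0}"
  have LI: "eval2 P x z / poly A x \<in> L" if "P \<in> poly_over (poly_over K)" "A \<in> poly_over K" "A \<noteq> 0" for P A
    using that by (auto simp: L_def)
  have KL: "poly A x \<in> L" if "A \<in> poly_over K" for A
    using LI[of "[:A:]" 1] that by (auto intro: const_poly_over KX_subring KX_closed)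
  have "is_subfield L"
    unfolding is_subfield_def
  proof (intro conjI ballI)
    show "0 \<in> L" "1 \<in> L" using KL[of 0] KL[of 1] KX_closed by auto
    fix u w assume "u \<in> L" "w \<in> L"
    then obtain P A P' A' where *: "P \<in> poly_over (poly_over K)" "A \<in> poly_over K" "A \<noteq> 0" "u = eval2 P x z / poly A x"
      "P' \<in> poly_over (poly_over K)" "A' \<in> poly_over K" "A' \<noteq> 0" "w = eval2 P' x z / poly A' x"
      by (auto simp: L_def)
    have nz: "poly A x \<noteq> 0" "poly A' x \<noteq> 0" using * transcendental by auto
    have "u - w = eval2 ([:A':] * P - [:A:] * P') x z / poly (A * A') x"
      using nz unfolding *(4,8) by (simp add: diff_frac_eq mult.commute)
    also have "\<dots> \<in> L" using *
      by (intro LI KXZ_closed const_poly_over KX_subring KX_closed) auto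
    finally show "u - w \<in> L" .
    have "u * w = eval2 (P * P') x z / poly (A * A') x" using * by simp
    also have "\<dots> \<in> L" using *
      by (intro LI KXZ_closed const_poly_over KX_subring KX_closed) auto
    finally show "u * w \<in> L" .
  next
    fix u assume "u \<in> L"
    then obtain P A where *: "P \<in> poly_over (poly_over K)" "A \<in> poly_over K" "A \<noteq> 0" "u = eval2 P x z / poly A x"
      by (auto simp: L_def)
    have nz: "poly A x \<noteq> 0" using * transcendental by auto
    show "inverse u \<in> L"
    proof (cases "u = 0")
      case True
      then show ?thesis using KL[of 0] KX_closed by auto
    next
      case False
      then have u: "eval2 P x z \<noteq> 0" using * by auto
      obtain P' B where **: "P' \<in> poly_over (poly_over K)" "B \<in> poly_over K" "B \<noteq> 0" "eval2 P x z * eval2 P' x z = poly B x"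
        using nonzero_multiple_in_base[OF *(1) u] by blast
      have "inverse u = eval2 ([:A:] * P') x z / poly B x"
        using u nz transcendental[OF **(2,3)] by (simp add: *(4) **(4)[symmetric] field_simps)
      also have "\<dots> \<in> L" using * ** 
        by (intro LI KXZ_closed const_poly_over KX_subring KX_closed) auto
      finally show ?thesis .
    qed
  qed
  moreover have "K \<union> {x, z} \<subseteq> L"
  proof -
    have "k \<in> L" if "k \<in> K" for k using KL[of "[:k:]"] that const_poly_over[OF K_subring] by auto
    moreover have "x \<in> L" using KL[of "[:-0, 1:]"] linear_poly_over[OF K_subring K_closed(1)] by simp
    moreover have "z \<in> L" using LI[of "[:-0, 1:]" 1] linear_poly_over[OF KX_subring KX_closed(1)] KX_closed
      by (simp add: eval2_def)
    ultimately show ?thesis by auto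
  qed
  ultimately have "field_adjoin K {x, z} \<subseteq> L" by (auto simp: field_adjoin_def)
  then have "u \<in> L" using generated by auto
  then show thesis using that by (auto simp: L_def)
qed

lemma component_form:
  obtains A B where "\<forall>s. A s \<in> poly_over K" "B \<in> poly_over K" "B \<noteq> 0"
    "u = (\<Sum>s<n. poly (A s) x * z ^ s) / poly B x"
proof -
  obtain P B where P: "P \<in> poly_over (poly_over K)" "B \<in> poly_over K" "B \<noteq> 0" "u = eval2 P x z / poly B x"
    by (rule fraction_form)
  obtain R where R: "R\<in>poly_over (poly_over K)" "eval2 R x z = eval2 P x z" "\<forall>i\<ge>n. coeff R i = 0"
    using reduce_eval[OF P(1)] by blast
  show thesis
    using that[of "coeff R" B] P R poly_over_coeff eval2_altdef[OF R(3), of x z] by metis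
qed

text \<open>
  By independence a relation \<open>P(x, z) = 0\<close> is a consequence of \<open>z\<^sup>n = G(x)\<close>.  So it also holds
  for any other solution \<open>(x', z')\<close> of that equation, and \<open>x \<mapsto> x'\<close>, \<open>z \<mapsto> z'\<close> is well defined on
  \<open>K[x, z]\<close>; it extends to fractions with denominators in \<open>K[x]\<close>, which are all elements.
\<close>

lemma hom_exists:
  fixes \<psi> :: "'f \<Rightarrow> 'l::field"
  assumes \<psi>: "is_hom \<psi>"
    and tr: "\<And>A. A \<in> poly_over K \<Longrightarrow> A \<noteq> 0 \<Longrightarrow> poly (map_poly \<psi> A) x' \<noteq> 0"
    and z': "z' ^ n = poly (map_poly \<psi> G) x'"
  shows "\<exists>\<phi>. is_hom \<phi> \<and> (\<forall>k\<in>K. \<phi> k = \<psi> k) \<and> \<phi> x = x' \<and> \<phi> z = z'"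
proof -
  note \<psi>h = is_hom_simps[OF \<psi>]
  define ev where "ev P = eval2 (map_poly (map_poly \<psi>) P) x' z'" for P
  have "is_hom ev"
    unfolding ev_def eval2_def
    by (intro is_hom_comp[OF is_hom_comp[OF _ is_hom_poly] is_hom_poly] is_hom_map_poly \<psi>)
  note evh = is_hom_simps[OF this]
  note pC = map_poly_pCons_hom[OF \<psi>] map_poly_pCons_hom[OF is_hom_map_poly[OF \<psi>]]
  have ev: "ev (P + Q) = ev P + ev Q" "ev (P * Q) = ev P * ev Q" "ev 0 = 0" "ev 1 = 1" "ev [:A:] = poly (map_poly \<psi> A) x'" for P Q A
    using evh by (simp_all add: ev_def pC)
  have evs: "ev (smult A P) = poly (map_poly \<psi> A) x' * ev P" for P A
    using ev(2)[of "[:A:]" P] ev(5) by simp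
  have h1: "poly (map_poly \<psi> (A * B)) u = poly (map_poly \<psi> A) u * poly (map_poly \<psi> B) u" "map_poly \<psi> 1 = 1" for A B u
    using is_hom_simps[OF is_hom_map_poly[OF \<psi>]] by simp_all
  have evd: "ev (P - Q) = ev P - ev Q" for P Q
    using ev(1)[of "P - Q" Q] by simp
  \<comment> \<open>A polynomial that vanishes at \<open>(x, z)\<close> has remainder \<open>0\<close> modulo \<open>Z\<^sup>n - G\<close>.\<close>
  have kernel: "ev P = 0" if P: "P \<in> poly_over (poly_over K)" "eval2 P x z = 0" for P
  proof -
    obtain Q R where R: "R \<in> poly_over (poly_over K)" "P = Q * (monom 1 n - [:G:]) + R" "\<forall>i\<ge>n. coeff R i = 0"
      using reduce[OF P(1)] by blast
    then have "eval2 R x z = 0" using P(2) by (simp add: z_power)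
    then have "\<forall>s<n. coeff R s = 0"
      using independent[of "coeff R"] R poly_over_coeff eval2_altdef[OF R(3), of x z] by metis
    then have "R = 0" using R(3) by (metis coeff_0 not_le poly_eqI)
    moreover have "ev (monom 1 n) = z' ^ n"
      by (simp add: ev_def map_poly_monom h1)
    ultimately show ?thesis using R(2) z' by (simp add: ev evd)
  qed
  define \<phi> where "\<phi> u = (SOME w. \<exists>P A. P \<in> poly_over (poly_over K) \<and> A \<in> poly_over K \<and> A \<noteq> 0 \<and>
    u = eval2 P x z / poly A x \<and> w = ev P / ev [:A:])" for u
  have \<phi>: "\<phi> (eval2 P x z / poly A x) = ev P / ev [:A:]"
    if P: "P \<in> poly_over (poly_over K)" "A \<in> poly_over K" "A \<noteq> 0" for P A
  proof -
    let ?Q = "\<lambda>w P' A'. P' \<in> poly_over (poly_over K) \<and> A' \<in> poly_over K \<and> A' \<noteq> 0 \<and>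
        eval2 P x z / poly A x = eval2 P' x z / poly A' x \<and> w = ev P' / ev [:A':]"
    have "\<exists>P' A'. ?Q (\<phi> (eval2 P x z / poly A x)) P' A'"
      unfolding \<phi>_def
      by (rule someI_ex[of "\<lambda>w. \<exists>P' A'. ?Q w P' A'"]) (use P in blast)
    then obtain P' A' where *: "P' \<in> poly_over (poly_over K)" "A' \<in> poly_over K" "A' \<noteq> 0"
        "eval2 P x z / poly A x = eval2 P' x z / poly A' x" "\<phi> (eval2 P x z / poly A x) = ev P' / ev [:A':]"
      by blast
    have "eval2 ([:A':] * P - [:A:] * P') x z = 0"
      using *(4) transcendental[OF P(2,3)] transcendental[OF *(2,3)] by (simp add: field_simps)
    then have "ev ([:A':] * P - [:A:] * P') = 0"
      by (intro kernel KXZ_closed const_poly_over KX_subring) (use P * in auto)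
    then have "ev P * ev [:A':] = ev P' * ev [:A:]" by (simp add: ev evd evs mult.commute)
    then show ?thesis using *(5) tr[OF P(2,3)] tr[OF *(2,3)] by (simp add: ev frac_eq_eq)
  qed
  have K1: "1 \<in> poly_over K" "(1::'f poly) \<noteq> 0" using KX_closed by auto
  have ev1: "ev [:1:] = 1" by (simp add: ev h1)
  have base: "\<phi> (poly A x) = poly (map_poly \<psi> A) x'" if "A \<in> poly_over K" for A
    using \<phi>[of "[:A:]" 1] that K1 ev1 const_poly_over[OF KX_subring] by (simp add: ev)
  have k: "\<phi> k = \<psi> k" if "k \<in> K" for k
    using base[of "[:k:]"] that const_poly_over[OF K_subring] by (simp add: pC)
  have x: "\<phi> x = x'"
    using base[of "[:-0,1:]"] linear_poly_over[OF K_subring K_closed(1)] by (simp add: pC \<psi>h)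
  have Z: "[:0, 1:] \<in> poly_over (poly_over K)" using linear_poly_over[OF KX_subring KX_closed(1)] by simp
  have z: "\<phi> z = z'"
    using \<phi>[OF Z K1] ev1 by (simp add: ev ev_def pC h1 eval2_def)
  have "is_hom \<phi>"
    unfolding is_hom_def
  proof (intro conjI allI)
    show "\<phi> 0 = 0" "\<phi> 1 = 1" using k[of 0] k[of 1] K_closed \<psi>h by auto
    fix u w
    obtain P A where P: "P \<in> poly_over (poly_over K)" "A \<in> poly_over K" "A \<noteq> 0" "u = eval2 P x z / poly A x"
      by (rule fraction_form)
    obtain P' A' where P': "P' \<in> poly_over (poly_over K)" "A' \<in> poly_over K" "A' \<noteq> 0" "w = eval2 P' x z / poly A' x"
      by (rule fraction_form)
    note nz = transcendental[OF P(2,3)] transcendental[OF P'(2,3)]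
    note nz' = tr[OF P(2,3)] tr[OF P'(2,3)]
    have "u + w = eval2 ([:A':] * P + [:A:] * P') x z / poly (A * A') x"
      using nz unfolding P(4) P'(4) by (simp add: add_frac_eq mult.commute)
    also have "\<phi> \<dots> = ev ([:A':] * P + [:A:] * P') / ev [:A * A':]" using P P'
      by (intro \<phi> KXZ_closed const_poly_over KX_subring KX_closed) auto
    also have "\<dots> = \<phi> u + \<phi> w" using nz' P P' by (simp add: \<phi> ev evs h1 field_simps)
    finally show "\<phi> (u + w) = \<phi> u + \<phi> w" .
    have "u * w = eval2 (P * P') x z / poly (A * A') x"
      unfolding P(4) P'(4) by simp
    also have "\<phi> \<dots> = ev (P * P') / ev [:A * A':]" using P P'
      by (intro \<phi> KXZ_closed const_poly_over KX_subring KX_closed) auto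
    also have "\<dots> = \<phi> u * \<phi> w" using nz' P P' by (simp add: \<phi> ev evs h1 field_simps)
    finally show "\<phi> (u * w) = \<phi> u * \<phi> w" .
  qed
  then show ?thesis using k x z by blast
qed

end

section \<open>Valuations\<close>

definition valuation :: "('a::field \<Rightarrow> int) \<Rightarrow> bool" where
  "valuation v \<longleftrightarrow> v 0 = 0 \<and>
     (\<forall>u w. u \<noteq> 0 \<longrightarrow> w \<noteq> 0 \<longrightarrow> v (u * w) = v u + v w) \<and>
     (\<forall>u w. u \<noteq> 0 \<longrightarrow> w \<noteq> 0 \<longrightarrow> u + w \<noteq> 0 \<longrightarrow> min (v u) (v w) \<le> v (u + w))"

lemma is_place_iff:
  "is_place K v \<longleftrightarrow> valuation v \<and> (\<forall>u\<in>K - {0}. v u = 0) \<and> v ` (- {0}) = UNIV"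
  by (auto simp: is_place_def valuation_def)

lemma valuation_mult: "valuation v \<Longrightarrow> u \<noteq> 0 \<Longrightarrow> w \<noteq> 0 \<Longrightarrow> v (u * w) = v u + v w"
  by (auto simp: valuation_def)

lemma valuation_0: "valuation v \<Longrightarrow> v 0 = 0"
  by (auto simp: valuation_def)

lemma valuation_1:
  assumes "valuation v"
  shows "v 1 = 0"
  using valuation_mult[OF assms, of 1 1] by simp

lemma valuation_minus:
  assumes "valuation v"
  shows "v (- u) = v u"
proof (cases "u = 0")
  case False
  have "2 * v (- 1) = 0"
    using valuation_mult[OF assms, of "- 1" "- 1"] valuation_1[OF assms] by simp
  then show ?thesis using valuation_mult[OF assms, of "- 1" u] False by simp
qed simp

lemma valuation_power:
  assumes "valuation v" 
  shows "u \<noteq> 0 \<Longrightarrow> v (u ^ k) = int k * v u"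
  by (induction k) (auto simp: valuation_1 valuation_mult assms algebra_simps)

lemma valuation_inverse:
  assumes "valuation v"
  shows "v (inverse u) = - v u"
proof (cases "u = 0")
  case False
  then show ?thesis using valuation_mult[OF assms, of u "inverse u"] valuation_1[OF assms] by simp
qed (use valuation_0[OF assms] in simp)

lemma valuation_divide:
  assumes "valuation v" "u \<noteq> 0" "w \<noteq> 0"
  shows "v (u / w) = v u - v w"
  using valuation_mult[OF assms(1), of u "inverse w"] valuation_inverse[OF assms(1), of w] assms
  by (simp add: divide_inverse)

lemma valuation_power_int:
  assumes "valuation v" "u \<noteq> 0"
  shows "v (u powi k) = k * v u"
  using valuation_power[OF assms, of "nat k"] valuation_power[OF assms(1), of "inverse u" "nat (- k)"]
    valuation_inverse[OF assms(1), of u] assms(2)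
  by (auto simp: power_int_def power_inverse)

lemma valuation_prod:
  assumes "valuation v" "\<And>i. i \<in> I \<Longrightarrow> f i \<noteq> 0"
  shows "v (prod f I) = (\<Sum>i\<in>I. v (f i))"
  using assms(2)
  by (induction I rule: infinite_finite_induct) (auto simp: valuation_1 valuation_mult assms(1))

lemma valuation_add_ge:
  assumes "valuation v" "u = 0 \<or> k \<le> v u" "w = 0 \<or> k \<le> v w"
  shows "u + w = 0 \<or> k \<le> v (u + w)"
  using assms unfolding valuation_def by (metis add.left_neutral add.right_neutral min.bounded_iff order_trans)

lemma valuation_sum_ge:
  assumes "valuation v" "\<And>i. i \<in> I \<Longrightarrow> f i = 0 \<or> k \<le> v (f i)"
  shows "sum f I = 0 \<or> k \<le> v (sum f I)"
  using assms(2)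
proof (induction I rule: infinite_finite_induct)
  case (insert i I)
  then show ?case using valuation_add_ge[OF assms(1), of "f i" k "sum f I"] by auto
qed auto

lemma valuation_add_dominant:
  assumes v: "valuation v" and u: "u \<noteq> 0" and w: "w = 0 \<or> v u < v w"
  shows "u + w \<noteq> 0" "v (u + w) = v u"
proof -
  show nz: "u + w \<noteq> 0"
    using valuation_minus[OF v, of w] u w by (auto simp: add_eq_0_iff2)
  show "v (u + w) = v u"
  proof (rule ccontr)
    assume ne: "v (u + w) \<noteq> v u"
    have "v u \<le> v (u + w)" using valuation_add_ge[OF v, of u "v u" w] nz w by auto
    with ne have "v u + 1 \<le> v (u + w)" by simp
    then have "u + w + - w = 0 \<or> v u + 1 \<le> v (u + w + - w)"
      using w valuation_minus[OF v, of w] \<open>v u + 1 \<le> v (u + w)\<close>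
      by (intro valuation_add_ge[OF v, of "u + w" _ "- w"]) auto
    then show False using u by simp
  qed
qed

lemma valuation_sum_dominant:
  assumes v: "valuation v" and "finite I" "i \<in> I" "f i \<noteq> 0"
    and "\<And>j. j \<in> I \<Longrightarrow> j \<noteq> i \<Longrightarrow> f j = 0 \<or> v (f i) < v (f j)"
  shows "sum f I \<noteq> 0" "v (sum f I) = v (f i)"
proof -
  have "sum f I = f i + sum f (I - {i})" using assms by (simp add: sum.remove)
  moreover have "sum f (I - {i}) = 0 \<or> v (f i) + 1 \<le> v (sum f (I - {i}))"
    using assms by (intro valuation_sum_ge[OF v]) fastforce
  ultimately show "sum f I \<noteq> 0" "v (sum f I) = v (f i)"
    using valuation_add_dominant[OF v, of "f i" "sum f (I - {i})"] assms by auto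
qed

lemma valuation_sum_distinct:
  assumes v: "valuation v" and I: "finite I" "\<exists>i\<in>I. f i \<noteq> 0"
    and inj: "\<And>i j. i \<in> I \<Longrightarrow> j \<in> I \<Longrightarrow> f i \<noteq> 0 \<Longrightarrow> f j \<noteq> 0 \<Longrightarrow> v (f i) = v (f j) \<Longrightarrow> i = j"
  shows "sum f I \<noteq> 0" "\<exists>i\<in>I. f i \<noteq> 0 \<and> v (sum f I) = v (f i) \<and>
    (\<forall>j\<in>I. f j \<noteq> 0 \<longrightarrow> v (f i) \<le> v (f j))"
proof -
  define J where "J = {i\<in>I. f i \<noteq> 0}"
  have "finite ((\<lambda>i. v (f i)) ` J)" "(\<lambda>i. v (f i)) ` J \<noteq> {}" using I by (auto simp: J_def)
  from Min_in[OF this] Min_le[OF this(1)] obtain i where i: "i \<in> J" "\<forall>j\<in>J. v (f i) \<le> v (f j)"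
    by auto
  have "v (f i) < v (f j)" if "j \<in> I" "j \<noteq> i" "f j \<noteq> 0" for j
    using i inj[of i j] that unfolding J_def by force
  then show "sum f I \<noteq> 0" "\<exists>i\<in>I. f i \<noteq> 0 \<and> v (sum f I) = v (f i) \<and>
    (\<forall>j\<in>I. f j \<noteq> 0 \<longrightarrow> v (f i) \<le> v (f j))"
    using valuation_sum_dominant[OF v I(1), of i f] i by (auto simp: J_def)
qed

lemma valuation_poly_nonneg:
  assumes "valuation v" "\<forall>u\<in>K - {0}. v u = 0" "A \<in> poly_over K" "u = 0 \<or> 0 \<le> v u"
  shows "poly A u = 0 \<or> 0 \<le> v (poly A u)"
  unfolding poly_altdef
proof (rule valuation_sum_ge[OF assms(1)])
  fix i assume "i \<in> {..degree A}"
  show "coeff A i * u ^ i = 0 \<or> 0 \<le> v (coeff A i * u ^ i)"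
  proof (cases "coeff A i * u ^ i = 0")
    case False
    then have "v (coeff A i * u ^ i) = v (u ^ i)"
      using assms(1,2) poly_over_coeff[OF assms(3)] by (auto simp: valuation_mult)
    then show ?thesis using assms False by (cases "u = 0") (auto simp: valuation_power valuation_1 power_0_left)
  qed simp
qed

lemma valuation_poly_pole:
  assumes v: "valuation v" "\<forall>u\<in>K - {0}. v u = 0" and A: "A \<in> poly_over K" "A \<noteq> 0" and u: "v u < 0"
  shows "poly A u \<noteq> 0" "v (poly A u) = int (degree A) * v u"
proof -
  have nz: "u \<noteq> 0" using u valuation_0[OF v(1)] by auto
  have val: "v (coeff A i * u ^ i) = int i * v u" if "coeff A i \<noteq> 0" for i
    using that poly_over_coeff[OF A(1), of i] nz by (simp add: valuation_mult valuation_power v)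
  have lc: "lead_coeff A \<noteq> 0" using A by simp
  have l: "coeff A j * u ^ j = 0 \<or> v (coeff A (degree A) * u ^ degree A) < v (coeff A j * u ^ j)"
    if "j \<in> {..degree A}" "j \<noteq> degree A" for j
    using that val[of j] val[OF lc] u by (auto simp: mult_less_cancel_right)
  note * = valuation_sum_dominant[OF v(1), of "{..degree A}" "degree A" "\<lambda>i. coeff A i * u ^ i", OF _ _ _ l]
  have nz': "coeff A (degree A) * u ^ degree A \<noteq> 0" using lc nz by simp
  show "poly A u \<noteq> 0" "v (poly A u) = int (degree A) * v u"
    unfolding poly_altdef using *(1)[OF _ _ nz'] *(2)[OF _ _ nz'] val[OF lc] by auto
qed

text \<open>\<open>A(u) - A(r)\<close> is a multiple of \<open>u - r\<close>, and \<open>A(r)\<close> is a nonzero constant.\<close>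

lemma valuation_poly_nonroot:
  assumes v: "valuation v" "\<forall>u\<in>K - {0}. v u = 0" and K: "is_subring K"
    and A: "A \<in> poly_over K" and r: "r \<in> K" "poly A r \<noteq> 0" and u: "u = r \<or> 0 < v (u - r)"
  shows "poly A u \<noteq> 0" "v (poly A u) = 0"
proof -
  obtain Q R where QR: "Q \<in> poly_over K" "A = Q * [:-r, 1:] + R" "\<forall>i\<ge>1. coeff R i = 0"
    using division_poly_over[OF K A linear_poly_over[OF K r(1)], of 1] is_subring_closed(2)[OF K] by auto
  have "degree R = 0" using QR(3) by (metis One_nat_def degree_le le_0_eq Suc_leI)
  then obtain d where R: "R = [:d:]" by (auto elim: degree_eq_zeroE)
  have d: "poly A r = d" using QR R by simp
  have Au: "poly A u = d + (u - r) * poly Q u" unfolding QR(2) R by (simp add: algebra_simps)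
  have "d \<in> K" using poly_in_subring[OF K A r(1)] d by simp
  then have vd: "v d = 0" "d \<noteq> 0" using v(2) r d by auto
  have "r = 0 \<or> 0 \<le> v r" using v(2) r by (cases "r = 0") auto
  then have "u = 0 \<or> 0 \<le> v u" using valuation_add_ge[OF v(1), of "u - r" 0 r] u by fastforce
  then have Q: "poly Q u = 0 \<or> 0 \<le> v (poly Q u)" by (rule valuation_poly_nonneg[OF v QR(1)])
  have "(u - r) * poly Q u = 0 \<or> v d < v ((u - r) * poly Q u)"
    using Q u vd by (cases "u = r \<or> poly Q u = 0") (auto simp: valuation_mult[OF v(1)])
  from valuation_add_dominant[OF v(1) vd(2) this] show "poly A u \<noteq> 0" "v (poly A u) = 0"
    by (auto simp: Au vd)
qed

text \<open>
  The value group of a nontrivial valuation is infinite cyclic; dividing by its positive generator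
  gives a place.
\<close>

lemma normalize_valuation:
  assumes v: "valuation v" "\<forall>u\<in>K - {0}. v u = 0" and "u0 \<noteq> 0" "v u0 \<noteq> 0"
  obtains w d where "is_place K w" "d > 0" "\<And>u. v u = d * w u"
proof -
  define Q where "Q d \<longleftrightarrow> d > 0 \<and> (\<exists>u. u \<noteq> 0 \<and> v u = int d)" for d :: nat
  have "Q (nat \<bar>v u0\<bar>)"
    unfolding Q_def using assms(3,4) valuation_inverse[OF v(1), of u0]
    by (auto intro!: exI[of _ "if v u0 > 0 then u0 else inverse u0"] split: if_splits)
  define d where "d = (LEAST d. Q d)"
  have "Q d" using \<open>Q (nat \<bar>v u0\<bar>)\<close> unfolding d_def by (rule LeastI)
  then obtain t where t: "t \<noteq> 0" "v t = int d" "d > 0" by (auto simp: Q_def)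
  have dvd: "int d dvd v u" for u
  proof (cases "u = 0")
    case False
    define u' where "u' = u / t powi (v u div int d)"
    have u': "u' \<noteq> 0" "v u' = v u mod int d"
      using False t by (auto simp: u'_def valuation_divide[OF v(1)] valuation_power_int[OF v(1)]
          minus_div_mult_eq_mod)
    have "v u' = 0"
    proof (rule ccontr)
      assume "v u' \<noteq> 0"
      moreover have "0 \<le> v u'" using u' t by simp
      ultimately have "Q (nat (v u'))" using u'(1) by (auto simp: Q_def intro!: exI[of _ u'])
      then have "d \<le> nat (v u')" unfolding d_def by (rule Least_le)
      moreover have "v u' < int d" using u' t by simp
      ultimately show False using t(3) by linarith
    qed
    then show ?thesis using u'(2) by (simp add: dvd_eq_mod_eq_0)
  qed (simp add: valuation_0[OF v(1)])
  define w where "w u = v u div int d" for u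
  have vw: "v u = int d * w u" for u using dvd[of u] by (simp add: w_def)
  have dp: "int d > 0" using t by simp
  have "is_place K w"
    unfolding is_place_iff
  proof (intro conjI)
    show "valuation w"
      unfolding valuation_def
    proof (intro conjI allI impI)
      show "w 0 = 0" by (simp add: w_def valuation_0[OF v(1)])
      fix u u' :: 'a assume nz: "u \<noteq> 0" "u' \<noteq> 0"
      have "int d * w (u * u') = int d * (w u + w u')"
        using valuation_mult[OF v(1) nz] by (simp add: vw algebra_simps)
      then show "w (u * u') = w u + w u'" using dp by simp
      assume "u + u' \<noteq> 0"
      then have "min (v u) (v u') \<le> v (u + u')" using v(1) nz by (auto simp: valuation_def)
      then show "min (w u) (w u') \<le> w (u + u')"
        unfolding vw min_le_iff_disj using dp by simp
    qed
    show "\<forall>u\<in>K - {0}. w u = 0" using v(2) by (simp add: w_def)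
    have "k \<in> w ` (- {0})" for k
    proof
      have "w t = 1" using t by (simp add: w_def)
      then show "k = w (t powi k)"
        using valuation_power_int[OF \<open>valuation w\<close> t(1), of k] by simp
      show "t powi k \<in> - {0}" using t by simp
    qed
    then show "w ` (- {0}) = UNIV" by blast
  qed
  then show thesis using that dp vw by blast
qed

lemma valuation_fls_subdegree: "valuation (fls_subdegree :: 'a::field fls \<Rightarrow> int)"
  unfolding valuation_def by (auto intro: fls_plus_subdegree)

lemma valuation_comp_hom:
  fixes f :: "'a::field \<Rightarrow> 'b::field"
  assumes "valuation v" "is_hom f"
  shows "valuation (v \<circ> f)"
  using assms(1) unfolding valuation_def
  by (auto simp: is_hom_simps[OF assms(2)] is_hom_field[OF assms(2)])
    (metis is_hom_simps(3)[OF assms(2)] is_hom_field(1)[OF assms(2)])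

section \<open>The additive polynomial and zeros of the coordinate functions\<close>

lemma additive_t_add:
  fixes u w :: "'a::field"
  assumes "prime p" "CHAR('a) = p"
  shows "additive_t p a b (u + w) = additive_t p a b u + additive_t p a b w"
  unfolding additive_t_def sum.distrib[symmetric]
  using assms by (intro sum.cong refl freshmans_dream') auto

lemma additive_t_diff:
  fixes u w :: "'a::field"
  assumes "prime p" "CHAR('a) = p"
  shows "additive_t p a b (u - w) = additive_t p a b u - additive_t p a b w"
  using additive_t_add[OF assms, of a b "u - w" w] by simp

lemma additive_t_hom:
  fixes f :: "'a::field \<Rightarrow> 'b::field"
  assumes "is_hom f"
  shows "f (additive_t p a b u) = additive_t p a b (f u)"
  unfolding additive_t_def by (simp add: is_hom_simps[OF assms])

text \<open>The linear term dominates at a zero of \<open>u\<close>, because the derivative of \<open>t\<close> is \<open>1\<close>.\<close>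

lemma valuation_additive_t:
  assumes v: "valuation v" and u: "u \<noteq> 0" "v u > 0" and p: "p > 1" "b > 0" "a div b > 0"
  shows "additive_t p a b u \<noteq> 0" "v (additive_t p a b u) = v u"
proof -
  have l: "u ^ p ^ (j * b) = 0 \<or> v (u ^ p ^ (0 * b)) < v (u ^ p ^ (j * b))" if "j \<noteq> 0" for j
  proof -
    have "1 < p ^ (j * b)" using p that by (intro one_less_power) auto
    then have "1 * v u < int (p ^ (j * b)) * v u" using u(2) by (intro mult_strict_right_mono) linarith+
    then show ?thesis using u by (simp add: valuation_power[OF v])
  qed
  from valuation_sum_dominant[OF v, of "{..<a div b}" 0 "\<lambda>j. u ^ p ^ (j * b)"] l u p
  show "additive_t p a b u \<noteq> 0" "v (additive_t p a b u) = v u"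
    unfolding additive_t_def by auto
qed

text \<open>
  At a zero of \<open>y\<close> the term \<open>- y\<close> dominates \<open>y\<^sup>Q\<close>.
\<close>

lemma valuation_artin_schreier:
  assumes v: "valuation v" and Q: "1 < Q" and y: "y \<noteq> 0" "0 < v y" and z: "z \<noteq> 0"
    and eq: "y ^ Q - y = z ^ M"
  shows "int M * v z = v y"
proof -
  have "int M * v z = v (z ^ M)" by (rule valuation_power[OF v z, symmetric])
  also have "\<dots> = v (- y + y ^ Q)" by (simp flip: eq)
  also have "\<dots> = v (- y)"
  proof (rule valuation_add_dominant[OF v])
    have "1 < int Q" using Q by linarith
    then have "1 * v y < int Q * v y" using y(2) by (intro mult_strict_right_mono)
    then show "y ^ Q = 0 \<or> v (- y) < v (y ^ Q)"
      using y by (simp add: valuation_power[OF v] valuation_minus[OF v])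
  qed (use y in simp)
  finally show ?thesis by (simp add: valuation_minus[OF v])
qed

lemma zero_orders:
  assumes v: "valuation v" and pab: "p > 1" "b > 0" "a div b > 0" and q: "q > 1"
    and x: "x \<noteq> 0" "0 < v x" and yz: "y \<noteq> 0" "z \<noteq> 0" and c: "c \<noteq> 0" "v c = 0"
    and eq1: "c * y ^ (q + 1) = additive_t p a b x" and eq2: "y ^ q\<^sup>2 - y = z ^ M"
  shows "0 < v y" "int (q + 1) * v y = v x" "int M * v z = v y"
proof -
  have "v (c * y ^ (q + 1)) = v x"
    unfolding eq1 using valuation_additive_t[OF v x pab] by simp
  then show 1: "int (q + 1) * v y = v x"
    using yz c valuation_power[OF v yz(1), of "q + 1"] by (simp add: valuation_mult[OF v])
  show "0 < v y"
  proof (rule ccontr)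
    assume "\<not> 0 < v y"
    then have "int (q + 1) * v y \<le> 0" by (intro mult_nonneg_nonpos) auto
    then show False using 1 x by simp
  qed
  moreover have "1 < q\<^sup>2" using q by (rule one_less_power) simp
  ultimately show "int M * v z = v y"
    using valuation_artin_schreier[OF v _ yz(1) _ yz(2) eq2] by simp
qed

section \<open>The function field as a radical extension of the rational function field\<close>

locale curve =
  fixes p a b q M :: nat and K :: "'f::field set" and c x y z :: 'f
  assumes p: "prime p" and a: "a > 0" and b: "b > 0" "b dvd a" and q: "q = p ^ a"
    and M: "M > 0" "coprime M p"
    and char: "CHAR('f) = p"
    and cff: "curve_function_field p a b M K c x y z"
    and c: "c \<in> K" "c \<noteq> 0"
    and pole: "\<exists>v. is_place K v \<and> v x < 0"
begin

text \<open>
  The exponent in \<open>N\<close> makes it the degree \<open>q / p\<^sup>b\<close> of \<open>t\<close> (\<open>q_eq\<close>, \<open>degree_T\<close>).  The polynomials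
  are chosen such that \<open>y\<^bsup>q+1\<^esup> = W(x)\<close>, \<open>z\<^sup>M = y V(x)\<close> and \<open>z\<^sup>n = G(x)\<close>.
\<close>

definition n :: nat where "n = (q + 1) * M"
definition N :: nat where "N = p ^ ((a div b - 1) * b)"
definition T :: "'f poly" where "T = (\<Sum>i<a div b. monom 1 (p ^ (i * b)))"
definition W :: "'f poly" where "W = smult (inverse c) T"
definition V :: "'f poly" where "V = W ^ (q - 1) - 1"
definition G :: "'f poly" where "G = W * V ^ (q + 1)"

definition e :: "nat \<Rightarrow> 'f" where "e s = y ^ (s div M) * z ^ (s mod M)"

lemma K: "is_subfield K" and adjoin: "field_adjoin K {x, y, z} = UNIV"
  and not_alg: "\<not> algebraic_over K x"
  and eq1: "c * y ^ (q + 1) = additive_t p a b x" and eq2: "y ^ q\<^sup>2 - y = z ^ M"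
  using cff by (auto simp: curve_function_field_def q)

lemmas K_sub = is_subring_subfield[OF K]
lemmas K_cl = is_subring_closed[OF K_sub]
lemmas KX_sub = is_subring_poly_over[OF K_sub]
lemmas KX_cl = is_subring_closed[OF KX_sub]

lemma inverse_K: "u \<in> K \<Longrightarrow> inverse u \<in> K"
  using K by (auto simp: is_subfield_def)

lemma transcendental: "A \<in> poly_over K \<Longrightarrow> A \<noteq> 0 \<Longrightarrow> poly A x \<noteq> 0"
  using not_alg by (auto simp: algebraic_over_def poly_over_def)

lemma p_gt_1: "p > 1" using p by (rule prime_gt_1_nat)
lemma ab: "a div b > 0" "a div b * b = a"
  using a b by (auto simp: div_greater_zero_iff dvd_imp_le)
lemma q_gt_1: "q > 1" unfolding q using p_gt_1 a by (rule one_less_power)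
lemma n_pos: "n > 0" using M by (simp add: n_def)

lemma q_eq: "q = N * p ^ b"
proof -
  have "(a div b - 1) * b + b = a" using ab by (cases "a div b") auto
  then show ?thesis by (simp add: q N_def flip: power_add)
qed

lemma N_pos: "N > 0" using p_gt_1 by (simp add: N_def)

lemma coprimes: "coprime M (q\<^sup>2 * N)" "coprime (q + 1) N" "coprime n (q\<^sup>2 * N)"
proof -
  show 1: "coprime M (q\<^sup>2 * N)" using M(2) by (simp add: q N_def)
  have "coprime (q + 1) q" by simp
  then have "coprime (q + 1) (p ^ a)" using q by metis
  then have "coprime (q + 1) p" using a by simp
  then show 2: "coprime (q + 1) N" by (simp add: N_def)
  have "coprime (q + 1) (q\<^sup>2)" by simp
  then show "coprime n (q\<^sup>2 * N)" unfolding n_def coprime_mult_left_iff using 1 2 by simp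
qed

lemma poly_T: "poly T u = additive_t p a b u"
  by (simp add: T_def additive_t_def poly_sum poly_monom)

lemma T_over: "T \<in> poly_over K"
  unfolding T_def by (intro is_subring_sum KX_sub monom_poly_over K_sub K_cl)

lemma W_over: "W \<in> poly_over K"
proof -
  have "W = [:inverse c:] * T" by (simp add: W_def)
  then show ?thesis using T_over const_poly_over[OF K_sub inverse_K[OF c(1)]] KX_cl(4) by metis
qed

lemma V_over: "V \<in> poly_over K"
  unfolding V_def using W_over by (intro KX_cl)

lemma G_over: "G \<in> poly_over K"
  unfolding G_def using W_over V_over by (intro KX_cl)

lemma coeff_T: "coeff T k = (\<Sum>i<a div b. if p ^ (i * b) = k then 1 else 0)"
  by (simp add: T_def coeff_sum)

lemma degree_T: "degree T = N" "T \<noteq> 0"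
proof -
  have inj: "p ^ (i * b) = p ^ (j * b) \<longleftrightarrow> i = j" for i j
    using p_gt_1 b by (auto simp: power_inject_exp)
  have "coeff T N = (\<Sum>i<a div b. if i = a div b - 1 then 1 else 0)"
    unfolding coeff_T N_def by (simp add: inj)
  also have "\<dots> = 1" using ab by simp
  finally have 1: "coeff T N = 1" .
  have "degree T \<le> N"
  proof (intro degree_le allI impI)
    fix k assume k: "k > N"
    have "p ^ (i * b) \<noteq> k" if "i < a div b" for i
    proof -
      have "p ^ (i * b) \<le> N" unfolding N_def using that p_gt_1 by (intro power_increasing) auto
      then show ?thesis using k by simp
    qed
    then show "coeff T k = 0" unfolding coeff_T by simp
  qed
  then show "degree T = N" using 1 le_degree[of T N] by simp
  show "T \<noteq> 0" using 1 by auto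
qed

lemma degree_W: "degree W = N" "W \<noteq> 0"
  using degree_T c by (auto simp: W_def)

lemma V_nonzero: "V \<noteq> 0"
proof
  assume "V = 0"
  then have "degree (W ^ (q - 1)) = 0" by (simp add: V_def)
  then show False using degree_W N_pos q_gt_1 by (simp add: degree_power_eq)
qed

lemma y_power: "y ^ (q + 1) = poly W x"
  using eq1 c by (simp add: W_def poly_T field_simps)

lemma q2_split: "u ^ q\<^sup>2 = u * (u ^ (q + 1)) ^ (q - 1)" for u :: "'a::comm_ring_1"
proof -
  have "q\<^sup>2 = 1 + (q + 1) * (q - 1)" using q_gt_1 by (cases q) (auto simp: power2_eq_square)
  then show ?thesis by (metis power_add power_mult power_one_right)
qed

lemma z_power_M: "z ^ M = y * poly V x"
  unfolding eq2[symmetric] q2_split y_power by (simp add: V_def algebra_simps)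

lemma z_power_n: "z ^ n = poly G x"
proof -
  have "z ^ n = (z ^ M) ^ (q + 1)" by (simp only: n_def mult.commute[of "q + 1"] power_mult)
  then show ?thesis unfolding z_power_M power_mult_distrib y_power by (simp add: G_def)
qed

lemma z_power_s: "z ^ s = poly V x ^ (s div M) * e s"
proof -
  have "z ^ s = z ^ (M * (s div M) + s mod M)" by simp
  also have "\<dots> = (z ^ M) ^ (s div M) * z ^ (s mod M)" by (simp only: power_add power_mult)
  finally show ?thesis by (simp add: z_power_M e_def power_mult_distrib)
qed

lemma y_nonzero: "y \<noteq> 0" 
  using y_power transcendental[OF W_over degree_W(2)] by auto

lemma z_nonzero: "z \<noteq> 0"
  using z_power_M M y_nonzero transcendental[OF V_over V_nonzero] by (auto simp: power_0_left)

lemma e_nonzero: "e s \<noteq> 0" using y_nonzero z_nonzero by (simp add: e_def)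

text \<open>
  At a pole of \<open>x\<close> the leading terms of the two equations give \<open>(q + 1) v(y) = N v(x)\<close> and
  \<open>M v(z) = q\<^sup>2 v(y)\<close>.  As \<open>q + 1\<close> is prime to \<open>N\<close> and \<open>M\<close> is prime to \<open>q\<^sup>2 N\<close>, all three orders are
  fixed multiples of one integer \<open>E\<close>.
\<close>

lemma pole_orders:
  assumes v: "valuation v" "\<forall>u\<in>K - {0}. v u = 0" and x: "v x < 0"
  obtains E where "E < 0" "v x = int n * E" "v y = int (M * N) * E" "v z = int (q\<^sup>2 * N) * E"
    "\<forall>A\<in>poly_over K. A \<noteq> 0 \<longrightarrow> v (poly A x) = int n * int (degree A) * E"
proof -
  have "int (q + 1) * v y = v (y ^ (q + 1))"
    by (rule valuation_power[OF v(1) y_nonzero, symmetric])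
  also have "\<dots> = int N * v x"
    unfolding y_power using valuation_poly_pole[OF v W_over degree_W(2) x] degree_W by simp
  finally have 1: "int (q + 1) * v y = int N * v x" .
  have "int N * v x < 0" using N_pos x by (simp add: mult_pos_neg)
  then have vy: "v y < 0" using 1 by (smt (verit) mult_nonneg_nonneg of_nat_0_le_iff)
  have "int M * v z = v (z ^ M)" by (rule valuation_power[OF v(1) z_nonzero, symmetric])
  also have "\<dots> = v (y ^ q\<^sup>2 + - y)" by (simp flip: eq2)
  also have "\<dots> = v (y ^ q\<^sup>2)"
  proof (rule valuation_add_dominant[OF v(1)])
    have "1 < q\<^sup>2" using q_gt_1 by (rule one_less_power) simp
    then have "1 < int (q\<^sup>2)" by linarith
    then have "int (q\<^sup>2) * v y < 1 * v y" using vy by (intro mult_strict_right_mono_neg)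
    then show "- y = 0 \<or> v (y ^ q\<^sup>2) < v (- y)"
      using y_nonzero by (simp add: valuation_power[OF v(1)] valuation_minus[OF v(1)])
  qed (use y_nonzero in simp)
  also have "\<dots> = int (q\<^sup>2) * v y" by (rule valuation_power[OF v(1) y_nonzero])
  finally have 2: "int M * v z = int (q\<^sup>2) * v y" .
  have "int (q + 1) dvd int N * v x" unfolding 1[symmetric] by simp
  then have "int (q + 1) dvd v x"
    using coprimes(2) coprime_dvd_mult_right_iff[of "int (q + 1)" "int N" "v x"] coprime_int_iff by blast
  then obtain X1 where X: "v x = int (q + 1) * X1" unfolding dvd_def by blast
  have Y: "v y = int N * X1" using 1 unfolding X by simp
  have "int M dvd int (q\<^sup>2 * N) * X1" using 2 Y by (metis dvd_triv_left mult.assoc of_nat_mult)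
  then have "int M dvd X1"
    using coprimes(1) coprime_dvd_mult_right_iff[of "int M" "int (q\<^sup>2 * N)" X1] coprime_int_iff by blast
  then obtain E where E: "X1 = int M * E" unfolding dvd_def by blast
  have Z: "v z = int (q\<^sup>2 * N) * E" using 2 M(1) unfolding Y E by simp
  have X': "v x = int n * E" by (simp add: X E n_def algebra_simps)
  show thesis
  proof (rule that[OF _ X' _ Z])
    show "E < 0" using x n_pos unfolding X' by (simp add: mult_less_0_iff)
    show "v y = int (M * N) * E" unfolding Y E by simp
    show "\<forall>A\<in>poly_over K. A \<noteq> 0 \<longrightarrow> v (poly A x) = int n * int (degree A) * E"
      using valuation_poly_pole(2)[OF v _ _ x] X' by simp
  qed
qed

text \<open>
  A zero \<open>x = r\<close> of \<open>t\<close> is simple, as \<open>t(x) = t(x - r)\<close>.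
\<close>

lemma root_orders:
  assumes v: "valuation v" "\<forall>u\<in>K - {0}. v u = 0" and r: "r \<in> K" "additive_t p a b r = 0"
    and x: "0 < v (x - r)"
  obtains E where "E > 0" "v (x - r) = int n * E" "v y = int M * E" "v z = E"
proof -
  have xr: "x - r \<noteq> 0" using x valuation_0[OF v(1)] by auto
  have "c * y ^ (q + 1) = additive_t p a b (x - r)"
    using eq1 additive_t_diff[OF p char] r(2) by simp
  moreover have "v c = 0" using v(2) c by simp
  ultimately have *: "0 < v y" "int (q + 1) * v y = v (x - r)" "int M * v z = v y"
    using zero_orders[OF v(1) p_gt_1 b(1) ab(1) q_gt_1 xr x y_nonzero z_nonzero c(2) _ _ eq2] by auto
  show thesis
  proof (rule that[of "v z"])
    show "v z > 0" using * by (metis M(1) of_nat_0_less_iff zero_less_mult_pos)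
    have "int n * v z = int (q + 1) * (int M * v z)" by (simp only: n_def of_nat_mult mult.assoc)
    then show "v (x - r) = int n * v z" using * by simp
  qed (use * in auto)
qed

text \<open>
  Both kinds of places are totally ramified over \<open>K(x)\<close>: the orders of the elements of \<open>K(x)\<close>
  are multiples of \<open>n\<close>, while that of \<open>z\<close> is prime to \<open>n\<close>, up to a common factor \<open>E\<close>.  This factor
  is allowed because total ramification is needed to see that \<open>1, z, z\<^sup>2, \<dots>\<close> are independent over \<open>K(x)\<close>, and only
  then does the surjectivity of a place onto the integers yield \<open>E = 1\<close> or \<open>E = -1\<close>
  (\<open>ramified_place\<close>).
\<close>

definition ramified :: "('f \<Rightarrow> int) \<Rightarrow> int \<Rightarrow> bool" where
  "ramified v E \<longleftrightarrow> valuation v \<and> E \<noteq> 0 \<and> (\<exists>k. coprime (int n) k \<and> v z = k * E) \<and>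
     (\<forall>A\<in>poly_over K. A \<noteq> 0 \<longrightarrow> int n * E dvd v (poly A x))"

lemma ramified_distinct:
  assumes R: "ramified v E" and A: "A \<in> poly_over K" "A \<noteq> 0" and B: "B \<in> poly_over K" "B \<noteq> 0"
    and st: "s < n" "t < n" and eq: "v (poly A x * z ^ s) = v (poly B x * z ^ t)"
  shows "s = t"
proof -
  have v: "valuation v" using R by (simp add: ramified_def)
  obtain k where k: "coprime (int n) k" "v z = k * E" and E: "E \<noteq> 0" using R by (auto simp: ramified_def)
  obtain i j where ij: "v (poly A x) = int n * E * i" "v (poly B x) = int n * E * j"
    using R A B by (fastforce simp: ramified_def elim: dvdE)
  have "E * (int n * i + int s * k) = E * (int n * j + int t * k)"
    using eq transcendental[OF A] transcendental[OF B] z_nonzero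
    by (simp add: valuation_mult[OF v] valuation_power[OF v] ij k algebra_simps)
  then have "int n * i + int s * k = int n * j + int t * k" using E by simp
  then have "(int s - int t) * k = int n * (j - i)" by (simp add: algebra_simps)
  then have "int n dvd (int s - int t)"
    using k(1) by (metis coprime_dvd_mult_left_iff dvd_triv_left)
  then have "\<bar>int s - int t\<bar> = 0" using st zdvd_imp_le[of "int n" "\<bar>int s - int t\<bar>"] by fastforce
  then show ?thesis by simp
qed

lemma ramified_sum:
  assumes R: "ramified v E" and A: "\<And>s. s < n \<Longrightarrow> A s \<in> poly_over K" "\<exists>s<n. A s \<noteq> 0"
  shows "(\<Sum>s<n. poly (A s) x * z ^ s) \<noteq> 0"
    "\<exists>s<n. A s \<noteq> 0 \<and> v (\<Sum>s<n. poly (A s) x * z ^ s) = v (poly (A s) x * z ^ s) \<and>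
      (\<forall>t<n. A t \<noteq> 0 \<longrightarrow> v (poly (A s) x * z ^ s) \<le> v (poly (A t) x * z ^ t))"
proof -
  have v: "valuation v" using R by (simp add: ramified_def)
  let ?f = "\<lambda>s. poly (A s) x * z ^ s"
  have nz: "?f s \<noteq> 0 \<longleftrightarrow> A s \<noteq> 0" if "s < n" for s
    using transcendental[OF A(1)[OF that]] z_nonzero by auto
  have fin: "finite {..<n}" by simp
  have ex: "\<exists>s\<in>{..<n}. ?f s \<noteq> 0" using A(2) nz by auto
  have inj: "i = j" if "i \<in> {..<n}" "j \<in> {..<n}" "?f i \<noteq> 0" "?f j \<noteq> 0" "v (?f i) = v (?f j)" for i j
    using ramified_distinct[OF R A(1) _ A(1) _ _ _ that(5)] that nz by auto
  show "sum ?f {..<n} \<noteq> 0" using valuation_sum_distinct(1)[of v "{..<n}" ?f, OF v fin ex inj] by blast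
  show "\<exists>s<n. A s \<noteq> 0 \<and> v (\<Sum>s<n. poly (A s) x * z ^ s) = v (poly (A s) x * z ^ s) \<and>
      (\<forall>t<n. A t \<noteq> 0 \<longrightarrow> v (poly (A s) x * z ^ s) \<le> v (poly (A t) x * z ^ t))"
    using valuation_sum_distinct(2)[of v "{..<n}" ?f, OF v fin ex inj] nz by fastforce
qed

lemma pole_ramified:
  assumes v: "valuation v" "\<forall>u\<in>K - {0}. v u = 0" and x: "v x < 0"
  obtains E where "E < 0" "ramified v E" "v x = int n * E" "v y = int (M * N) * E" "v z = int (q\<^sup>2 * N) * E"
    "\<forall>A\<in>poly_over K. A \<noteq> 0 \<longrightarrow> v (poly A x) = int n * int (degree A) * E"
proof -
  obtain E where E: "E < 0" "v x = int n * E" "v y = int (M * N) * E" "v z = int (q\<^sup>2 * N) * E"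
    "\<forall>A\<in>poly_over K. A \<noteq> 0 \<longrightarrow> v (poly A x) = int n * int (degree A) * E"
    by (rule pole_orders[OF v x])
  have "coprime (int n) (int (q\<^sup>2 * N))" using coprimes(3) coprime_int_iff by blast
  moreover have "int n * E dvd v (poly A x)" if "A \<in> poly_over K" "A \<noteq> 0" for A
    using E(5) that by (intro dvdI[of _ _ "int (degree A)"]) (simp add: algebra_simps)
  ultimately have "ramified v E" using E v(1) unfolding ramified_def by blast
  then show thesis using that E by blast
qed

lemma root_ramified:
  assumes v: "valuation v" "\<forall>u\<in>K - {0}. v u = 0" and r: "r \<in> K" "additive_t p a b r = 0"
    and x: "0 < v (x - r)"
  obtains E where "E > 0" "ramified v E" "v (x - r) = int n * E" "v y = int M * E" "v z = E"
proof -
  obtain E where E: "E > 0" "v (x - r) = int n * E" "v y = int M * E" "v z = E"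
    by (rule root_orders[OF v r x])
  have "int n * E dvd v (poly A x)" if A: "A \<in> poly_over K" "A \<noteq> 0" for A
  proof -
    have S: "finite {r}" "{r} \<subseteq> K" using r by auto
    obtain f B where B: "B \<in> poly_over K" "poly B r \<noteq> 0" "A = [:-r, 1:] ^ f * B"
      using split_roots_poly_over[OF K_sub S A] by auto
    note * = valuation_poly_nonroot[OF v K_sub B(1) r(1) B(2) disjI2[OF x]]
    have "x - r \<noteq> 0" using x valuation_0[OF v(1)] by auto
    then have "v (poly A x) = int f * v (x - r)"
      using * by (simp add: B(3) poly_power valuation_mult[OF v(1)] valuation_power[OF v(1)] del: diff_gt_0_iff_gt)
    then show ?thesis unfolding E(2) by simp
  qed
  then have "ramified v E" using E v(1) unfolding ramified_def by (metis coprime_1_right less_irrefl mult_1)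
  then show thesis using that E by blast
qed

end

sublocale curve \<subseteq> radical_extension K x z n G
proof
  show "is_subfield K" "n > 0" "G \<in> poly_over K" "z ^ n = poly G x" 
    "\<And>A. A \<in> poly_over K \<Longrightarrow> A \<noteq> 0 \<Longrightarrow> poly A x \<noteq> 0"
    using K n_pos G_over z_power_n transcendental by auto
  obtain v where v: "is_place K v" "v x < 0" using pole by blast
  have "valuation v" "\<forall>u\<in>K - {0}. v u = 0" using v(1) by (auto simp: is_place_iff)
  then obtain E where "ramified v E" using v(2) by (rule pole_ramified)
  from ramified_sum(1)[OF this] show "\<forall>s<n. A s = 0"
    if "\<And>s. s < n \<Longrightarrow> A s \<in> poly_over K" "(\<Sum>s<n. poly (A s) x * z ^ s) = 0" for A
    using that by blast
  have "L = UNIV" if L: "is_subfield L" "K \<union> {x, z} \<subseteq> L" for L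
  proof -
    note Ls = is_subring_subfield[OF L(1)]
    have sub: "poly_over K \<subseteq> poly_over L" using L by (auto simp: poly_over_def)
    have "z ^ M * inverse (poly V x) \<in> L"
      using L V_over sub by (intro is_subring_closed(4,7)[OF Ls] poly_in_subring[OF Ls])
        (auto simp: is_subfield_def intro!: poly_in_subring[OF Ls])
    moreover have "z ^ M * inverse (poly V x) = y"
      using z_power_M transcendental[OF V_over V_nonzero] by simp
    ultimately have "K \<union> {x, y, z} \<subseteq> L" using L by auto
    then have "field_adjoin K {x, y, z} \<subseteq> L" using L by (auto simp: field_adjoin_def)
    then show ?thesis using adjoin by auto
  qed
  then show "field_adjoin K {x, z} = UNIV" unfolding field_adjoin_def by auto
qed

context curve
begin

lemma ramified_place:
  assumes R: "ramified v E" and v: "is_place K v"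
  shows "\<bar>E\<bar> = 1"
proof -
  have val: "valuation v" using R by (simp add: ramified_def)
  have "E dvd v h" if "h \<noteq> 0" for h
  proof -
    obtain A B where AB: "\<forall>s. A s \<in> poly_over K" "B \<in> poly_over K" "B \<noteq> 0"
      "h = (\<Sum>s<n. poly (A s) x * z ^ s) / poly B x" by (rule component_form)
    have "\<exists>s<n. A s \<noteq> 0" using that AB(4) by (auto intro: ccontr)
    from ramified_sum[OF R AB(1)[rule_format] this] obtain s where s: "A s \<noteq> 0"
      "(\<Sum>s<n. poly (A s) x * z ^ s) \<noteq> 0"
      "v (\<Sum>s<n. poly (A s) x * z ^ s) = v (poly (A s) x * z ^ s)" by blast
    have "v h = v (poly (A s) x) + int s * v z - v (poly B x)"
      unfolding AB(4) using s transcendental AB z_nonzero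
      by (simp add: valuation_divide[OF val] valuation_mult[OF val] valuation_power[OF val])
    moreover have "E dvd v (poly C x)" if "C \<in> poly_over K" "C \<noteq> 0" for C
      using R that unfolding ramified_def by (metis dvd_mult_right)
    moreover have "E dvd v z" using R by (auto simp: ramified_def)
    ultimately show ?thesis using s(1) AB by auto
  qed
  moreover have "1 \<in> v ` (- {0})" using v by (auto simp: is_place_iff)
  ultimately have "E dvd 1" by force
  then show ?thesis by simp
qed

text \<open>
  The order of an element is the smallest order of its components, so it is determined by the orders on
  \<open>K(x)\<close> and that of \<open>z\<close>.
\<close>

lemma ramified_unique:
  assumes R: "ramified v E" "ramified w E'" and z: "v z = w z"
    and A: "\<And>A. A \<in> poly_over K \<Longrightarrow> A \<noteq> 0 \<Longrightarrow> v (poly A x) = w (poly A x)"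
  shows "v = w"
proof
  fix h
  have val: "valuation v" "valuation w" using R by (auto simp: ramified_def)
  show "v h = w h"
  proof (cases "h = 0")
    case False
    obtain A B where AB: "\<forall>s. A s \<in> poly_over K" "B \<in> poly_over K" "B \<noteq> 0"
      "h = (\<Sum>s<n. poly (A s) x * z ^ s) / poly B x" by (rule component_form)
    have ex: "\<exists>s<n. A s \<noteq> 0" using False AB(4) by (auto intro: ccontr)
    have eq: "v (poly (A s) x * z ^ s) = w (poly (A s) x * z ^ s)" if "A s \<noteq> 0" for s
      using that transcendental AB(1) z_nonzero A
      by (simp add: valuation_mult[OF val(1)] valuation_power[OF val(1)] valuation_mult[OF val(2)]
          valuation_power[OF val(2)] z)
    have "v (\<Sum>s<n. poly (A s) x * z ^ s) = w (\<Sum>s<n. poly (A s) x * z ^ s)"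
    proof -
      obtain i where i: "i < n" "A i \<noteq> 0"
        "v (\<Sum>s<n. poly (A s) x * z ^ s) = v (poly (A i) x * z ^ i)"
        "\<forall>t<n. A t \<noteq> 0 \<longrightarrow> v (poly (A i) x * z ^ i) \<le> v (poly (A t) x * z ^ t)"
        using ramified_sum(2)[OF R(1) AB(1)[rule_format] ex] by blast
      obtain j where j: "j < n" "A j \<noteq> 0"
        "w (\<Sum>s<n. poly (A s) x * z ^ s) = w (poly (A j) x * z ^ j)"
        "\<forall>t<n. A t \<noteq> 0 \<longrightarrow> w (poly (A j) x * z ^ j) \<le> w (poly (A t) x * z ^ t)"
        using ramified_sum(2)[OF R(2) AB(1)[rule_format] ex] by blast
      show ?thesis
        using i(3) i(4)[rule_format, OF j(1,2)] j(3) j(4)[rule_format, OF i(1,2)] eq[OF i(2)] eq[OF j(2)]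
        by linarith
    qed
    then show ?thesis
      unfolding AB(4) using ramified_sum(1)[OF R(1) AB(1)[rule_format] ex] transcendental AB A
      by (simp add: valuation_divide[OF val(1)] valuation_divide[OF val(2)])
  qed (use val in \<open>simp add: valuation_0\<close>)
qed

lemma place_at_pole:
  assumes v: "is_place K v" and x: "v x < 0"
  shows "ramified v (- 1)" "v x = - int n" "v y = - int (M * N)" "v z = - int (q\<^sup>2 * N)"
    "\<And>A. A \<in> poly_over K \<Longrightarrow> A \<noteq> 0 \<Longrightarrow> v (poly A x) = - int (n * degree A)"
proof -
  have val: "valuation v" "\<forall>u\<in>K - {0}. v u = 0" using v by (auto simp: is_place_iff)
  obtain E where E: "E < 0" "ramified v E" "v x = int n * E" "v y = int (M * N) * E" "v z = int (q\<^sup>2 * N) * E"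
    "\<forall>A\<in>poly_over K. A \<noteq> 0 \<longrightarrow> v (poly A x) = int n * int (degree A) * E"
    by (rule pole_ramified[OF val x])
  have "E = -1" using ramified_place[OF E(2) v] E(1) by simp
  then show "ramified v (- 1)" "v x = - int n" "v y = - int (M * N)" "v z = - int (q\<^sup>2 * N)"
    "A \<in> poly_over K \<Longrightarrow> A \<noteq> 0 \<Longrightarrow> v (poly A x) = - int (n * degree A)" for A
    using E(2-6) by simp_all
qed

lemma place_at_root:
  assumes v: "is_place K v" and r: "r \<in> K" "additive_t p a b r = 0" and x: "0 < v (x - r)"
  shows "ramified v 1" "v (x - r) = int n" "v y = int M" "v z = 1"
proof -
  have val: "valuation v" "\<forall>u\<in>K - {0}. v u = 0" using v by (auto simp: is_place_iff)
  obtain E where E: "E > 0" "ramified v E" "v (x - r) = int n * E" "v y = int M * E" "v z = E"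
    by (rule root_ramified[OF val r x])
  have "E = 1" using ramified_place[OF E(2) v] E(1) by simp
  then show "ramified v 1" "v (x - r) = int n" "v y = int M" "v z = 1" using E by auto
qed

lemma place_at_pole_unique:
  assumes "is_place K v" "v x < 0" "is_place K w" "w x < 0"
  shows "v = w"
  using place_at_pole[OF assms(1,2)] place_at_pole[OF assms(3,4)]
  by (intro ramified_unique[of v "-1" w "-1"]) auto

lemma place_at_root_unique:
  assumes v: "is_place K v" "0 < v (x - r)" and w: "is_place K w" "0 < w (x - r)"
    and r: "r \<in> K" "additive_t p a b r = 0"
  shows "v = w"
proof (rule ramified_unique)
  note v' = place_at_root[OF v(1) r v(2)] and w' = place_at_root[OF w(1) r w(2)]
  show "ramified v 1" "ramified w 1" "v z = w z" using v' w' by auto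
  have vv: "valuation v" "\<forall>u\<in>K - {0}. v u = 0" using v by (auto simp: is_place_iff)
  have ww: "valuation w" "\<forall>u\<in>K - {0}. w u = 0" using w by (auto simp: is_place_iff)
  fix A assume A: "A \<in> poly_over K" "A \<noteq> 0"
  have S: "finite {r}" "{r} \<subseteq> K" using r by auto
  obtain f B where B: "B \<in> poly_over K" "poly B r \<noteq> 0" "A = [:-r, 1:] ^ f * B"
    using split_roots_poly_over[OF K_sub S A] by auto
  note 1 = valuation_poly_nonroot[OF vv K_sub B(1) r(1) B(2) disjI2[OF v(2)]]
  note 2 = valuation_poly_nonroot[OF ww K_sub B(1) r(1) B(2) disjI2[OF w(2)]]
  have "x - r \<noteq> 0" using v(2) valuation_0[OF vv(1)] by auto
  then show "v (poly A x) = w (poly A x)"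
    using 1 2 v' w' by (simp add: B(3) poly_power valuation_mult[OF vv(1)] valuation_power[OF vv(1)] 
     valuation_mult[OF ww(1)] valuation_power[OF ww(1)])
qed

end

section \<open>Local parametrizations by power series\<close>

text \<open>The fixed point theorem for contractions in the metric of power series.\<close>

lemma fps_fixpoint:
  fixes \<Phi> :: "'a::zero fps \<Rightarrow> 'a fps"
  assumes zero: "\<And>U. fps_nth U 0 = 0 \<Longrightarrow> fps_nth (\<Phi> U) 0 = 0"
    and contract: "\<And>U V m. m > 0 \<Longrightarrow> \<forall>i<m. fps_nth U i = fps_nth V i \<Longrightarrow>
      \<forall>i\<le>m. fps_nth (\<Phi> U) i = fps_nth (\<Phi> V) i"
  shows "\<exists>U. fps_nth U 0 = 0 \<and> \<Phi> U = U"
proof -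
  define W where "W k = (\<Phi> ^^ k) 0" for k
  have W0: "fps_nth (W k) 0 = 0" for k
    by (induction k) (auto simp: W_def zero)
  have step: "\<forall>i\<le>k. fps_nth (W (Suc k)) i = fps_nth (W k) i" for k
  proof (induction k)
    case 0
    then show ?case using W0 by simp
  next
    case (Suc k)
    then have "\<forall>i<Suc k. fps_nth (W (Suc k)) i = fps_nth (W k) i" by auto
    from contract[OF _ this] show ?case by (simp add: W_def)
  qed
  have stable: "fps_nth (W (i + j)) i = fps_nth (W i) i" for i j
    by (induction j) (use step in auto)
  define U where "U = Abs_fps (\<lambda>i. fps_nth (W i) i)"
  have U: "fps_nth U i = fps_nth (W k) i" if "i \<le> k" for i k
    using stable[of i "k - i"] that by (simp add: U_def)
  have "fps_nth (\<Phi> U) i = fps_nth U i" for i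
  proof -
    have "\<forall>j<Suc i. fps_nth U j = fps_nth (W (Suc i)) j" using U by auto
    then have "fps_nth (\<Phi> U) i = fps_nth (\<Phi> (W (Suc i))) i"
      using contract[OF zero_less_Suc, of i U "W (Suc i)"] by simp
    also have "\<dots> = fps_nth (W (Suc (Suc i))) i" by (simp add: W_def)
    also have "\<dots> = fps_nth U i" using U[of i "Suc (Suc i)"] by simp
    finally show ?thesis .
  qed
  then have "\<Phi> U = U" by (simp add: fps_eq_iff)
  moreover have "fps_nth U 0 = 0" using U[of 0 0] W0 by simp
  ultimately show ?thesis by blast
qed

text \<open>\<open>U\<^sup>Q - V\<^sup>Q = (U - V)\<^sup>Q\<close> for powers \<open>Q\<close> of the characteristic.\<close>

lemma fps_frobenius_contract:
  fixes U V :: "'a::field fps"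
  assumes p: "prime p" "CHAR('a) = p" and k: "k > 0" and m: "m > 0"
    and eq: "\<forall>i<m. fps_nth U i = fps_nth V i" and i: "i \<le> m"
  shows "fps_nth (U ^ p ^ k) i = fps_nth (V ^ p ^ k) i"
proof -
  define D where "D = U - V"
  have 1: "1 < p ^ k" using prime_gt_1_nat[OF p(1)] k by (intro one_less_power) auto
  have "U ^ p ^ k = (D + V) ^ p ^ k" by (simp add: D_def)
  also have "\<dots> = D ^ p ^ k + V ^ p ^ k" using p by (intro freshmans_dream'[of _ k]) auto
  finally have "U ^ p ^ k = D ^ p ^ k + V ^ p ^ k" .
  moreover have "fps_nth (D ^ p ^ k) i = 0"
  proof (cases "D = 0")
    case True
    then show ?thesis using prime_gt_0_nat[OF p(1)] by (simp add: power_0_left)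
  next
    case False
    have "m \<le> subdegree D" using False eq by (intro subdegree_geI) (auto simp: D_def)
    moreover have "2 * subdegree D \<le> p ^ k * subdegree D" using 1 by (intro mult_right_mono) auto
    ultimately have "i < p ^ k * subdegree D" using i m by linarith
    then have "i < subdegree (D ^ p ^ k)" by simp
    then show ?thesis by (rule nth_less_subdegree_zero)
  qed
  ultimately show ?thesis by simp
qed

lemma artin_schreier_series:
  fixes A :: "'a::field fps"
  assumes p: "prime p" "CHAR('a) = p" and k: "k > 0" and A: "fps_nth A 0 = 0"
  shows "\<exists>U. fps_nth U 0 = 0 \<and> U ^ p ^ k - U = A"
proof -
  have "\<exists>U. fps_nth U 0 = 0 \<and> U ^ p ^ k - A = U"
  proof (rule fps_fixpoint)
    show "fps_nth (U ^ p ^ k - A) 0 = 0" if "fps_nth U 0 = 0" for U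
      using that A prime_gt_0_nat[OF p(1)] by (simp add: power_0_left)
    show "\<forall>i\<le>m. fps_nth (U ^ p ^ k - A) i = fps_nth (V ^ p ^ k - A) i"
      if "m > 0" "\<forall>i<m. fps_nth U i = fps_nth V i" for U V m
      using fps_frobenius_contract[OF p k that] by simp
  qed
  then show ?thesis by (metis diff_diff_eq2 add_diff_cancel_left' diff_eq_eq)
qed

text \<open>Solving for the linear term \<open>U\<close> of the sum, that with \<open>j = 0\<close>, turns the equation into a fixed point equation.\<close>

lemma additive_series:
  fixes A :: "'a::field fps"
  assumes p: "prime p" "CHAR('a) = p" and b: "b > 0" and r: "r > 0" and A: "fps_nth A 0 = 0"
  shows "\<exists>U. fps_nth U 0 = 0 \<and> (\<Sum>j<r. U ^ p ^ (j * b)) = A"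
proof -
  have "\<exists>U. fps_nth U 0 = 0 \<and> A - (\<Sum>j\<in>{0<..<r}. U ^ p ^ (j * b)) = U"
  proof (rule fps_fixpoint)
    show "fps_nth (A - (\<Sum>j\<in>{0<..<r}. U ^ p ^ (j * b))) 0 = 0" if "fps_nth U 0 = 0" for U
      using that A prime_gt_0_nat[OF p(1)] by (simp add: fps_sum_nth fps_power_zeroth power_0_left)
    show "\<forall>i\<le>m. fps_nth (A - (\<Sum>j\<in>{0<..<r}. U ^ p ^ (j * b))) i
        = fps_nth (A - (\<Sum>j\<in>{0<..<r}. V ^ p ^ (j * b))) i"
      if "m > 0" "\<forall>i<m. fps_nth U i = fps_nth V i" for U V m
      using fps_frobenius_contract[OF p _ that] b by (auto simp: fps_sum_nth intro!: sum.cong)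
  qed
  then obtain U where U: "fps_nth U 0 = 0" "A - (\<Sum>j\<in>{0<..<r}. U ^ p ^ (j * b)) = U" by blast
  have "{..<r} = insert 0 {0<..<r}" using r by auto
  then have "(\<Sum>j<r. U ^ p ^ (j * b)) = U + (\<Sum>j\<in>{0<..<r}. U ^ p ^ (j * b))" by simp
  also have "\<dots> = A" using U(2) by (simp add: diff_eq_eq)
  finally show ?thesis using U(1) by blast
qed

lemma fps_to_fls_sum: "fps_to_fls (sum f I) = (\<Sum>i\<in>I. fps_to_fls (f i))"
  by (induction I rule: infinite_finite_induct) auto

text \<open>
  The projection of the affine curve to the \<open>z\<close>-axis is unramified: the derivatives of \<open>t(x)\<close>
  and of \<open>y\<^bsup>q\<^sup>2\<^esup> - y\<close> are the constants \<open>1\<close> and \<open>-1\<close>.  So \<open>z - z\<^sub>0\<close> is a local parameter at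
  every point, in which \<open>x\<close> and \<open>y\<close> have power series expansions.
\<close>

lemma curve_point_series:
  fixes c x0 y0 z0 :: "'a::field"
  assumes p: "prime p" "CHAR('a) = p" and b: "b > 0" and a: "a div b > 0" and q: "q = p ^ a"
    and eq1: "c * y0 ^ (q + 1) = additive_t p a b x0" and eq2: "y0 ^ q\<^sup>2 - y0 = z0 ^ M"
  obtains X1 Y1 :: "'a fps" where "fps_nth X1 0 = x0" "fps_nth Y1 0 = y0"
    "fls_const c * fps_to_fls Y1 ^ (q + 1) = additive_t p a b (fps_to_fls X1)"
    "fps_to_fls Y1 ^ q\<^sup>2 - fps_to_fls Y1 = (fls_const z0 + fls_X) ^ M"
proof -
  have a0: "a > 0" using a by (cases a) auto
  have q2: "q\<^sup>2 = p ^ (a * 2)" by (simp add: q power_mult)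
  define A where "A = (fps_const z0 + fps_X) ^ M - fps_const (z0 ^ M)"
  have "fps_nth A 0 = 0" by (simp add: A_def fps_power_zeroth)
  then obtain U where U: "fps_nth U 0 = 0" "U ^ p ^ (a * 2) - U = A"
    using artin_schreier_series[OF p, of "a * 2" A] a0 by auto
  define Y1 where "Y1 = fps_const y0 + U"
  have "Y1 ^ q\<^sup>2 = fps_const (y0 ^ q\<^sup>2) + U ^ q\<^sup>2"
    unfolding Y1_def q2 using p by (subst freshmans_dream'[of _ "a * 2"]) auto
  then have "Y1 ^ q\<^sup>2 - Y1 = fps_const (y0 ^ q\<^sup>2 - y0) + (U ^ q\<^sup>2 - U)"
    by (simp add: Y1_def flip: fps_const_sub)
  also have "\<dots> = (fps_const z0 + fps_X) ^ M" unfolding eq2 using U(2) by (simp add: A_def q2)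
  finally have Y1: "Y1 ^ q\<^sup>2 - Y1 = (fps_const z0 + fps_X) ^ M" .
  have Y0: "fps_nth Y1 0 = y0" using U by (simp add: Y1_def)
  define B where "B = fps_const c * Y1 ^ (q + 1) - fps_const (additive_t p a b x0)"
  have "fps_nth B 0 = 0" using Y0 eq1 by (simp add: B_def fps_power_zeroth)
  then obtain U' where U': "fps_nth U' 0 = 0" "(\<Sum>j<a div b. U' ^ p ^ (j * b)) = B"
    using additive_series[OF p b a, of B] by auto
  define X1 where "X1 = fps_const x0 + U'"
  have "(\<Sum>j<a div b. X1 ^ p ^ (j * b)) = (\<Sum>j<a div b. fps_const (x0 ^ p ^ (j * b)) + U' ^ p ^ (j * b))"
    unfolding X1_def using p by (intro sum.cong refl) (subst freshmans_dream', auto)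
  also have "\<dots> = fps_const c * Y1 ^ (q + 1)"
  proof -
    have "(\<Sum>j<a div b. fps_const (x0 ^ p ^ (j * b))) = fps_const (additive_t p a b x0)"
      by (simp add: fps_eq_iff fps_sum_nth additive_t_def)
    then show ?thesis unfolding sum.distrib U'(2) by (simp add: B_def)
  qed
  finally have X1: "fps_const c * Y1 ^ (q + 1) = (\<Sum>j<a div b. X1 ^ p ^ (j * b))" ..
  show thesis
  proof (rule that)
    show "fps_nth X1 0 = x0" using U' by (simp add: X1_def)
    show "fps_nth Y1 0 = y0" by (rule Y0)
    show "fls_const c * fps_to_fls Y1 ^ (q + 1) = additive_t p a b (fps_to_fls X1)"
      using arg_cong[OF X1, of fps_to_fls]
      by (simp add: fps_to_fls_power fls_times_fps_to_fls fps_to_fls_sum additive_t_def del: power_Suc flip: fps_const_to_fls)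
    show "fps_to_fls Y1 ^ q\<^sup>2 - fps_to_fls Y1 = (fls_const z0 + fls_X) ^ M"
      using arg_cong[OF Y1, of fps_to_fls] by (simp add: fps_to_fls_power)
  qed
qed

lemma is_hom_fls_const: "is_hom (fls_const :: 'a::field \<Rightarrow> 'a fls)"
  by (simp add: is_hom_def fls_plus_const)

text \<open>Over an algebraically closed field \<open>A\<close> splits into linear factors, and one of them vanishes at \<open>u\<close>.\<close>

lemma algebraic_imp_constant:
  fixes A :: "'a::alg_closed_field poly"
  assumes "A \<noteq> 0" "poly (map_poly fls_const A) u = 0"
  shows "u \<in> range fls_const"
  using assms
proof (induction "degree A" arbitrary: A rule: less_induct)
  case less
  show ?case
  proof (cases "degree A = 0")
    case True
    then obtain d where "A = [:d:]" by (auto elim: degree_eq_zeroE)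
    then show ?thesis using less.prems by (simp add: map_poly_pCons_hom[OF is_hom_fls_const])
  next
    case False
    then obtain r where "poly A r = 0" using alg_closed_imp_poly_has_root by blast
    then obtain B where B: "A = [:-r, 1:] * B" by (metis dvdE poly_eq_0_iff_dvd)
    then have "B \<noteq> 0" using less.prems by auto
    then have d: "degree A = Suc (degree B)" unfolding B by (simp add: degree_mult_eq del: mult_pCons_left)
    have "poly (map_poly fls_const A) u = (u - fls_const r) * poly (map_poly fls_const B) u"
      unfolding B is_hom_simps(4)[OF is_hom_map_poly[OF is_hom_fls_const]] poly_mult
      by (simp add: map_poly_pCons_hom[OF is_hom_fls_const])
    then show ?thesis using less.prems less.hyps[of B] d \<open>B \<noteq> 0\<close> by auto
  qed
qed

text \<open>Constant \<open>u\<close> would make first \<open>w\<close> and then \<open>t\<close> algebraic over the constants.\<close>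

lemma curve_point_nonconstant:
  fixes u w t :: "'a::alg_closed_field fls"
  assumes c: "c \<noteq> 0" and q: "q > 0" and M: "M > 0"
    and eq1: "fls_const c * w ^ (q + 1) = additive_t p a b u"
    and eq2: "w ^ q\<^sup>2 - w = t ^ M" and t: "t \<notin> range fls_const"
  shows "u \<notin> range fls_const"
proof
  assume "u \<in> range fls_const"
  then obtain r where u: "u = fls_const r" by auto
  note h = is_hom_simps[OF is_hom_map_poly[OF is_hom_fls_const]] map_poly_pCons_hom[OF is_hom_fls_const]
  have "poly (map_poly fls_const (monom c (q + 1) - [:additive_t p a b r:])) w = 0"
    unfolding h(6) using eq1 by (simp add: h map_poly_monom poly_monom u additive_t_hom[OF is_hom_fls_const])
  moreover have "monom c (q + 1) - [:additive_t p a b r:] \<noteq> 0"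
  proof
    assume "monom c (q + 1) - [:additive_t p a b r:] = 0"
    then have "coeff (monom c (q + 1) - [:additive_t p a b r:]) (q + 1) = 0" by simp
    then show False using c by simp
  qed
  ultimately have "w \<in> range fls_const" by (rule algebraic_imp_constant[rotated])
  then obtain d where w: "w = fls_const d" by auto
  have "poly (map_poly fls_const (monom 1 M - [:d ^ q\<^sup>2 - d:])) t = 0"
    unfolding h(6) using eq2
    by (simp add: h map_poly_monom poly_monom w is_hom_simps(6,7)[OF is_hom_fls_const])
  moreover have "monom 1 M - [:d ^ q\<^sup>2 - d:] \<noteq> 0"
  proof
    assume "monom 1 M - [:d ^ q\<^sup>2 - d:] = 0"
    then have "coeff (monom 1 M - [:d ^ q\<^sup>2 - d:]) M = 0" by simp
    then show False using M by (simp add: coeff_pCons split: nat.splits)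
  qed
  ultimately have "t \<in> range fls_const" by (rule algebraic_imp_constant[rotated])
  then show False using t by simp
qed

text \<open>
  If \<open>y\<^sub>0 = 0\<close>, then the orders of \<open>x - x\<^sub>0\<close>, \<open>y\<close>, \<open>z\<close> are \<open>(q + 1) M\<close>, \<open>M\<close>, \<open>1\<close> up to a common
  factor.  If \<open>y\<^sub>0 \<noteq> 0\<close>, then \<open>y\<close> is a unit, and if moreover \<open>z\<^sub>0 = 0\<close>, then the order of \<open>x - x\<^sub>0\<close>
  is at least that of \<open>y - y\<^sub>0\<close>, which is \<open>M\<close> times that of \<open>z\<close>.  The lemma shows that the monomials
  in the basis of the function field over \<open>K(x)\<close> cannot compensate a pole of a coefficient.
\<close>

lemma fibre_orders:
  fixes v :: "'l::field \<Rightarrow> int"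
  assumes v: "valuation v" and p: "prime p" "CHAR('l) = p" and b: "b > 0" and a: "a div b > 0"
    and q: "q = p ^ a" and C: "is_subring C" "\<forall>u\<in>C - {0}. v u = 0"
    and c: "c \<noteq> 0" "c \<in> C" and 0: "x0 \<in> C" "y0 \<in> C" "z0 \<in> C"
    and eq1: "c * y ^ (q + 1) = additive_t p a b x" and eq2: "y ^ q\<^sup>2 - y = z ^ M"
    and eq10: "c * y0 ^ (q + 1) = additive_t p a b x0" and eq20: "y0 ^ q\<^sup>2 - y0 = z0 ^ M"
    and x: "x \<noteq> x0" "0 < v (x - x0)" and y: "y = y0 \<or> 0 < v (y - y0)" and z: "z = z0 \<or> 0 < v (z - z0)"
    and yz: "y \<noteq> 0" "z \<noteq> 0" and ij: "i \<le> q" "j < M"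
  shows "v (y ^ i * z ^ j) < v (x - x0)"
proof -
  have p1: "p > 1" by (rule prime_gt_1_nat[OF p(1)])
  have a0: "a > 0" using a by (cases a) auto
  have q1: "q > 1" unfolding q using p1 a0 by (rule one_less_power)
  have yzv: "v (y ^ i * z ^ j) = int i * v y + int j * v z"
    using yz by (simp add: valuation_mult[OF v] valuation_power[OF v])
  have unit: "v u = 0" if "u0 \<in> C" "u0 \<noteq> 0" "u = u0 \<or> 0 < v (u - u0)" for u u0
    using valuation_add_dominant(2)[OF v that(2), of "u - u0"] that C(2) by auto
  have eq: "c * (y ^ (q + 1) - y0 ^ (q + 1)) = additive_t p a b (x - x0)"
    using eq1 eq10 additive_t_diff[OF p, of a b x x0] by (simp only: right_diff_distrib)
  have xv: "x - x0 \<noteq> 0" using x by simp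
  show ?thesis
  proof (cases "y0 = 0")
    case True
    have "v c = 0" using C c by simp
    have z0: "c * y ^ (q + 1) = additive_t p a b (x - x0)" using eq True by simp
    note z = zero_orders[OF v p1 b a q1 xv x(2) yz c(1) \<open>v c = 0\<close> z0 eq2]
    have vz: "v z > 0" using z(1,3) ij by (metis of_nat_0_less_iff zero_less_mult_pos gr_zeroI less_nat_zero_code)
    have "int i * v y + int j * v z < int q * v y + int M * v z"
      using ij vz z(1) by (intro add_le_less_mono mult_right_mono mult_strict_right_mono) auto
    also have "\<dots> = v (x - x0)" using z(2,3) by (simp add: algebra_simps)
    finally show ?thesis unfolding yzv .
  next
    case False
    then have vy: "v y = 0" using unit 0 y by blast
    show ?thesis
    proof (cases "z0 = 0")
      case False
      then have "v z = 0" using unit 0 z by blast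
      then show ?thesis using vy x yzv by simp
    next
      case True
      then have vz: "v z > 0" using z yz by auto
      define u where "u = y - y0"
      have q2: "q\<^sup>2 = p ^ (a * 2)" by (simp add: q power_mult)
      have "y ^ q\<^sup>2 = (u + y0) ^ q\<^sup>2" by (simp add: u_def)
      also have "\<dots> = u ^ q\<^sup>2 + y0 ^ q\<^sup>2" using p q2 by (intro freshmans_dream'[of _ "a * 2"]) auto
      finally have u: "u ^ q\<^sup>2 - u = z ^ M"
        using eq2 eq20 True ij by (simp add: u_def power_0_left algebra_simps)
      have "q\<^sup>2 > 0" using q1 by simp
      then have unz: "u \<noteq> 0" using u yz by (auto simp: power_0_left)
      then have uv: "0 < v u" using y by (auto simp: u_def)
      have "1 < q\<^sup>2" using q1 by (rule one_less_power) simp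
      from valuation_artin_schreier[OF v this unz uv yz(2) u] have Mz: "int M * v z = v u" .
      have v0: "v (x - x0) = v (additive_t p a b (x - x0))" "additive_t p a b (x - x0) \<noteq> 0"
        using valuation_additive_t[OF v xv x(2) p1 b a] by auto
      define d where "d = c * (\<Sum>k<q+1. y0 ^ (q + 1 - Suc k) * y ^ k)"
      have f: "additive_t p a b (x - x0) = u * d"
        unfolding eq[symmetric] d_def u_def power_diff_sumr2 by (simp only: mult.left_commute)
      have "d \<noteq> 0" using f v0(2) by auto
      have "(\<Sum>k<q+1. y0 ^ (q + 1 - Suc k) * y ^ k) = 0 \<or> 0 \<le> v (\<Sum>k<q+1. y0 ^ (q + 1 - Suc k) * y ^ k)"
        using vy C(2) 0 yz \<open>y0 \<noteq> 0\<close>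
        by (intro valuation_sum_ge[OF v]) (simp add: valuation_mult[OF v] valuation_power[OF v])
      then have "0 \<le> v d" using \<open>d \<noteq> 0\<close> C c by (auto simp: d_def valuation_mult[OF v])
      then have "v u \<le> v (x - x0)" unfolding v0(1) f using unz \<open>d \<noteq> 0\<close> by (simp add: valuation_mult[OF v])
      moreover have "int j * v z < int M * v z" using ij vz by (intro mult_strict_right_mono) auto
      ultimately show ?thesis unfolding yzv vy Mz by simp
    qed
  qed
qed

text \<open>A double root would be a root of the derivative \<open>n u\<^bsup>n-1\<^esup>\<close>, hence zero.\<close>

lemma card_roots_of_unity:
  assumes "of_nat n \<noteq> (0 :: 'a::alg_closed_field)"
  shows "card {u::'a. u ^ n = 1} = n"
proof -
  have n: "n > 0" using assms by (cases n) auto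
  define P :: "'a poly" where "P = monom 1 n - 1"
  have ev: "poly P u = u ^ n - 1" for u by (simp add: P_def poly_monom)
  have cn: "coeff P n = 1" using n by (simp add: P_def coeff_1)
  then have nz: "P \<noteq> 0" by auto
  have "degree P \<le> n" unfolding P_def by (intro degree_diff_le) (auto simp: degree_monom_le)
  then have dg: "degree P = n" using le_degree[of P n] cn by simp
  have ord: "order u P = 1" if u: "poly P u = 0" for u
  proof -
    have "\<not> [:-u, 1:] ^ 2 dvd P"
    proof
      assume "[:-u, 1:] ^ 2 dvd P"
      then obtain R where "P = [:-u, 1:] ^ 2 * R" by (elim dvdE)
      then have "P = [:-u, 1:] * ([:-u, 1:] * R)" by (simp only: power2_eq_square mult.assoc)
      then have "poly (pderiv P) u = 0" by (simp only: pderiv_mult poly_add poly_mult) simp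
      then have "of_nat n * u ^ (n - 1) = 0" by (simp add: P_def pderiv_diff pderiv_monom poly_monom)
      then have "u = 0" using assms by auto
      then show False using u n by (simp add: ev power_0_left)
    qed
    then have "\<not> 2 \<le> order u P" using nz by (simp add: order_divides)
    moreover have "order u P \<noteq> 0" using u nz by (simp add: order_root)
    ultimately show ?thesis by simp
  qed
  obtain A where A: "size A = degree P" "P = smult (lead_coeff P) (\<Prod>r\<in>#A. [:-r, 1:])"
    using alg_closed_imp_factorization[OF nz] by blast
  have "proots (\<Prod>r\<in>#B. [:-r, 1:]) = B" for B :: "'a multiset"
  proof (induction B)
    case (add r B)
    have "(\<Prod>r\<in>#B. [:-r, 1:]) \<noteq> 0" by (induction B) (auto simp del: mult_pCons_left)
    then have "proots ([:-r, 1:] * (\<Prod>r\<in>#B. [:-r, 1:])) = add_mset r B"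
      using add by (subst proots_mult) auto
    then show ?case by (simp del: mult_pCons_left)
  qed simp
  then have "proots P = A"
    using nz by (subst A(2)) (simp add: leading_coeff_0_iff)
  then have "n = size (proots P)" using A(1) dg by simp
  also have "\<dots> = (\<Sum>u\<in>set_mset (proots P). count (proots P) u)" by (rule size_multiset_overloaded_eq)
  also have "\<dots> = (\<Sum>u\<in>{u::'a. u ^ n = 1}. 1)"
  proof (rule sum.cong)
    show "set_mset (proots P) = {u. u ^ n = 1}" using nz by (simp add: set_count_proots ev)
    show "count (proots P) u = 1" if "u \<in> {u. u ^ n = 1}" for u
      using that nz ord[of u] by (simp add: ev)
  qed
  finally show ?thesis by simp
qed

section \<open>Functions regular outside the given places\<close>

lemma fls_vge_nth:
  assumes "u = 0 \<or> D \<le> fls_subdegree u" "k < D"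
  shows "fls_nth u k = 0"
  using assms by auto

lemma fls_const_mult_sum_nth:
  fixes u :: "'i \<Rightarrow> 'a::field fls"
  shows
  "fls_nth (\<Sum>s\<in>I. fls_const (c s) * u s) k = (\<Sum>s\<in>I. c s * fls_nth (u s) k)"
  by (induction I rule: infinite_finite_induct) (auto simp: fls_mult_const_nth)

text \<open>
  The sums are a discrete Fourier transform over the \<open>n\<close>-th roots of unity.  For \<open>k < D\<close> the polynomial
  of degree less than \<open>n\<close> whose coefficients are the \<open>k\<close>-th coefficients of the \<open>u s\<close> vanishes at all
  \<open>n\<close> roots of unity.
\<close>

lemma fourier_components:
  fixes u :: "nat \<Rightarrow> 'a::alg_closed_field fls"
  assumes n: "of_nat n \<noteq> (0 :: 'a)"
    and sums: "\<And>\<eta>. \<eta> ^ n = 1 \<Longrightarrow>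
      (\<Sum>s<n. fls_const (\<eta> ^ s) * u s) = 0 \<or> D \<le> fls_subdegree (\<Sum>s<n. fls_const (\<eta> ^ s) * u s)"
    and s: "s < n"
  shows "u s = 0 \<or> D \<le> fls_subdegree (u s)"
proof -
  have "fls_nth (u s) k = 0" if k: "k < D" for k
  proof -
    define P :: "'a poly" where "P = (\<Sum>s<n. monom (fls_nth (u s) k) s)"
    have cf: "coeff P i = (if i < n then fls_nth (u i) k else 0)" for i
      by (simp add: P_def coeff_sum)
    have "poly P \<eta> = 0" if "\<eta> ^ n = 1" for \<eta>
      using fls_vge_nth[OF sums[OF that] k] unfolding fls_const_mult_sum_nth
      by (simp add: P_def poly_sum poly_monom mult.commute)
    then have sub: "{\<eta>. \<eta> ^ n = 1} \<subseteq> {\<eta>. poly P \<eta> = 0}" by auto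
    have "P = 0"
    proof (rule ccontr)
      assume nz: "P \<noteq> 0"
      have "n > 0" using s by simp
      then have "degree P < n" using degree_le[of "n - 1" P] cf by fastforce
      moreover have "n \<le> card {\<eta>. poly P \<eta> = 0}"
        using card_mono[OF poly_roots_finite[OF nz] sub] card_roots_of_unity[OF n] by simp
      ultimately show False using card_poly_roots_bound[OF nz] by simp
    qed
    then show ?thesis using cf[of s] s by simp
  qed
  then show ?thesis using fls_subdegree_geI by blast
qed

lemma is_hom_to_ac: "is_hom (to_ac :: 'a::field \<Rightarrow> 'a alg_closure)"
  by (simp add: is_hom_def)

context curve
begin

lemma e_component_form:
  obtains A B where "\<forall>s. A s \<in> poly_over K" "B \<in> poly_over K" "B \<noteq> 0"
    "h = (\<Sum>s<n. poly (A s) x * e s) / poly B x"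
proof -
  obtain A B where AB: "\<forall>s. A s \<in> poly_over K" "B \<in> poly_over K" "B \<noteq> 0"
    "h = (\<Sum>s<n. poly (A s) x * z ^ s) / poly B x" by (rule component_form)
  show thesis
  proof (rule that[of "\<lambda>s. A s * V ^ (s div M)" B])
    show "\<forall>s. A s * V ^ (s div M) \<in> poly_over K" using AB(1) V_over by (simp add: KX_cl)
    show "h = (\<Sum>s<n. poly (A s * V ^ (s div M)) x * e s) / poly B x"
      unfolding AB(4) z_power_s by (simp add: mult.assoc)
  qed (use AB in auto)
qed

text \<open>
  Let \<open>\<beta>\<close> be a root of the denominator \<open>B\<close> in the algebraic closure, and take a point of the
  curve above \<open>x = \<beta>\<close>.  Its conjugates \<open>(\<beta>, \<eta>\<^sup>M y\<^sub>0, \<eta> z\<^sub>0)\<close> with \<open>\<eta>\<^sup>n = 1\<close> are again points,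
  and each of them gives a place of the function field through the power series expansion.  As
  \<open>h\<close> has no pole there, and \<open>e s\<close> is multiplied by \<open>\<eta>\<^sup>s\<close>, no component \<open>A\<^sub>s(x) e s / B(x)\<close> has a pole, which
  forces \<open>A\<^sub>s(\<beta>) = 0\<close> because \<open>e s\<close> vanishes to a smaller order than \<open>x - \<beta>\<close>.
\<close>

lemma numerators_vanish:
  assumes A: "\<forall>s. A s \<in> poly_over K" and B: "B \<in> poly_over K" "B \<noteq> 0"
    and h: "h = (\<Sum>s<n. poly (A s) x * e s) / poly B x"
    and S: "S \<subseteq> K"
    and regular: "\<forall>v. is_place K v \<and> 0 \<le> v x \<and> (\<forall>r\<in>S. v (x - r) \<le> 0) \<longrightarrow> h = 0 \<or> 0 \<le> v h"
    and \<beta>: "poly (map_poly to_ac B) \<beta> = 0" "\<beta> \<notin> to_ac ` S"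
    and s: "s < n"
  shows "poly (map_poly to_ac (A s)) \<beta> = 0"
proof (rule ccontr)
  assume contra: "poly (map_poly to_ac (A s)) \<beta> \<noteq> 0"
  define c' where "c' = to_ac c"
  have c': "c' \<noteq> 0" using c by (simp add: c'_def)
  \<comment> \<open>A point \<open>(\<beta>, y0, z0)\<close> of the curve and the expansions \<open>x'\<close>, \<open>y'\<close>, \<open>z'\<close> of the coordinates there.\<close>
  obtain y0 where y0: "y0 ^ (q + 1) = additive_t p a b \<beta> / c'" using nth_root_exists[of "q + 1"] by auto
  obtain z0 where z0: "z0 ^ M = y0 ^ q\<^sup>2 - y0" using nth_root_exists[OF M(1)] by blast
  have eq10: "c' * y0 ^ (q + 1) = additive_t p a b \<beta>" using y0 c' by simp
  have eq20: "y0 ^ q\<^sup>2 - y0 = z0 ^ M" using z0 by simp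
  have char': "CHAR('f alg_closure) = p" using char by simp
  have char'': "CHAR('f alg_closure fls) = p" using char by simp
  obtain X1 Y1 where XY: "fps_nth X1 0 = \<beta>" "fps_nth Y1 0 = y0"
    "fls_const c' * fps_to_fls Y1 ^ (q + 1) = additive_t p a b (fps_to_fls X1)"
    "fps_to_fls Y1 ^ q\<^sup>2 - fps_to_fls Y1 = (fls_const z0 + fls_X) ^ M"
    by (rule curve_point_series[OF p char' b(1) ab(1) q eq10 eq20])
  define x' y' z' where "x' = fps_to_fls X1" and "y' = fps_to_fls Y1" and "z' = fls_const z0 + fls_X"
  have eq1': "fls_const c' * y' ^ (q + 1) = additive_t p a b x'" and eq2': "y' ^ q\<^sup>2 - y' = z' ^ M"
    using XY by (simp_all add: x'_def y'_def z'_def)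
  have z'_nonconst: "z' \<notin> range fls_const"
  proof
    assume "z' \<in> range fls_const"
    then obtain d where "z' = fls_const d" by auto
    from arg_cong[OF this, of "\<lambda>f. fls_nth f 1"] show False by (simp add: z'_def)
  qed
  have x'_nonconst: "x' \<notin> range fls_const"
    using q_gt_1 by (intro curve_point_nonconstant[OF c' _ M(1) eq1' eq2' z'_nonconst]) auto
  let ?C = "range (fls_const :: 'f alg_closure \<Rightarrow> _)"
  have C: "is_subring ?C" "\<forall>u\<in>?C - {0}. fls_subdegree u = 0"
  proof -
    show "is_subring ?C"
      unfolding is_subring_def
      by (auto simp: fls_minus_const intro: rangeI[of fls_const 0, simplified] rangeI[of fls_const 1, simplified])
  qed auto
  note val = valuation_fls_subdegree[where 'a = "'f alg_closure"]
  have x'_pos: "x' \<noteq> fls_const \<beta>" "0 < fls_subdegree (x' - fls_const \<beta>)"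
  proof -
    show ne: "x' \<noteq> fls_const \<beta>" using x'_nonconst by auto
    have eq: "x' - fls_const \<beta> = fps_to_fls (X1 - fps_const \<beta>)" by (simp add: x'_def)
    have "0 < subdegree (X1 - fps_const \<beta>)"
      using ne XY(1) by (auto simp: subdegree_pos_iff x'_def simp flip: fps_const_to_fls)
    then show "0 < fls_subdegree (x' - fls_const \<beta>)" unfolding eq fls_subdegree_fls_to_fps by simp
  qed
  have y'_pos: "y' = fls_const y0 \<or> 0 < fls_subdegree (y' - fls_const y0)"
  proof -
    have eq: "y' - fls_const y0 = fps_to_fls (Y1 - fps_const y0)" by (simp add: y'_def)
    have "y' = fls_const y0 \<or> 0 < subdegree (Y1 - fps_const y0)"
      using XY(2) by (auto simp: subdegree_pos_iff y'_def simp flip: fps_const_to_fls)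
    then show ?thesis unfolding eq fls_subdegree_fls_to_fps by simp
  qed
  have z'_pos: "z' = fls_const z0 \<or> 0 < fls_subdegree (z' - fls_const z0)" by (simp add: z'_def)
  have z'_nz: "z' \<noteq> 0" using z'_nonconst rangeI[of fls_const 0] by auto
  have y'_nz: "y' \<noteq> 0"
  proof
    assume "y' = 0"
    then have "z' ^ M = 0" using eq2' q_gt_1 by (simp add: power_0_left)
    then show False using z'_nz by simp
  qed
  define \<kappa> where "\<kappa> u = fls_const (to_ac u)" for u :: 'f
  have \<kappa>: "is_hom \<kappa>"
    unfolding \<kappa>_def by (rule is_hom_comp[OF is_hom_to_ac is_hom_fls_const])
  note \<kappa>h = is_hom_simps[OF \<kappa>]
  have mp\<kappa>: "map_poly \<kappa> F = map_poly fls_const (map_poly to_ac F)" for F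
    by (simp add: poly_eq_iff coeff_map_poly \<kappa>_def)
  \<comment> \<open>The embedding of \<open>K[x]\<close> into the Laurent series; it is common to all conjugates of the point.\<close>
  define \<rho> where "\<rho> F = poly (map_poly \<kappa> F) x'" for F
  have "is_hom \<rho>"
    unfolding \<rho>_def by (rule is_hom_comp[OF is_hom_map_poly[OF \<kappa>] is_hom_poly])
  note \<rho>h = is_hom_simps[OF this]
  have \<rho>_nz: "\<rho> F \<noteq> 0" if "F \<noteq> 0" for F
  proof
    assume "\<rho> F = 0"
    then have "poly (map_poly fls_const (map_poly to_ac F)) x' = 0" by (simp add: \<rho>_def mp\<kappa>)
    moreover have "map_poly to_ac F \<noteq> 0" using that by (simp add: map_poly_eq_0_iff)
    ultimately show False using algebraic_imp_constant x'_nonconst by blast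
  qed
  have \<rho>_val: "\<rho> F \<noteq> 0 \<and> fls_subdegree (\<rho> F) = 0" if "poly (map_poly to_ac F) \<beta> \<noteq> 0" for F
  proof -
    have "map_poly \<kappa> F \<in> poly_over ?C" by (auto simp: poly_over_def coeff_map_poly \<kappa>_def)
    moreover have "poly (map_poly \<kappa> F) (fls_const \<beta>) \<noteq> 0"
      using that by (simp add: mp\<kappa> poly_map_poly_hom[OF is_hom_fls_const])
    ultimately show ?thesis
      unfolding \<rho>_def using valuation_poly_nonroot[OF val C(2,1) _ rangeI] x'_pos by blast
  qed
  define D where "D = fls_subdegree (x' - fls_const \<beta>)"
  have \<rho>B: "D \<le> fls_subdegree (\<rho> B)"
  proof -
    obtain F where F: "map_poly to_ac B = [:-\<beta>, 1:] * F" using \<beta>(1) by (metis dvdE poly_eq_0_iff_dvd)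
    have "\<rho> B = poly (map_poly fls_const [:-\<beta>, 1:]) x' * poly (map_poly fls_const F) x'"
      unfolding \<rho>_def mp\<kappa> F is_hom_simps(4)[OF is_hom_map_poly[OF is_hom_fls_const]] by simp
    also have "poly (map_poly fls_const [:-\<beta>, 1:]) x' = x' - fls_const \<beta>"
      by (simp add: map_poly_pCons_hom[OF is_hom_fls_const])
    finally have 1: "\<rho> B = (x' - fls_const \<beta>) * poly (map_poly fls_const F) x'" .
    have "map_poly fls_const F \<in> poly_over ?C" by (auto simp: poly_over_def coeff_map_poly)
    moreover have "x' = 0 \<or> 0 \<le> fls_subdegree x'" by (simp add: x'_def fls_subdegree_fls_to_fps)
    ultimately have "0 \<le> fls_subdegree (poly (map_poly fls_const F) x')"
      using valuation_poly_nonneg[OF val C(2)] by fastforce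
    then show ?thesis using \<rho>_nz[OF B(2)] unfolding 1 D_def by simp
  qed
  have T': "\<rho> W = y' ^ (q + 1)"
  proof -
    have "\<rho> T = additive_t p a b x'"
      unfolding T_def \<rho>h by (simp add: \<rho>_def map_poly_monom \<kappa>h poly_monom additive_t_def)
    moreover have "fls_const c' * \<rho> W = \<rho> T"
    proof -
      have "T = [:c:] * W" using c by (simp add: W_def)
      then have "\<rho> T = \<rho> [:c:] * \<rho> W" using \<rho>h(4) by metis
      then show ?thesis by (simp add: \<rho>_def map_poly_pCons_hom[OF \<kappa>] \<kappa>_def c'_def)
    qed
    ultimately show ?thesis using eq1' c' by (metis fls_const_eq_0_iff mult_left_cancel)
  qed
  have z'M: "z' ^ M = y' * \<rho> V"
    unfolding eq2'[symmetric] q2_split T'[symmetric] V_def \<rho>h by (simp add: algebra_simps)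
  have z'n: "z' ^ n = \<rho> G"
  proof -
    have "z' ^ n = (z' ^ M) ^ (q + 1)" by (simp only: n_def mult.commute[of "q + 1"] power_mult)
    then show ?thesis unfolding z'M power_mult_distrib T'[symmetric] by (simp only: G_def \<rho>h)
  qed
  define e' where "e' s = y' ^ (s div M) * z' ^ (s mod M)" for s
  have "(\<Sum>s<n. fls_const (\<eta> ^ s) * (\<rho> (A s) * e' s)) = 0 \<or>
      D \<le> fls_subdegree (\<Sum>s<n. fls_const (\<eta> ^ s) * (\<rho> (A s) * e' s))" if \<eta>: "\<eta> ^ n = 1" for \<eta>
  proof -
    define \<epsilon> where "\<epsilon> = fls_const \<eta>"
    have "\<epsilon> ^ n = 1" by (simp add: \<epsilon>_def \<eta> flip: fls_const_power)
    then have "(\<epsilon> * z') ^ n = poly (map_poly \<kappa> G) x'"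
      using z'n by (simp add: power_mult_distrib \<rho>_def)
    moreover have "poly (map_poly \<kappa> F) x' \<noteq> 0" if "F \<in> poly_over K" "F \<noteq> 0" for F
      using \<rho>_nz[OF that(2)] by (simp add: \<rho>_def)
    ultimately obtain \<phi> where \<phi>: "is_hom \<phi>" "\<forall>k\<in>K. \<phi> k = \<kappa> k" "\<phi> x = x'" "\<phi> z = \<epsilon> * z'"
      using hom_exists[OF \<kappa>, of x' "\<epsilon> * z'"] by blast
    note \<phi>h = is_hom_simps[OF \<phi>(1)] is_hom_field[OF \<phi>(1)]
    have \<phi>_poly: "\<phi> (poly F x) = \<rho> F" if "F \<in> poly_over K" for F
    proof -
      have "map_poly \<phi> F = map_poly \<kappa> F"
        using that \<phi>(2) by (simp add: poly_eq_iff coeff_map_poly \<phi>h \<kappa>h poly_over_def)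
      then show ?thesis using poly_map_poly_hom[OF \<phi>(1), of F x] \<phi>(3) by (simp add: \<rho>_def)
    qed
    have "\<epsilon> ^ M * y' * \<rho> V = \<phi> y * \<rho> V"
      using arg_cong[OF z_power_M, of \<phi>] z'M by (simp add: \<phi>h \<phi>_poly V_over \<phi>(4) power_mult_distrib mult.assoc)
    then have \<phi>y: "\<phi> y = \<epsilon> ^ M * y'" using \<rho>_nz[OF V_nonzero] by (metis mult_right_cancel)
    have \<phi>e: "\<phi> (e s) = fls_const (\<eta> ^ s) * e' s" for s
    proof -
      have "\<epsilon> ^ s = (\<epsilon> ^ M) ^ (s div M) * \<epsilon> ^ (s mod M)" by (simp flip: power_mult power_add)
      then have "\<phi> (e s) = \<epsilon> ^ s * e' s"
        by (simp only: e_def e'_def \<phi>h \<phi>y \<phi>(4) power_mult_distrib mult_ac)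
      then show ?thesis by (simp add: \<epsilon>_def fls_const_power)
    qed
    \<comment> \<open>The local parameter \<open>z - z0\<close> need not lie in the function field, so an element of order \<open>1\<close>
      is not at hand, and the order is normalized instead.\<close>
    define v where "v = fls_subdegree \<circ> \<phi>"
    have v: "valuation v" unfolding v_def by (rule valuation_comp_hom[OF val \<phi>(1)])
    have vK: "\<forall>u\<in>K - {0}. v u = 0" using \<phi>(2) by (simp add: v_def \<kappa>_def)
    have Bx: "poly B x \<noteq> 0" using transcendental B by blast
    have "D \<le> v (poly B x)" using \<rho>B by (simp add: v_def \<phi>_poly[OF B(1)])
    moreover have "D > 0" using x'_pos by (simp add: D_def)
    ultimately have "v (poly B x) \<noteq> 0" by simp
    then obtain w d where w: "is_place K w" "d > 0" "\<And>u. v u = d * w u"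
      using normalize_valuation[OF v vK Bx] by blast
    have "0 \<le> v x" by (simp add: v_def \<phi>(3) x'_def fls_subdegree_fls_to_fps)
    then have "0 \<le> w x" using w by (simp add: zero_le_mult_iff)
    moreover have "w (x - r) \<le> 0" if "r \<in> S" for r
    proof (rule ccontr)
      assume "\<not> w (x - r) \<le> 0"
      then have "0 < v (x - r)" using w by simp
      then have 1: "0 < fls_subdegree (x' - \<kappa> r)" using that S \<phi>(2) by (auto simp: v_def \<phi>h \<phi>(3))
      have "\<beta> - to_ac r \<noteq> 0" using that \<beta>(2) by auto
      then have "fls_const (\<beta> - to_ac r) \<noteq> 0" by simp
      moreover have "fls_const (\<beta> - to_ac r) = (x' - \<kappa> r) + - (x' - fls_const \<beta>)"
        by (simp add: \<kappa>_def fls_minus_const[symmetric])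
      moreover have "(x' - \<kappa> r) + - (x' - fls_const \<beta>) = 0 \<or> 1 \<le> fls_subdegree ((x' - \<kappa> r) + - (x' - fls_const \<beta>))"
        using 1 x'_pos by (intro valuation_add_ge[OF val]) (simp_all add: valuation_minus[OF val] del: minus_diff_eq)
      ultimately show False by (metis fls_const_subdegree not_one_le_zero)
    qed
    ultimately have "h = 0 \<or> 0 \<le> w h" using regular w(1) by blast
    then have "h = 0 \<or> 0 \<le> v h" using w by auto
    moreover have "h * poly B x = (\<Sum>s<n. poly (A s) x * e s)" using h Bx by simp
    then have "\<phi> h * \<rho> B = (\<Sum>s<n. fls_const (\<eta> ^ s) * (\<rho> (A s) * e' s))"
      using A by (simp add: \<phi>h \<phi>e \<phi>_poly[symmetric] B mult_ac flip: \<phi>h(4))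
        (simp add: \<phi>h \<phi>e \<phi>_poly mult_ac)
    moreover have "\<phi> h * \<rho> B = 0 \<or> D \<le> fls_subdegree (\<phi> h * \<rho> B)" if "h = 0 \<or> 0 \<le> v h"
      using that \<rho>B \<rho>_nz[OF B(2)] by (cases "h = 0") (auto simp: \<phi>h v_def)
    ultimately show ?thesis by simp
  qed
  moreover have "of_nat n \<noteq> (0 :: 'f alg_closure)"
  proof -
    have "coprime n p"
      using coprimes(3) q a by (simp add: coprime_mult_right_iff)
    then have "\<not> p dvd n" using p by (metis coprime_common_divisor dvd_refl not_prime_unit)
    then show ?thesis by (simp add: of_nat_eq_0_iff_char_dvd char)
  qed
  ultimately have "\<rho> (A s) * e' s = 0 \<or> D \<le> fls_subdegree (\<rho> (A s) * e' s)"
    using fourier_components[of n "\<lambda>s. \<rho> (A s) * e' s" D s] s by blast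
  moreover have "e' s \<noteq> 0" using y'_nz z'_nz by (simp add: e'_def)
  moreover have "fls_subdegree (e' s) < D"
    unfolding D_def e'_def
  proof (rule fibre_orders[OF val p char'' b(1) ab(1) q C _ _ _ _ _ eq1' eq2' _ _ x'_pos y'_pos z'_pos y'_nz z'_nz])
    show "fls_const c' * fls_const y0 ^ (q + 1) = additive_t p a b (fls_const \<beta>)"
      using arg_cong[OF eq10, of fls_const] 
      by (simp only: is_hom_simps[OF is_hom_fls_const] additive_t_hom[OF is_hom_fls_const])
    show "fls_const y0 ^ q\<^sup>2 - fls_const y0 = fls_const z0 ^ M"
      using arg_cong[OF eq20, of fls_const] by (simp only: is_hom_simps[OF is_hom_fls_const])
    have "s div M < q + 1" using s by (intro less_mult_imp_div_less) (simp add: n_def)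
    then show "s div M \<le> q" by simp
  qed (use c' M in auto)
  ultimately show False using \<rho>_val[OF contra] by simp
qed

text \<open>\<open>F\<close> is the minimal polynomial of \<open>\<beta>\<close> over \<open>K\<close>.\<close>

lemma common_factor_at_root:
  assumes B: "B \<in> poly_over K" "B \<noteq> 0" "poly (map_poly to_ac B) \<beta> = 0"
  obtains F where "F \<in> poly_over K" "degree F > 0"
    "\<And>A. A \<in> poly_over K \<Longrightarrow> poly (map_poly to_ac A) \<beta> = 0 \<Longrightarrow> \<exists>Q\<in>poly_over K. A = F * Q"
proof -
  define R where "R F \<longleftrightarrow> F \<in> poly_over K \<and> F \<noteq> 0 \<and> poly (map_poly to_ac F) \<beta> = 0" for F
  define F where "F = (ARG_MIN degree F. R F)"
  have F: "R F" "\<And>F'. R F' \<Longrightarrow> degree F \<le> degree F'"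
    unfolding F_def using arg_min_nat_lemma[of R B degree] B by (auto simp: R_def)
  note h = is_hom_simps[OF is_hom_comp[OF is_hom_map_poly[OF is_hom_to_ac] is_hom_poly]]
  have F': "F \<in> poly_over K" "F \<noteq> 0" using F(1) by (auto simp: R_def)
  have "degree F > 0"
  proof (rule ccontr)
    assume "\<not> degree F > 0"
    then obtain d where "F = [:d:]" by (auto elim: degree_eq_zeroE)
    then show False using F(1) by (auto simp: R_def map_poly_pCons)
  qed
  moreover have "\<exists>Q\<in>poly_over K. A = F * Q" if A: "A \<in> poly_over K" "poly (map_poly to_ac A) \<beta> = 0" for A
  proof -
    have lc: "inverse (lead_coeff F) \<in> K" "inverse (lead_coeff F) * lead_coeff F = 1"
      using F' by (auto intro!: inverse_K poly_over_coeff)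
    obtain Q P where QP: "Q \<in> poly_over K" "P \<in> poly_over K" "A = Q * F + P" "\<forall>i\<ge>degree F. coeff P i = 0"
      using division_poly_over[OF K_sub A(1) F'(1) lc] by blast
    have "poly (map_poly to_ac P) \<beta> = 0"
      using A(2) F(1) unfolding QP(3) h by (simp add: R_def)
    have "P = 0"
    proof (rule ccontr)
      assume "P \<noteq> 0"
      then have "degree F \<le> degree P" using F(2) QP(2) \<open>poly (map_poly to_ac P) \<beta> = 0\<close> by (simp add: R_def)
      then have "lead_coeff P = 0" using QP(4) by blast
      then show False using \<open>P \<noteq> 0\<close> by simp
    qed
    then show ?thesis using QP by (auto simp: mult.commute)
  qed
  ultimately show thesis using that F'(1) by blast
qed

text \<open>
  A denominator of smallest degree has no roots in the algebraic closure outside \<open>S\<close>, since such a root would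
  be shared by all numerators and could be cancelled.
\<close>

lemma regular_form:
  assumes S: "finite S" "S \<subseteq> K"
    and regular: "\<forall>v. is_place K v \<and> 0 \<le> v x \<and> (\<forall>r\<in>S. v (x - r) \<le> 0) \<longrightarrow> h = 0 \<or> 0 \<le> v h"
  obtains A f where "\<forall>s. A s \<in> poly_over K"
    "h = (\<Sum>s<n. poly (A s) x * e s) / (\<Prod>r\<in>S. (x - r) ^ f r)"
proof -
  define R where "R B \<longleftrightarrow> B \<in> poly_over K \<and> B \<noteq> 0 \<and>
    (\<exists>A. (\<forall>s. A s \<in> poly_over K) \<and> h = (\<Sum>s<n. poly (A s) x * e s) / poly B x)" for B
  obtain A0 B0 where "\<forall>s. A0 s \<in> poly_over K" "B0 \<in> poly_over K" "B0 \<noteq> 0"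
    "h = (\<Sum>s<n. poly (A0 s) x * e s) / poly B0 x" by (rule e_component_form)
  then have "R B0" unfolding R_def by blast
  define B where "B = (ARG_MIN degree B. R B)"
  have "R B" and min: "\<And>B'. R B' \<Longrightarrow> degree B \<le> degree B'"
    unfolding B_def using arg_min_nat_lemma[of R B0 degree] \<open>R B0\<close> by auto
  then obtain A where B: "B \<in> poly_over K" "B \<noteq> 0" and A: "\<forall>s. A s \<in> poly_over K"
    and h: "h = (\<Sum>s<n. poly (A s) x * e s) / poly B x" by (auto simp: R_def)
  have roots: "\<beta> \<in> to_ac ` S" if \<beta>: "poly (map_poly to_ac B) \<beta> = 0" for \<beta>
  proof (rule ccontr)
    assume nS: "\<beta> \<notin> to_ac ` S"
    obtain F where F: "F \<in> poly_over K" "degree F > 0"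
      "\<And>A. A \<in> poly_over K \<Longrightarrow> poly (map_poly to_ac A) \<beta> = 0 \<Longrightarrow> \<exists>Q\<in>poly_over K. A = F * Q"
      using common_factor_at_root[OF B \<beta>] by blast
    obtain B' where B': "B' \<in> poly_over K" "B = F * B'" using F(3)[OF B(1) \<beta>] by blast
    have "\<forall>s. \<exists>Q. Q \<in> poly_over K \<and> (s < n \<longrightarrow> A s = F * Q)"
      using F(3) A numerators_vanish[of A B h S \<beta>, OF A B h S(2) regular \<beta> nS] KX_cl(1) by metis
    then obtain A' where A': "\<And>s. A' s \<in> poly_over K" "\<And>s. s < n \<Longrightarrow> A s = F * A' s" by metis
    have nz: "B' \<noteq> 0" "F \<noteq> 0" using B' B by auto
    have "h = (\<Sum>s<n. poly F x * (poly (A' s) x * e s)) / (poly F x * poly B' x)"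
      unfolding h B'(2) using A'(2) by (simp add: mult.assoc)
    also have "\<dots> = (\<Sum>s<n. poly (A' s) x * e s) / poly B' x"
      using transcendental[OF F(1) nz(2)] by (simp flip: sum_distrib_left)
    finally have "R B'" unfolding R_def using nz B' A' by blast
    then have "degree B \<le> degree B'" by (rule min)
    then show False using F(2) nz unfolding B'(2) by (simp add: degree_mult_eq)
  qed
  obtain f C where C: "C \<in> poly_over K" "\<forall>r\<in>S. poly C r \<noteq> 0" "B = (\<Prod>r\<in>S. [:-r, 1:] ^ f r) * C"
    using split_roots_poly_over[OF K_sub S B] by blast
  note hh = is_hom_simps[OF is_hom_map_poly[OF is_hom_to_ac]]
  have "degree C = 0"
  proof (rule ccontr)
    assume "degree C \<noteq> 0"
    then have "degree (map_poly to_ac C) > 0" by (simp add: degree_map_poly)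
    then obtain \<beta> where \<beta>: "poly (map_poly to_ac C) \<beta> = 0" using alg_closed_imp_poly_has_root by blast
    then have "poly (map_poly to_ac B) \<beta> = 0" unfolding C(3) hh by simp
    then obtain r where r: "r \<in> S" "\<beta> = to_ac r" using roots by blast
    then have "to_ac (poly C r) = 0" using \<beta> poly_map_poly_hom[OF is_hom_to_ac, of C r] by simp
    then show False using C(2) r by simp
  qed
  then obtain d where d: "C = [:d:]" by (auto elim: degree_eq_zeroE)
  have dK: "d \<in> K" "d \<noteq> 0" using C B poly_over_coeff[OF C(1), of 0] by (auto simp: d)
  show thesis
  proof (rule that[of "\<lambda>s. [:inverse d:] * A s" f])
    show "\<forall>s. [:inverse d:] * A s \<in> poly_over K"
      using A const_poly_over[OF K_sub inverse_K[OF dK(1)]] KX_cl(4) by blast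
    have "poly B x = (\<Prod>r\<in>S. (x - r) ^ f r) * d" unfolding C(3) d by (simp add: poly_prod poly_power)
    then show "h = (\<Sum>s<n. poly ([:inverse d:] * A s) x * e s) / (\<Prod>r\<in>S. (x - r) ^ f r)"
      unfolding h by (simp add: mult.assoc divide_inverse flip: sum_distrib_left)
  qed
qed

end

section \<open>Absolute maximal elements\<close>

lemma residue_eqI:
  fixes \<kappa> :: int
  assumes "coprime (int n) \<kappa>" "int n dvd w - \<kappa> * int s" "int n dvd w - \<kappa> * int t" "s < n" "t < n"
  shows "s = t"
proof -
  have "int n dvd (w - \<kappa> * int s) - (w - \<kappa> * int t)" by (rule dvd_diff[OF assms(2,3)])
  then have "int n dvd \<kappa> * (int t - int s)" by (simp add: algebra_simps)
  then have "int n dvd int t - int s" using assms(1) by (simp add: coprime_dvd_mult_right_iff)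
  then have "\<bar>int t - int s\<bar> = 0" using assms(4,5) zdvd_imp_le[of "int n" "\<bar>int t - int s\<bar>"] by fastforce
  then show ?thesis by simp
qed

locale curve_points = curve +
  fixes m :: nat and \<alpha> :: "nat \<Rightarrow> 'a" and P :: "nat \<Rightarrow> 'a \<Rightarrow> int" and Pinf :: "'a \<Rightarrow> int"
  assumes m: "m \<ge> 1"
    and \<alpha>: "inj_on \<alpha> {1..m}" "\<And>l. l \<in> {1..m} \<Longrightarrow> \<alpha> l \<in> K \<and> additive_t p a b (\<alpha> l) = 0"
    and Pinf: "is_place K Pinf" "Pinf x < 0"
    and P: "\<And>l. l \<in> {1..m} \<Longrightarrow> is_place K (P l) \<and> 0 < P l (x - \<alpha> l)"
begin

definition places :: "('a \<Rightarrow> int) list" where "places = Pinf # map P [1..<m+1]"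

definition point :: "nat \<Rightarrow> 'a \<Rightarrow> int" where "point l = (if l = 0 then Pinf else P l)"

definition pole_orders_at :: "'a \<Rightarrow> int list" where
  "pole_orders_at h = map (\<lambda>v. - v h) places"

definition regular_outside :: "'a \<Rightarrow> bool" where
  "regular_outside h \<longleftrightarrow> h \<noteq> 0 \<and> (\<forall>v. is_place K v \<and> v \<notin> set places \<longrightarrow> regular_at v h)"

definition monomial :: "(nat \<Rightarrow> int) \<Rightarrow> nat \<Rightarrow> 'a" where
  "monomial k s = (\<Prod>l\<in>{1..m}. (x - \<alpha> l) powi k l) * e s"

lemma length_places: "length places = m + 1"
  by (simp add: places_def)

lemma nth_places: "l < m + 1 \<Longrightarrow> places ! l = point l"
  by (cases l) (auto simp: places_def point_def simp del: upt_Suc)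

lemma length_pole_orders_at: "length (pole_orders_at h) = m + 1"
  by (simp add: pole_orders_at_def length_places)

lemma pole_orders_at_nth: "l < m + 1 \<Longrightarrow> pole_orders_at h ! l = - point l h"
  by (simp add: pole_orders_at_def length_places nth_places)

lemma pole_orders_at_eqI:
  assumes "\<And>l. l < m + 1 \<Longrightarrow> point l h = point l h'"
  shows "pole_orders_at h = pole_orders_at h'"
  by (rule nth_equalityI) (simp_all add: length_pole_orders_at pole_orders_at_nth assms)

lemma generalized_semigroup_eq: "generalized_semigroup K places = {pole_orders_at h | h. regular_outside h}"
  unfolding generalized_semigroup_def pole_orders_at_def regular_outside_def by auto

lemma point_place: "l < m + 1 \<Longrightarrow> is_place K (point l)"
  using Pinf P by (auto simp: point_def)

lemma point_val: 
  assumes "l < m + 1"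
  shows "valuation (point l)" "\<forall>u\<in>K - {0}. point l u = 0"
  using point_place[OF assms] by (auto simp: is_place_iff)

lemma x_minus_K: "r \<in> K \<Longrightarrow> x - r \<noteq> 0"
  using transcendental[OF linear_poly_over[OF K_sub], of r] by simp

text \<open>
  Poles of \<open>x\<close> and zeros of \<open>x - \<alpha> l\<close> are unique, so being different from the given places is a
  condition on the orders of these functions.
\<close>

lemma other_place_iff:
  assumes v: "is_place K v"
  shows "v \<notin> set places \<longleftrightarrow> 0 \<le> v x \<and> (\<forall>l\<in>{1..m}. v (x - \<alpha> l) \<le> 0)"
proof
  assume n: "v \<notin> set places"
  have "0 \<le> v x"
  proof (rule ccontr)
    assume "\<not> 0 \<le> v x"
    then have "v = Pinf" using place_at_pole_unique[OF v _ Pinf] by simp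
    then show False using n by (simp add: places_def)
  qed
  moreover have "v (x - \<alpha> l) \<le> 0" if l: "l \<in> {1..m}" for l
  proof (rule ccontr)
    assume "\<not> v (x - \<alpha> l) \<le> 0"
    then have "v = P l" using place_at_root_unique[OF v, of "\<alpha> l" "P l"] P[OF l] \<alpha>(2)[OF l] by simp
    then show False using n l by (auto simp: places_def)
  qed
  ultimately show "0 \<le> v x \<and> (\<forall>l\<in>{1..m}. v (x - \<alpha> l) \<le> 0)" by blast
next
  assume *: "0 \<le> v x \<and> (\<forall>l\<in>{1..m}. v (x - \<alpha> l) \<le> 0)"
  show "v \<notin> set places"
  proof
    assume "v \<in> set places"
    then have "v = Pinf \<or> (\<exists>l\<in>{1..m}. v = P l)"
      by (auto simp: places_def less_Suc_eq_le simp del: upt_Suc)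
    then show False using * Pinf P by fastforce
  qed
qed

lemma factors_nonzero: "l \<in> {1..m} \<Longrightarrow> (x - \<alpha> l) powi k \<noteq> 0"
  using x_minus_K \<alpha> by (simp add: power_int_eq_0_iff)

lemma monomial_nonzero: "monomial k s \<noteq> 0"
  using factors_nonzero e_nonzero by (simp add: monomial_def)

lemma valuation_e: "valuation v \<Longrightarrow> v (e s) = int (s div M) * v y + int (s mod M) * v z"
  using y_nonzero z_nonzero by (simp add: e_def valuation_mult valuation_power)

lemma valuation_monomial:
  assumes v: "valuation v"
  shows "v (monomial k s) = (\<Sum>l\<in>{1..m}. k l * v (x - \<alpha> l)) + v (e s)"
proof -
  have "v (\<Prod>l\<in>{1..m}. (x - \<alpha> l) powi k l) = (\<Sum>l\<in>{1..m}. v ((x - \<alpha> l) powi k l))"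
    using factors_nonzero by (intro valuation_prod[OF v]) auto
  also have "\<dots> = (\<Sum>l\<in>{1..m}. k l * v (x - \<alpha> l))"
    using x_minus_K \<alpha>(2) by (intro sum.cong refl valuation_power_int[OF v]) auto
  finally show ?thesis
    using factors_nonzero e_nonzero by (simp add: monomial_def valuation_mult[OF v])
qed

lemma monomial_at_root:
  assumes l: "l \<in> {1..m}"
  shows "P l (monomial k s) = int n * k l + int s"
proof -
  have v: "is_place K (P l)" "0 < P l (x - \<alpha> l)" using P[OF l] by auto
  then have val: "valuation (P l)" "\<forall>u\<in>K - {0}. P l u = 0" by (auto simp: is_place_iff)
  have r: "\<alpha> l \<in> K" "additive_t p a b (\<alpha> l) = 0" using \<alpha>(2)[OF l] by auto
  note o = place_at_root[OF v(1) r v(2)]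
  have other: "P l (x - \<alpha> l') = 0" if "l' \<in> {1..m} - {l}" for l'
  proof -
    have "\<alpha> l' \<noteq> \<alpha> l" "\<alpha> l' \<in> K" using \<alpha> l that by (auto dest: inj_onD)
    then show ?thesis
      using valuation_poly_nonroot(2)[OF val K_sub linear_poly_over[OF K_sub] r(1) _ disjI2[OF v(2)], of "\<alpha> l'"]
      by simp
  qed
  have "(\<Sum>l'\<in>{1..m}. k l' * P l (x - \<alpha> l')) = k l * P l (x - \<alpha> l) + (\<Sum>l'\<in>{1..m} - {l}. k l' * P l (x - \<alpha> l'))"
    using l by (intro sum.remove) auto
  also have "(\<Sum>l'\<in>{1..m} - {l}. k l' * P l (x - \<alpha> l')) = 0"
    using other by (intro sum.neutral) auto
  finally have "P l (monomial k s) = k l * int n + (int (s div M) * int M + int (s mod M))"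
    by (simp add: valuation_monomial[OF val(1)] valuation_e[OF val(1)] o)
  also have "int (s div M) * int M + int (s mod M) = int s"
    by (metis div_mult_mod_eq of_nat_add of_nat_mult)
  finally show ?thesis by simp
qed

lemma monomial_at_pole:
  "Pinf (monomial k s) = - int n * (\<Sum>l\<in>{1..m}. k l) - (int (M * N) * int (s div M) + int (q\<^sup>2 * N) * int (s mod M))"
proof -
  have val: "valuation Pinf" using Pinf by (auto simp: is_place_iff)
  note o = place_at_pole[OF Pinf]
  have "Pinf (x - \<alpha> l) = - int n" if "l \<in> {1..m}" for l
    using o(5)[OF linear_poly_over[OF K_sub], of "\<alpha> l"] \<alpha>(2)[OF that] by simp
  then have "(\<Sum>l\<in>{1..m}. k l * Pinf (x - \<alpha> l)) = (\<Sum>l\<in>{1..m}. k l * (- int n))"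
    by (intro sum.cong) auto
  also have "\<dots> = - int n * (\<Sum>l\<in>{1..m}. k l)"
    by (simp only: sum_distrib_right[symmetric] mult.commute)
  finally show ?thesis
    unfolding valuation_monomial[OF val] by (simp add: valuation_e[OF val] o)
qed

text \<open>
  Modulo \<open>n\<close> the order of \<open>f e\<^sub>s\<close> with \<open>f\<close> in \<open>K(x)\<close> is the product of this number with \<open>s\<close>, as it
  is the order of \<open>z\<close>.
\<close>

definition residue_factor :: "nat \<Rightarrow> int" where
  "residue_factor l = (if l = 0 then - int (q\<^sup>2 * N) else 1)"

lemma residue_factor_coprime: "coprime (int n) (residue_factor l)"
  using coprimes(3) unfolding residue_factor_def by (simp only: coprime_int_iff coprime_minus_right_iff split: if_split) simp

lemma point_term:
  assumes l: "l < m + 1" and C: "C \<in> poly_over K" "C \<noteq> 0" "\<forall>l\<in>{1..m}. poly C (\<alpha> l) \<noteq> 0"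
  shows "point l (poly C x * monomial k s) = point l (monomial k s) - (if l = 0 then int (n * degree C) else 0)"
proof -
  have "point l (poly C x) = - (if l = 0 then int (n * degree C) else 0)"
  proof (cases "l = 0")
    case True
    then show ?thesis using place_at_pole(5)[OF Pinf C(1,2)] by (simp add: point_def)
  next
    case False
    then have l': "l \<in> {1..m}" using l by auto
    have "point l = P l" using False by (simp add: point_def)
    then show ?thesis
      using valuation_poly_nonroot(2)[OF point_val[OF l] K_sub C(1), of "\<alpha> l" x] \<alpha>(2)[OF l'] C(3) l' P[OF l'] False
      by auto
  qed
  then show ?thesis
    using transcendental[OF C(1,2)] monomial_nonzero by (simp add: valuation_mult[OF point_val(1)[OF l]])
qed

lemma point_term_residue:
  assumes l: "l < m + 1" and C: "C \<in> poly_over K" "C \<noteq> 0" "\<forall>l\<in>{1..m}. poly C (\<alpha> l) \<noteq> 0"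
  shows "int n dvd point l (poly C x * monomial k s) - residue_factor l * int s"
proof (cases "l = 0")
  case True
  have "int s = int (s div M) * int M + int (s mod M)"
    by (metis div_mult_mod_eq of_nat_add of_nat_mult)
  then have "point l (poly C x * monomial k s) - residue_factor l * int s
      = - int n * (\<Sum>l\<in>{1..m}. k l) - int n * int (degree C)
        + int (s div M) * int N * (int M * (int q * int q - 1))"
    unfolding point_term[OF assms] using True
    by (simp add: point_def residue_factor_def monomial_at_pole algebra_simps power2_eq_square)
  also have "int M * (int q * int q - 1) = int n * (int q - 1)" by (simp add: n_def algebra_simps)
  finally show ?thesis by simp
next
  case False
  then have "l \<in> {1..m}" using l by auto
  then show ?thesis unfolding point_term[OF assms] using False
    by (simp add: point_def residue_factor_def monomial_at_root)
qed

text \<open>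
  Outside the given places \<open>x\<close> is regular and the \<open>x - \<alpha> l\<close> are units; \<open>y\<close> and \<open>z\<close> are regular as they
  are integral over \<open>K[x]\<close>.
\<close>

lemma term_regular:
  assumes C: "C \<in> poly_over K" "C \<noteq> 0"
  shows "regular_outside (poly C x * monomial k s)"
  unfolding regular_outside_def
proof (intro conjI allI impI)
  show "poly C x * monomial k s \<noteq> 0" using transcendental[OF C] monomial_nonzero by simp
  fix v assume "is_place K v \<and> v \<notin> set places"
  then have v: "is_place K v" and x: "0 \<le> v x" and r: "\<And>l. l \<in> {1..m} \<Longrightarrow> v (x - \<alpha> l) \<le> 0"
    using other_place_iff by auto
  have val: "valuation v" "\<forall>u\<in>K - {0}. v u = 0" using v by (auto simp: is_place_iff)
  have poly: "poly A x = 0 \<or> 0 \<le> v (poly A x)" if "A \<in> poly_over K" for A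
    using valuation_poly_nonneg[OF val that] x by blast
  have "v (x - \<alpha> l) = 0" if "l \<in> {1..m}" for l
    using poly[OF linear_poly_over[OF K_sub], of "\<alpha> l"] x_minus_K[of "\<alpha> l"] \<alpha>(2)[OF that] r[OF that] by simp
  then have 1: "(\<Sum>l\<in>{1..m}. k l * v (x - \<alpha> l)) = 0" by simp
  have "int (q + 1) * v y = v (poly W x)"
    unfolding y_power[symmetric] by (rule valuation_power[OF val(1) y_nonzero, symmetric])
  also have "\<dots> \<ge> 0" using poly[OF W_over] transcendental[OF W_over degree_W(2)] by simp
  finally have y: "0 \<le> v y" by (simp add: zero_le_mult_iff)
  have "int M * v z = v (y * poly V x)"
    unfolding z_power_M[symmetric] by (rule valuation_power[OF val(1) z_nonzero, symmetric])
  also have "\<dots> \<ge> 0"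
    using y poly[OF V_over] transcendental[OF V_over V_nonzero] y_nonzero by (simp add: valuation_mult[OF val(1)])
  finally have z: "0 \<le> v z" using M by (simp add: zero_le_mult_iff)
  have "v (poly C x * monomial k s) \<ge> 0"
    using poly[OF C(1)] transcendental[OF C] monomial_nonzero y z
    unfolding valuation_mult[OF val(1) transcendental[OF C] monomial_nonzero] valuation_monomial[OF val(1)] 1
    by (simp add: valuation_e[OF val(1)])
  then show "regular_at v (poly C x * monomial k s)" by (simp add: regular_at_def)
qed

lemma monomial_regular: "regular_outside (monomial k s)"
  using term_regular[of 1 k s] KX_cl(2) by simp

lemma decomposition:
  assumes h: "regular_outside h"
  obtains I C k where "I \<subseteq> {..<n}" "I \<noteq> {}" "h = (\<Sum>s\<in>I. poly (C s) x * monomial (k s) s)"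
    "\<forall>s\<in>I. C s \<in> poly_over K \<and> C s \<noteq> 0 \<and> (\<forall>l\<in>{1..m}. poly (C s) (\<alpha> l) \<noteq> 0)"
proof -
  define S where "S = \<alpha> ` {1..m}"
  have S: "finite S" "S \<subseteq> K" using \<alpha>(2) by (auto simp: S_def)
  have "\<forall>v. is_place K v \<and> 0 \<le> v x \<and> (\<forall>r\<in>S. v (x - r) \<le> 0) \<longrightarrow> h = 0 \<or> 0 \<le> v h"
    using h other_place_iff unfolding regular_outside_def S_def regular_at_def by blast
  then obtain A f where A: "\<forall>s. A s \<in> poly_over K"
    and hA: "h = (\<Sum>s<n. poly (A s) x * e s) / (\<Prod>r\<in>S. (x - r) ^ f r)"
    using regular_form[OF S] by blast
  have reindex: "(\<Prod>r\<in>S. (x - r) ^ g r) = (\<Prod>l\<in>{1..m}. (x - \<alpha> l) ^ g (\<alpha> l))" for g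
    unfolding S_def using \<alpha>(1) by (simp add: prod.reindex)
  have "\<exists>g C. C \<in> poly_over K \<and> (\<forall>r\<in>S. poly C r \<noteq> 0) \<and> A s = (\<Prod>r\<in>S. [:-r, 1:] ^ g r) * C"
    if "A s \<noteq> 0" for s
    using split_roots_poly_over[OF K_sub S _ that] A by blast
  then obtain g C where gC: "\<And>s. A s \<noteq> 0 \<Longrightarrow> C s \<in> poly_over K \<and> (\<forall>r\<in>S. poly (C s) r \<noteq> 0) \<and>
      A s = (\<Prod>r\<in>S. [:-r, 1:] ^ g s r) * C s" by metis
  define I where "I = {s. s < n \<and> A s \<noteq> 0}"
  define k where "k s l = int (g s (\<alpha> l)) - int (f (\<alpha> l))" for s l
  have t: "poly (A s) x * e s / (\<Prod>r\<in>S. (x - r) ^ f r) = poly (C s) x * monomial (k s) s" if "s \<in> I" for s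
  proof -
    have As: "A s = (\<Prod>r\<in>S. [:-r, 1:] ^ g s r) * C s" using gC that by (auto simp: I_def)
    have "poly (A s) x = (\<Prod>l\<in>{1..m}. (x - \<alpha> l) ^ g s (\<alpha> l)) * poly (C s) x"
      unfolding As by (simp add: poly_prod poly_power reindex)
    moreover have "(\<Prod>l\<in>{1..m}. (x - \<alpha> l) powi k s l)
      = (\<Prod>l\<in>{1..m}. (x - \<alpha> l) ^ g s (\<alpha> l)) / (\<Prod>l\<in>{1..m}. (x - \<alpha> l) ^ f (\<alpha> l))"
      unfolding prod_dividef[symmetric] k_def using x_minus_K \<alpha>(2)
      by (intro prod.cong refl) (simp add: power_int_diff)
    ultimately show ?thesis by (simp add: monomial_def reindex)
  qed
  have "h = (\<Sum>s<n. poly (A s) x * e s / (\<Prod>r\<in>S. (x - r) ^ f r))"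
    unfolding hA by (simp add: sum_divide_distrib)
  also have "\<dots> = (\<Sum>s\<in>I. poly (A s) x * e s / (\<Prod>r\<in>S. (x - r) ^ f r))"
    by (intro sum.mono_neutral_right) (auto simp: I_def)
  also have "\<dots> = (\<Sum>s\<in>I. poly (C s) x * monomial (k s) s)" using t by (intro sum.cong) auto
  finally have hI: "h = (\<Sum>s\<in>I. poly (C s) x * monomial (k s) s)" .
  show thesis
  proof (rule that[OF _ _ hI])
    show "I \<subseteq> {..<n}" by (auto simp: I_def)
    show "I \<noteq> {}" using hI h by (auto simp: regular_outside_def)
    show "\<forall>s\<in>I. C s \<in> poly_over K \<and> C s \<noteq> 0 \<and> (\<forall>l\<in>{1..m}. poly (C s) (\<alpha> l) \<noteq> 0)"
      using gC by (force simp: I_def S_def)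
  qed
qed

text \<open>At each given point the orders of the components are pairwise incongruent modulo \<open>n\<close>.\<close>

lemma sum_point:
  assumes I: "I \<subseteq> {..<n}" "I \<noteq> {}" and h: "h = (\<Sum>s\<in>I. poly (C s) x * monomial (k s) s)"
    and C: "\<forall>s\<in>I. C s \<in> poly_over K \<and> C s \<noteq> 0 \<and> (\<forall>l\<in>{1..m}. poly (C s) (\<alpha> l) \<noteq> 0)"
    and l: "l < m + 1"
  shows "\<exists>s\<in>I. point l h = point l (poly (C s) x * monomial (k s) s)"
    "\<And>s. s \<in> I \<Longrightarrow> point l h \<le> point l (poly (C s) x * monomial (k s) s)"
proof -
  let ?t = "\<lambda>s. poly (C s) x * monomial (k s) s"
  have fin: "finite I" using I(1) finite_subset by blast
  have nz: "?t s \<noteq> 0" if "s \<in> I" for s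
    using that bspec[OF C that] transcendental monomial_nonzero by auto
  then have ex: "\<exists>s\<in>I. ?t s \<noteq> 0" using I(2) by blast
  have inj: "s = t" if st: "s \<in> I" "t \<in> I" and eq: "point l (?t s) = point l (?t t)" for s t
  proof (rule residue_eqI)
    show "int n dvd point l (?t s) - residue_factor l * int s"
      using point_term_residue[OF l] bspec[OF C st(1)] by blast
    show "int n dvd point l (?t s) - residue_factor l * int t"
      unfolding eq using point_term_residue[OF l] bspec[OF C st(2)] by blast
  qed (use residue_factor_coprime st I in auto)
  obtain s where s: "s \<in> I" "point l h = point l (?t s)" "\<And>t. t \<in> I \<Longrightarrow> point l (?t s) \<le> point l (?t t)"
    using valuation_sum_distinct(2)[of "point l" I ?t, OF point_val(1)[OF l] fin ex] inj nz unfolding h by blast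
  then show "\<exists>s\<in>I. point l h = point l (?t s)" "\<And>s. s \<in> I \<Longrightarrow> point l h \<le> point l (?t s)" by auto
qed

text \<open>
  The divisor \<open>n (P\<^sub>l - P\<^sub>\<infinity>)\<close> of \<open>x - \<alpha> l\<close> has degree \<open>0\<close> and is supported in the given points, so
  the exponents do not contribute to the sum.
\<close>

lemma sum_point_monomial:
  "(\<Sum>l<m+1. point l (monomial k s)) = (\<Sum>l<m+1. point l (monomial k' s))"
proof -
  have *: "(\<Sum>l<m+1. point l (monomial k s)) = int m * int s - (int (M * N) * int (s div M) + int (q\<^sup>2 * N) * int (s mod M))"
    for k
  proof -
    have "{..<m+1} = insert 0 {1..m}" by auto
    then have "(\<Sum>l<m+1. point l (monomial k s)) = Pinf (monomial k s) + (\<Sum>l\<in>{1..m}. P l (monomial k s))"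
      by (simp add: point_def)
    also have "(\<Sum>l\<in>{1..m}. P l (monomial k s)) = (\<Sum>l\<in>{1..m}. int n * k l + int s)"
      using monomial_at_root by (intro sum.cong) auto
    finally show ?thesis
      by (simp add: monomial_at_pole sum.distrib sum_distrib_left[symmetric])
  qed
  show ?thesis by (simp only: *)
qed

text \<open>
  The order of \<open>h\<close> at a point of \<open>J\<close> has the residue that belongs to \<open>s\<close>, so it is attained by the
  component of \<open>h\<close> with index \<open>s\<close>.  The orders of that component are then at least those of the monomial,
  and larger outside \<open>J\<close>, which contradicts the equality of the sums.
\<close>

lemma nabla_monomial:
  assumes s: "s < n" and J: "J \<noteq> {}" "J \<subset> {..<m+1}"
  shows "nabla K places J (pole_orders_at (monomial k s)) = {}"
proof (rule ccontr)
  assume "nabla K places J (pole_orders_at (monomial k s)) \<noteq> {}"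
  then obtain h where h: "regular_outside h"
    and J1: "\<And>j. j \<in> J \<Longrightarrow> pole_orders_at h ! j = pole_orders_at (monomial k s) ! j"
    and J2: "\<And>i. i \<in> {..<m+1} - J \<Longrightarrow> pole_orders_at h ! i < pole_orders_at (monomial k s) ! i"
    unfolding nabla_def generalized_semigroup_eq length_places by auto
  have J1: "point j h = point j (monomial k s)" if "j \<in> J" for j
    using J1[OF that] that J(2) by (auto simp: pole_orders_at_nth)
  have J2: "point i (monomial k s) < point i h" if "i \<in> {..<m+1} - J" for i
    using J2[OF that] that by (auto simp: pole_orders_at_nth)
  obtain I C k' where dec: "I \<subseteq> {..<n}" "I \<noteq> {}" "h = (\<Sum>s\<in>I. poly (C s) x * monomial (k' s) s)"
    "\<forall>s\<in>I. C s \<in> poly_over K \<and> C s \<noteq> 0 \<and> (\<forall>l\<in>{1..m}. poly (C s) (\<alpha> l) \<noteq> 0)"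
    using decomposition[OF h] by blast
  note sp = sum_point[OF dec]
  have attained: "s \<in> I \<and> point j h = point j (poly (C s) x * monomial (k' s) s)" if j: "j \<in> J" for j
  proof -
    have jm: "j < m + 1" using j J by auto
    obtain t where t: "t \<in> I" "point j h = point j (poly (C t) x * monomial (k' t) t)" using sp(1)[OF jm] by blast
    have "t = s"
    proof (rule residue_eqI)
      show "int n dvd point j h - residue_factor j * int t"
        unfolding t(2) using point_term_residue[OF jm] bspec[OF dec(4) t(1)] by blast
      show "int n dvd point j h - residue_factor j * int s"
        unfolding J1[OF j] using point_term_residue[OF jm, of 1 k s] KX_cl(2) by simp
    qed (use residue_factor_coprime s t dec(1) in auto)
    then show ?thesis using t by simp
  qed
  then have sI: "s \<in> I" using J by blast
  let ?t = "poly (C s) x * monomial (k' s) s"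
  have le: "point l (monomial k s) \<le> point l ?t" if "l \<in> {..<m+1}" for l
  proof (cases "l \<in> J")
    case True
    then show ?thesis using attained[OF True] J1[OF True] by simp
  next
    case False
    then show ?thesis using J2[of l] sp(2)[of l, OF _ sI] that by force
  qed
  obtain i where i: "i \<in> {..<m+1}" "i \<notin> J" using J by blast
  then have lt: "point i (monomial k s) < point i ?t"
    using J2[of i] sp(2)[of i, OF _ sI] by force
  have "(\<Sum>l<m+1. point l (monomial k s)) < (\<Sum>l<m+1. point l ?t)"
    using le lt i by (intro sum_strict_mono_ex1) auto
  also have "\<dots> \<le> (\<Sum>l<m+1. point l (monomial (k' s) s))"
    using point_term bspec[OF dec(4) sI] by (intro sum_mono) auto
  also have "\<dots> = (\<Sum>l<m+1. point l (monomial k s))" by (rule sum_point_monomial)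
  finally show False by simp
qed

text \<open>
  A component of \<open>h\<close> that does not attain the order of \<open>h\<close> at all points lies in \<open>\<nabla>\<^sub>J\<close>, where \<open>J\<close>
  consists of the points at which it does.  If all are attained, \<open>J = {1..m}\<close> excludes a nonconstant factor
  \<open>C(x)\<close>, since dropping it changes the pole order at infinity only.
\<close>

theorem Gamma_hat_eq: "Gamma_hat K places = {pole_orders_at (monomial k s) | k s. s < n}"
proof (intro equalityI subsetI)
  fix \<gamma> assume "\<gamma> \<in> Gamma_hat K places"
  then have \<gamma>: "\<gamma> \<in> generalized_semigroup K places"
    and max: "\<And>J. J \<noteq> {} \<Longrightarrow> J \<subset> {..<m+1} \<Longrightarrow> nabla K places J \<gamma> = {}"
    by (auto simp: Gamma_hat_def absolute_maximal_def length_places)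
  obtain h where h: "regular_outside h" "\<gamma> = pole_orders_at h" using \<gamma> by (auto simp: generalized_semigroup_eq)
  obtain I C k where dec: "I \<subseteq> {..<n}" "I \<noteq> {}" "h = (\<Sum>s\<in>I. poly (C s) x * monomial (k s) s)"
    "\<forall>s\<in>I. C s \<in> poly_over K \<and> C s \<noteq> 0 \<and> (\<forall>l\<in>{1..m}. poly (C s) (\<alpha> l) \<noteq> 0)"
    using decomposition[OF h(1)] by blast
  note sp = sum_point[OF dec]
  obtain s where s: "s \<in> I" "point 0 h = point 0 (poly (C s) x * monomial (k s) s)"
    using sp(1)[of 0] by auto
  let ?t = "poly (C s) x * monomial (k s) s"
  have C: "C s \<in> poly_over K" "C s \<noteq> 0" "\<forall>l\<in>{1..m}. poly (C s) (\<alpha> l) \<noteq> 0" using bspec[OF dec(4) s(1)] by auto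
  define J where "J = {l. l < m + 1 \<and> point l h = point l ?t}"
  have "J = {..<m+1}"
  proof (rule ccontr)
    assume "J \<noteq> {..<m+1}"
    moreover have "pole_orders_at ?t \<in> nabla K places J \<gamma>"
      unfolding nabla_def generalized_semigroup_eq h(2) length_places
      using term_regular[OF C(1,2)] sp(2)[OF _ s(1)] by (force simp: J_def pole_orders_at_nth)
    moreover have "J \<noteq> {}" "J \<subseteq> {..<m+1}" using s by (auto simp: J_def)
    ultimately show False using max[of J] by blast
  qed
  then have \<gamma>t: "\<gamma> = pole_orders_at ?t" unfolding h(2) by (intro pole_orders_at_eqI) (auto simp: J_def)
  have "degree (C s) = 0"
  proof (rule ccontr)
    assume d: "degree (C s) \<noteq> 0"
    have less: "pole_orders_at (monomial (k s) s) \<in> nabla K places {1..m} \<gamma>"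
      unfolding nabla_def generalized_semigroup_eq \<gamma>t length_places
    proof (intro CollectI conjI ballI)
      show "\<exists>h. pole_orders_at (monomial (k s) s) = pole_orders_at h \<and> regular_outside h"
        using monomial_regular by blast
      show "pole_orders_at (monomial (k s) s) ! j = pole_orders_at ?t ! j" if "j \<in> {1..m}" for j
        using that by (simp add: pole_orders_at_nth point_term[OF _ C])
      show "pole_orders_at (monomial (k s) s) ! i < pole_orders_at ?t ! i" if "i \<in> {..<m+1} - {1..m}" for i
      proof -
        have "i = 0" using that by auto
        then show ?thesis using d n_pos by (simp add: pole_orders_at_nth point_term[OF _ C])
      qed
    qed
    have ne: "{1..m} \<noteq> {}" using m by simp
    have sub: "{1..m} \<subset> {..<m+1}"
    proof (rule psubsetI)
      show "{1..m} \<subseteq> {..<m+1}" by (rule subsetI) simp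
      have "0 \<in> {..<m+1}" "0 \<notin> {1..m}" by simp_all
      then show "{1..m} \<noteq> {..<m+1}" by metis
    qed
    note J = ne sub
    from less max[OF J] show False by (simp only: empty_iff)
  qed
  then have "\<gamma> = pole_orders_at (monomial (k s) s)"
    unfolding \<gamma>t by (intro pole_orders_at_eqI) (simp add: point_term[OF _ C])
  then show "\<gamma> \<in> {pole_orders_at (monomial k s) | k s. s < n}" using s dec(1) by auto
next
  fix \<gamma> assume "\<gamma> \<in> {pole_orders_at (monomial k s) | k s. s < n}"
  then obtain k s where ks: "s < n" "\<gamma> = pole_orders_at (monomial k s)" by blast
  then show "\<gamma> \<in> Gamma_hat K places"
    using nabla_monomial[OF ks(1)] monomial_regular
    by (auto simp: Gamma_hat_def absolute_maximal_def generalized_semigroup_eq length_places)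
qed

lemma pole_orders_at_monomial:
  "pole_orders_at (monomial k s) =
    (int n * (\<Sum>l\<in>{1..m}. k l) + int (M * N) * int (s div M) + int (q\<^sup>2 * N) * int (s mod M))
    # map (\<lambda>l. - (int n * k l) - int s) [1..<m+1]"
  by (auto simp: pole_orders_at_def places_def monomial_at_pole monomial_at_root)

text \<open>
  The index shift comes from \<open>e\<^sub>s\<close> having a zero of order \<open>s\<close> where the tuple records a pole order
  congruent to \<open>i M + j\<close>: one has \<open>- n k - s = n (- k - 1) + (n - s)\<close>.
\<close>

lemma gamma_tuple_eq:
  assumes ij: "i \<le> q" "1 \<le> j" "j \<le> M" and s: "s = (q - i) * M + (M - j)"
  shows "gamma_tuple p b q M m (int i) (int j) k = pole_orders_at (monomial (\<lambda>l. - k (l + 1) - 1) s)"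
proof -
  have sdiv: "s div M = q - i" "s mod M = M - j"
  proof -
    have "(u * M + r) div M = u \<and> (u * M + r) mod M = r" if "r < M" for u r
      using that by simp
    moreover have "M - j < M" using ij M by simp
    ultimately show "s div M = q - i" "s mod M = M - j" unfolding s by blast+
  qed
  have int_s: "int s = int n - int i * int M - int j"
  proof -
    have "(q - i) * M + i * M = q * M" using ij by (simp flip: add_mult_distrib)
    then have "s + i * M + j = n" using ij by (simp add: s n_def)
    then have "int (s + i * M + j) = int n" by simp
    then show ?thesis by simp
  qed
  have sum: "(\<Sum>l=2..m+1. k l) = (\<Sum>l\<in>{1..m}. k (l + 1))"
    using sum.shift_bounds_cl_Suc_ivl[of k 1 m] by (simp add: numeral_2_eq_2)
  have pb: "int p ^ b \<noteq> 0" using p_gt_1 by simp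
  have qN: "int q = int N * int p ^ b" using q_eq by simp
  define S where "S = (\<Sum>l\<in>{1..m}. k (l + 1))"
  have "((int q)\<^sup>2 - int m * int p ^ b - int p ^ b * (\<Sum>l=2..m+1. k l)) * (int q + 1) * int M
        - int i * int q * int M - int j * int q ^ 3
      = (int q * (int N * int p ^ b) - int m * int p ^ b - int p ^ b * S) * (int q + 1) * int M
        - int i * (int N * int p ^ b) * int M - int j * (int q)\<^sup>2 * (int N * int p ^ b)"
    unfolding sum S_def[symmetric] qN[symmetric] by (simp add: power2_eq_square power3_eq_cube)
  also have "\<dots> = ((int N * int q - int m - S) * (int q + 1) * int M - int N * int i * int M - int N * int j * (int q)\<^sup>2) * int p ^ b"
    by (simp add: algebra_simps)
  finally have num: "(((int q)\<^sup>2 - int m * int p ^ b - int p ^ b * (\<Sum>l=2..m+1. k l)) * (int q + 1) * int M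
        - int i * int q * int M - int j * int q ^ 3) div int p ^ b
      = (int N * int q - int m - S) * (int q + 1) * int M - int N * int i * int M - int N * int j * (int q)\<^sup>2"
    using pb by simp
  have S: "(\<Sum>l\<in>{1..m}. - k (l + 1) - 1) = - S - int m" by (simp add: S_def sum_subtractf sum_negf)
  then have first: "int n * (\<Sum>l\<in>{1..m}. - k (l + 1) - 1) + int (M * N) * int (q - i) + int (q\<^sup>2 * N) * int (M - j)
      = (int N * int q - int m - S) * (int q + 1) * int M - int N * int i * int M - int N * int j * (int q)\<^sup>2"
    unfolding S using ij by (simp add: n_def of_nat_diff algebra_simps power2_eq_square)
  have "[2..<m+2] = map Suc [1..<m+1]" by (simp add: map_Suc_upt numeral_2_eq_2)
  then have rest: "map (\<lambda>l. k l * (int q + 1) * int M + int i * int M + int j) [2..<m+2]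
      = map (\<lambda>l. - (int n * (- k (l + 1) - 1)) - int s) [1..<m+1]"
    by (simp add: int_s n_def algebra_simps)
  show ?thesis unfolding gamma_tuple_def pole_orders_at_monomial sdiv num first rest ..
qed

lemma sum_zero:
  assumes "\<forall>l\<in>{1..m}. k l \<le> 0" "0 \<le> (\<Sum>l\<in>{1..m}. (k l :: int))" "l \<in> {1..m}"
  shows "k l = 0"
proof -
  have "(\<Sum>l\<in>{1..m}. - k l) = 0" using assms sum_nonneg[of "{1..m}" "\<lambda>l. - k l"] by (simp add: sum_negf)
  then show ?thesis using assms sum_nonneg_eq_0_iff[of "{1..m}" "\<lambda>l. - k l"] by auto
qed

theorem Gamma_set_eq:
  "Gamma_set K places = insert (replicate (m + 1) 0)
      {\<gamma>. \<exists>i j k. (i, j) \<in> index_set q M \<and> \<gamma> = gamma_tuple p b q M m i j k \<and> (\<forall>e\<in>set \<gamma>. 0 \<le> e)}"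
proof (intro equalityI subsetI)
  fix \<gamma> assume "\<gamma> \<in> Gamma_set K places"
  then obtain k s where s: "s < n" and \<gamma>: "\<gamma> = pole_orders_at (monomial k s)" and pos: "\<forall>e\<in>set \<gamma>. 0 \<le> e"
    by (auto simp: Gamma_set_def Gamma_hat_eq)
  show "\<gamma> \<in> insert (replicate (m + 1) 0)
      {\<gamma>. \<exists>i j k. (i, j) \<in> index_set q M \<and> \<gamma> = gamma_tuple p b q M m i j k \<and> (\<forall>e\<in>set \<gamma>. 0 \<le> e)}"
  proof (cases "s = 0")
    case True
    have "\<forall>l\<in>{1..m}. k l \<le> 0" "0 \<le> (\<Sum>l\<in>{1..m}. k l)"
      using pos n_pos by (auto simp: \<gamma> pole_orders_at_monomial True mult_le_0_iff zero_le_mult_iff)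
    then have "k l = 0" if "l \<in> {1..m}" for l using sum_zero that by blast
    then have "\<gamma> = 0 # map (\<lambda>l. 0) [1..<m+1]" by (auto simp: \<gamma> pole_orders_at_monomial True)
    then have "\<gamma> = replicate (m + 1) 0" by (simp add: map_replicate_const)
    then show ?thesis by simp
  next
    case False
    \<comment> \<open>The shift by \<open>1\<close> makes the last digit range over \<open>1, \<dots>, M\<close> instead of \<open>0, \<dots>, M - 1\<close>.\<close>
    define i where "i = (n - s - 1) div M"
    define j where "j = (n - s - 1) mod M + 1"
    have ijs: "i * M + j = n - s" using False s by (simp add: i_def j_def)
    have j: "1 \<le> j" "j \<le> M" using M by (auto simp: j_def Suc_le_eq)
    have "i < q + 1" unfolding i_def using s by (intro less_mult_imp_div_less) (simp add: n_def)
    then have i: "i \<le> q" by simp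
    have ne: "\<not> (i = q \<and> j = M)"
    proof
      assume "i = q \<and> j = M"
      then have "n = n - s" using ijs by (simp add: n_def)
      then show False using False s by simp
    qed
    have "s = (q - i) * M + (M - j)"
    proof -
      have "(q - i) * M + i * M = q * M" using i by (simp flip: add_mult_distrib)
      moreover have "s + (i * M + j) = q * M + M" using ijs s by (simp add: n_def)
      ultimately show ?thesis using j by linarith
    qed
    from gamma_tuple_eq[OF i j this, of "\<lambda>l. - k (l - 1) - 1"]
    have "\<gamma> = gamma_tuple p b q M m (int i) (int j) (\<lambda>l. - k (l - 1) - 1)" by (simp add: \<gamma>)
    moreover have "(int i, int j) \<in> index_set q M" using i j ne by (auto simp: index_set_def)
    ultimately show ?thesis using pos by blast
  qed
next
  fix \<gamma> assume "\<gamma> \<in> insert (replicate (m + 1) 0)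
      {\<gamma>. \<exists>i j k. (i, j) \<in> index_set q M \<and> \<gamma> = gamma_tuple p b q M m i j k \<and> (\<forall>e\<in>set \<gamma>. 0 \<le> e)}"
  then consider "\<gamma> = replicate (m + 1) 0"
    | i j k where "(i, j) \<in> index_set q M" "\<gamma> = gamma_tuple p b q M m i j k" "\<forall>e\<in>set \<gamma>. 0 \<le> e" by blast
  then show "\<gamma> \<in> Gamma_set K places"
  proof cases
    case 1
    have "pole_orders_at (monomial (\<lambda>_. 0) 0) = replicate (m + 1) 0"
      by (simp add: pole_orders_at_monomial map_replicate_const)
    then have "replicate (m + 1) 0 \<in> Gamma_hat K places"
      unfolding Gamma_hat_eq mem_Collect_eq using n_pos
      by (intro exI[of _ "\<lambda>_. 0"] exI[of _ 0]) simp
    then show ?thesis unfolding Gamma_set_def 1 by simp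
  next
    case 2
    define i' j' where "i' = nat i" and "j' = nat j"
    have ij: "i = int i'" "j = int j'" "i' \<le> q" "1 \<le> j'" "j' \<le> M" "\<not> (i' = q \<and> j' = M)"
      using 2(1) by (auto simp: index_set_def i'_def j'_def)
    define s where "s = (q - i') * M + (M - j')"
    have "s + (i' * M + j') = n" using ij by (simp add: s_def n_def flip: add_mult_distrib)
    then have "s < n" using ij by simp
    then show ?thesis
      using gamma_tuple_eq[OF ij(3-5) s_def, of k] 2 ij unfolding Gamma_set_def Gamma_hat_eq by auto
  qed
qed

end

section \<open>The minimal generating set\<close>

text \<open>Translation by \<open>1\<close> permutes \<open>K\<close> and adds \<open>1\<close> to each term of the sum of all elements.\<close>

lemma of_nat_card_subfield:
  fixes K :: "'f::field set"
  assumes K: "is_subfield K" "finite K"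
  shows "of_nat (card K) = (0 :: 'f)"
proof -
  note cl = is_subring_closed[OF is_subring_subfield[OF K(1)]]
  have "(\<lambda>u. u + 1) ` K = K"
  proof (intro equalityI subsetI)
    fix u assume "u \<in> K"
    then have "u = (u - 1) + 1" "u - 1 \<in> K" using cl by auto
    then show "u \<in> (\<lambda>u. u + 1) ` K" by blast
  qed (use cl in auto)
  then have "\<Sum>K = (\<Sum>u\<in>(\<lambda>u. u + 1) ` K. u)" by simp
  also have "\<dots> = (\<Sum>u\<in>K. u + 1)" by (simp add: sum.reindex inj_on_def)
  also have "\<dots> = \<Sum>K + of_nat (card K)" by (simp add: sum.distrib)
  finally show ?thesis by simp
qed

lemma odd_power_plus_1_dvd:
  assumes "odd n"
  shows "(q + 1) dvd (q ^ n + 1 :: nat)"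
proof -
  obtain k where "n = 2 * k + 1" using assms by (auto elim: oddE)
  moreover have "(q + 1) dvd (q ^ (2 * k + 1) + 1 :: nat)"
  proof (induction k)
    case (Suc k)
    have "q ^ (2 * Suc k + 1) + 1 + (q + 1) * q ^ (2 * k + 1) = q * (q + 1) * q ^ (2 * k + 1) + (q ^ (2 * k + 1) + 1)"
      by (simp add: algebra_simps)
    moreover have "(q + 1) dvd q * (q + 1) * q ^ (2 * k + 1) + (q ^ (2 * k + 1) + 1)"
      by (rule dvd_add[OF dvd_mult2[OF dvd_triv_right] Suc])
    ultimately have "(q + 1) dvd q ^ (2 * Suc k + 1) + 1 + (q + 1) * q ^ (2 * k + 1)" by (simp only:)
    then show ?case by (metis dvd_add_left_iff dvd_triv_left)
  qed simp
  ultimately show ?thesis by simp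
qed

theorem corollary3p5:
  fixes p a b n s q M m :: nat
    and K :: "'f::field set"
    and c x y z :: 'f
    and \<alpha> :: "nat \<Rightarrow> 'f"
    and Pinf :: "'f \<Rightarrow> int"
    and P :: "nat \<Rightarrow> 'f \<Rightarrow> int"
  assumes "prime p" and "a \<ge> 1" and "q = p ^ a"
    and "n \<ge> 1" and "b \<ge> 1" and "s \<ge> 1"
    and "odd n" and "b dvd a" and "s dvd (q ^ n + 1) div (q + 1)"
    and "M = (q ^ n + 1) div (s * (q + 1))"
    and "curve_function_field p a b M K c x y z"
    and "card K = q ^ (2 * n)"
    and "c \<in> K" and "c ^ (q\<^sup>2) = c" and "c ^ (q - 1) = - 1"
    and "is_place K Pinf"
    and "is_pole_at Pinf x" and "is_pole_at Pinf y" and "is_pole_at Pinf z"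
    and "bij_betw \<alpha> {1..q div p ^ b} {u \<in> K. additive_t p a b u = 0}"
    and "\<And>i. i \<in> {1..q div p ^ b} \<Longrightarrow>
           is_place K (P i) \<and> vanishes_at (P i) (x - \<alpha> i) \<and> vanishes_at (P i) y \<and> vanishes_at (P i) z"
    and "1 \<le> m" and "m \<le> q div p ^ b"
  shows "Gamma_set K (Pinf # map P [1..<m+1]) =
    insert (replicate (m + 1) 0)
      {\<gamma>. \<exists>i j k. (i, j) \<in> index_set q M \<and> \<gamma> = gamma_tuple p b q M m i j k \<and> (\<forall>e\<in>set \<gamma>. 0 \<le> e)}"
proof -
  have q1: "q > 1" unfolding assms(3) using prime_gt_1_nat[OF assms(1)] assms(2) by (intro one_less_power) auto
  have K: "is_subfield K" using assms(11) by (simp add: curve_function_field_def)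
  have "card K > 0" using q1 assms(12) by simp
  then have "finite K" by (rule card_ge_0_finite)
  then have "of_nat (p ^ (a * (2 * n))) = (0 :: 'f)"
    using of_nat_card_subfield[OF K] assms(3,12) by (simp add: power_mult)
  then have "of_nat p = (0 :: 'f)" by simp
  then have "CHAR('f) dvd p" by (simp add: of_nat_eq_0_iff_char_dvd)
  then have char: "CHAR('f) = p" using assms(1) by (metis CHAR_not_1' One_nat_def prime_nat_iff)
  have Mn: "M * (s * (q + 1)) = q ^ n + 1"
  proof -
    have "s * (q + 1) dvd q ^ n + 1"
      using assms(9) odd_power_plus_1_dvd[OF assms(7), of q]
      by (metis dvd_div_mult_self mult_dvd_mono dvd_refl)
    then show ?thesis unfolding assms(10) by simp
  qed
  then have M: "M > 0" by (cases M) auto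
  have "coprime (u + 1) u" for u :: nat by simp
  then have "coprime (q ^ n + 1) (q ^ n)" .
  then have "coprime M q" using assms(4) Mn by (metis coprime_mult_left_iff coprime_power_right_iff less_one not_le)
  then have Mp: "coprime M p" using assms(2,3) by simp
  have c0: "c \<noteq> 0" using assms(15) q1 by (auto simp: power_0_left)
  have Pinf: "is_place K Pinf" "Pinf x < 0" using assms(16,17) by (auto simp: is_pole_at_def)
  interpret curve p a b q M K c x y z
    by unfold_locales (use assms M Mp char c0 Pinf in auto)
  have range: "l \<in> {1..q div p ^ b}" if "l \<in> {1..m}" for l using that assms(23) by simp
  interpret curve_points p a b q M K c x y z m \<alpha> P Pinf
  proof unfold_locales
    show "inj_on \<alpha> {1..m}" using assms(20,23) by (auto simp: bij_betw_def intro: inj_on_subset)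
    show "\<alpha> l \<in> K \<and> additive_t p a b (\<alpha> l) = 0" if "l \<in> {1..m}" for l
      using range[OF that] assms(20) by (auto simp: bij_betw_def)
    then have "x - \<alpha> l \<noteq> 0" if "l \<in> {1..m}" for l
      using that transcendental[OF linear_poly_over[OF K_sub], of "\<alpha> l"] by simp
    then show "is_place K (P l) \<and> 0 < P l (x - \<alpha> l)" if "l \<in> {1..m}" for l
      using that assms(21)[OF range[OF that]] by (auto simp: vanishes_at_def)
  qed (use assms(22) Pinf in auto)
  show ?thesis using Gamma_set_eq unfolding places_def .
qed

end
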